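(* Let $1<p<n$ and $R>0$. Then $$ \left(\frac{p-1}{p}\right)^p\int_{B_R}\frac{|u(x)|^p}{|x|^p\left[\log_{\frac{n-1}{p-1}}\frac{R}{|x|}\right]^p}\,dx\le\int_{B_R}|\nabla_ru(x)|^p\,dx\qquad\text{for all }u\in W^{1,p}_0(B_R). $$ The constant $\left(\frac{p-1}{p}\right)^p$ is optimal (it cannot be replaced by a larger one), and the inequality is invariant under the scaling, for $\lambda>0$, $$ u_\lambda(x):=\lambda^{-\frac{p-1}{p}}u(x_\lambda),\qquad x_\lambda:=\left[\lambda|x|^{-\frac{n-p}{p-1}}+(1-\lambda)R^{-\frac{n-p}{p-1}}\right]^{-\frac{p-1}{n-p}}\frac{x}{|x|}, $$ that is, each of its two sides takes the same value for $u_\lambda$ as for $u$.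
   Context: $B_R$ is the open ball in $\mathbb{R}^n$ centered at the origin with radius $R>0$. For $q>0$, $q\ne1$ and $r>0$, the $q$-logarithm is $\log_q r:=\frac{r^{1-q}-1}{1-q}$. The radial derivative is $\nabla_ru(x):=\left(\frac{x}{|x|}\cdot\nabla u(x)\right)\frac{x}{|x|}$ for $x\neq 0$. *)

theory Defs
  imports "HOL-Analysis.Analysis"
begin

definition qlog :: "real \<Rightarrow> real \<Rightarrow> real" where
  "qlog q r = (r powr (1 - q) - 1) / (1 - q)"

primrec Ck_fun :: "nat \<Rightarrow> ('a::euclidean_space \<Rightarrow> real) \<Rightarrow> bool" where
  "Ck_fun 0 f \<longleftrightarrow> continuous_on UNIV f"
| "Ck_fun (Suc k) f \<longleftrightarrow> (\<forall>x. f differentiable (at x)) \<and>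
     (\<forall>b\<in>Basis. Ck_fun k (\<lambda>x. frechet_derivative f (at x) b))"

definition test_functions :: "'a::euclidean_space set \<Rightarrow> ('a \<Rightarrow> real) set" where
  "test_functions \<Omega> = {\<phi>. (\<forall>k. Ck_fun k \<phi>) \<and>
     compact (closure {x. \<phi> x \<noteq> 0}) \<and> closure {x. \<phi> x \<noteq> 0} \<subseteq> \<Omega>}"

definition locally_integrable ::
    "'a::euclidean_space set \<Rightarrow> ('a \<Rightarrow> 'b::euclidean_space) \<Rightarrow> bool" where
  "locally_integrable \<Omega> f \<longleftrightarrow>
     (\<forall>K. compact K \<and> K \<subseteq> \<Omega> \<longrightarrow> integrable (lebesgue_on K) f)"

definition has_weak_gradient ::
    "'a::euclidean_space set \<Rightarrow> ('a \<Rightarrow> real) \<Rightarrow> ('a \<Rightarrow> 'a) \<Rightarrow> bool" where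
  "has_weak_gradient \<Omega> u G \<longleftrightarrow> locally_integrable \<Omega> u \<and> locally_integrable \<Omega> G \<and>
     (\<forall>\<phi>\<in>test_functions \<Omega>. \<forall>b\<in>Basis.
        (LINT x|lebesgue_on \<Omega>. u x * frechet_derivative \<phi> (at x) b)
          = - (LINT x|lebesgue_on \<Omega>. (G x \<bullet> b) * \<phi> x))"

text \<open>For open \<open>\<Omega>\<close> a weak gradient, if there is one, is unique up to a null set of \<open>\<Omega>\<close>;
  \<open>weak_gradient\<close> picks a representative. Its values outside \<open>\<Omega>\<close> are meaningless.\<close>

definition weak_gradient ::
    "'a::euclidean_space set \<Rightarrow> ('a \<Rightarrow> real) \<Rightarrow> 'a \<Rightarrow> 'a" where
  "weak_gradient \<Omega> u = (SOME G. has_weak_gradient \<Omega> u G)"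

definition in_Lp ::
    "'a::euclidean_space set \<Rightarrow> real \<Rightarrow> ('a \<Rightarrow> 'b::euclidean_space) \<Rightarrow> bool" where
  "in_Lp \<Omega> p f \<longleftrightarrow> f \<in> borel_measurable (lebesgue_on \<Omega>) \<and>
     integrable (lebesgue_on \<Omega>) (\<lambda>x. norm (f x) powr p)"

text \<open>The elements of the Sobolev spaces are functions rather than classes modulo equality
  almost everywhere; their values outside \<open>\<Omega>\<close> play no role.\<close>

definition sobolev_W1 :: "'a::euclidean_space set \<Rightarrow> real \<Rightarrow> ('a \<Rightarrow> real) set" where
  "sobolev_W1 \<Omega> p =
     {u. in_Lp \<Omega> p u \<and> (\<exists>G. has_weak_gradient \<Omega> u G \<and> in_Lp \<Omega> p G)}"

definition sobolev_norm :: "'a::euclidean_space set \<Rightarrow> real \<Rightarrow> ('a \<Rightarrow> real) \<Rightarrow> real" where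
  "sobolev_norm \<Omega> p u =
     (LINT x|lebesgue_on \<Omega>. \<bar>u x\<bar> powr p + norm (weak_gradient \<Omega> u x) powr p) powr (1 / p)"

text \<open>The closure of the test functions in the Sobolev norm.\<close>

definition sobolev_W1_0 :: "'a::euclidean_space set \<Rightarrow> real \<Rightarrow> ('a \<Rightarrow> real) set" where
  "sobolev_W1_0 \<Omega> p = {u \<in> sobolev_W1 \<Omega> p.
     \<forall>e>0. \<exists>\<phi>\<in>test_functions \<Omega>. sobolev_norm \<Omega> p (\<lambda>x. u x - \<phi> x) < e}"

definition radial_gradient ::
    "'a::euclidean_space set \<Rightarrow> ('a \<Rightarrow> real) \<Rightarrow> 'a \<Rightarrow> 'a" where
  "radial_gradient \<Omega> u x =
     ((x /\<^sub>R norm x) \<bullet> weak_gradient \<Omega> u x) *\<^sub>R (x /\<^sub>R norm x)"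

text \<open>Both sides of the inequality (the left one without its constant) are integrals with
  values in the extended nonnegative reals, so finiteness of the left-hand side is part of
  the inequality and not presupposed.\<close>

definition hardy_lhs :: "real \<Rightarrow> real \<Rightarrow> (real ^ 'n \<Rightarrow> real) \<Rightarrow> ennreal" where
  "hardy_lhs p R u = (\<integral>\<^sup>+ x. ennreal (\<bar>u x\<bar> powr p /
       (norm x powr p * qlog ((real CARD('n) - 1) / (p - 1)) (R / norm x) powr p))
     \<partial>lebesgue_on (ball 0 R))"

definition hardy_rhs :: "real \<Rightarrow> real \<Rightarrow> (real ^ 'n \<Rightarrow> real) \<Rightarrow> ennreal" where
  "hardy_rhs p R u =
     (\<integral>\<^sup>+ x. ennreal (norm (radial_gradient (ball 0 R) u x) powr p) \<partial>lebesgue_on (ball 0 R))"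

definition scaled_point :: "real \<Rightarrow> real \<Rightarrow> real \<Rightarrow> real ^ 'n \<Rightarrow> real ^ 'n" where
  "scaled_point p R l x =
     (l * norm x powr (- ((real CARD('n) - p) / (p - 1)))
       + (1 - l) * R powr (- ((real CARD('n) - p) / (p - 1))))
       powr (- ((p - 1) / (real CARD('n) - p))) *\<^sub>R (x /\<^sub>R norm x)"

definition scaled_fun :: "real \<Rightarrow> real \<Rightarrow> real \<Rightarrow> (real ^ 'n \<Rightarrow> real) \<Rightarrow> real ^ 'n \<Rightarrow> real" where
  "scaled_fun p R l u x = l powr (- ((p - 1) / p)) * u (scaled_point p R l x)"

end

(* With a = (n - p) / (p - 1), the variable t = |x|^(-a) - R^(-a) turns both sides into those of
   the one-dimensional Hardy inequality on (0, oo), where t = 0 is the sphere |x| = R and t = oo is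
   the origin, and the scaling of the statement becomes t -> l t.

   Inequality: for a test function phi vanishing near the origin, integrate the divergence of
   |phi|^p V, where V is the radial field with div V = (p - 1) w and |V| = w^((p - 1) / p), w being
   the weight on the left-hand side, and apply Young's inequality pointwise. Since p < n, a point
   has zero p-capacity, so such functions are dense in W_0^{1,p}.

   Invariance: the scaling is a diffeomorphism of the punctured ball that is smooth and has bounded
   derivatives, so it maps test functions supported off the origin to such functions.

   Optimality: cut off the virtual extremal t^((p - 1) / p) at |ln t| = 2 k and let k -> oo; the
   measure with density w t^(p - 1) is invariant under t -> l t, so the part of it that the
   cutoff affects is comparable to the whole. *)

theory Submission
  imports Defs
begin

section \<open>Smooth functions on open sets\<close>

text \<open>The exponent a is that of the fundamental solution of the p-Laplacian, so t is the
  radial p-harmonic function that vanishes on the sphere and is singular at the origin. This has two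
  consequences. The p-th root of the weight is |d ln t / dr|, so multiplying t by a constant changes
  it only by the chain rule. And V equals -|grad t|^(p-2) grad t / t^(p-1), whose divergence
  contains no second-order term of t.

  The exponents match through (1 + a)(p - 1) = n - 1: the Jacobian of the scaling is l^(1-p) times
  the p-th power of its radial derivative. Tangential derivatives scale by another factor, so the
  invariance concerns the radial gradient.

  The obstacles lie in the function space. \<open>weak_gradient\<close> is a choice, so it is
  evaluated through uniqueness almost everywhere. The weight is unbounded at the sphere and at the
  origin, so the passage from test functions to Sobolev functions uses truncated weights and
  monotone convergence. The triangle inequality for p-th powers is used in a convexity form with a
  parameter \<theta>; its leading factor tends to 1, so the sharp constant survives.\<close>

primrec Ck_on :: "'a::euclidean_space set \<Rightarrow> nat \<Rightarrow> ('a \<Rightarrow> real) \<Rightarrow> bool" where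
  "Ck_on U 0 f \<longleftrightarrow> continuous_on U f"
| "Ck_on U (Suc k) f \<longleftrightarrow> (\<forall>x\<in>U. f differentiable (at x)) \<and>
     (\<forall>b\<in>Basis. Ck_on U k (\<lambda>x. frechet_derivative f (at x) b))"

text \<open>The notion is relative to a set because powers of the norm, logarithms and the scaling
  are smooth only off the origin or on a half line; test functions are later glued from such pieces
  and zero.\<close>

definition smooth_on :: "'a::euclidean_space set \<Rightarrow> ('a \<Rightarrow> real) \<Rightarrow> bool" where
  "smooth_on U f \<longleftrightarrow> (\<forall>k. Ck_on U k f)"

lemma Ck_fun_eq_Ck_on: "Ck_fun k f = Ck_on UNIV k f"
  by (induction k arbitrary: f) auto

text \<open>\<open>frechet_derivative\<close> is a choice among the derivatives at a point; f and g
  have the same ones at x, so the choices agree, even where there is no derivative.\<close>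

lemma frechet_derivative_cong_open:
  assumes "open U" "x \<in> U" "\<And>y. y \<in> U \<Longrightarrow> f y = g y"
  shows "frechet_derivative f (at x) = frechet_derivative g (at x)"
proof -
  have "(f has_derivative D) (at x) \<longleftrightarrow> (g has_derivative D) (at x)" for D
    using has_derivative_transform_within_open[of f D x UNIV U g]
      has_derivative_transform_within_open[of g D x UNIV U f] assms by auto
  then show ?thesis by (simp add: frechet_derivative_def)
qed

lemma Ck_on_cong:
  assumes "open U" "\<And>x. x \<in> U \<Longrightarrow> f x = g x" "Ck_on U k f"
  shows "Ck_on U k g"
  using assms(2,3)
proof (induction k arbitrary: f g)
  case 0 then show ?case using continuous_on_cong by force
next
  case (Suc k)
  have "g differentiable (at x)" if "x \<in> U" for x
  proof -
    have "(f has_derivative frechet_derivative f (at x)) (at x)"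
      using Suc.prems(2) that by (simp add: frechet_derivative_works)
    then have "(g has_derivative frechet_derivative f (at x)) (at x)"
      by (rule has_derivative_transform_within_open[OF _ assms(1) that]) (use Suc.prems(1) in auto)
    then show ?thesis by (auto simp: differentiable_def)
  qed
  moreover have "Ck_on U k (\<lambda>x. frechet_derivative g (at x) b)" if "b \<in> Basis" for b
  proof (rule Suc.IH)
    show "frechet_derivative f (at x) b = frechet_derivative g (at x) b" if "x \<in> U" for x
      using frechet_derivative_cong_open[OF assms(1) that Suc.prems(1)] by simp
    show "Ck_on U k (\<lambda>x. frechet_derivative f (at x) b)" using Suc.prems(2) that by simp
  qed
  ultimately show ?case by simp
qed

lemma smooth_on_cong:
  "open U \<Longrightarrow> (\<And>x. x \<in> U \<Longrightarrow> f x = g x) \<Longrightarrow> smooth_on U f \<Longrightarrow> smooth_on U g"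
  unfolding smooth_on_def using Ck_on_cong by blast

lemma Ck_on_SucI:
  assumes "open U" "\<And>x. x \<in> U \<Longrightarrow> (f has_derivative f' x) (at x)"
    "\<And>b. b \<in> Basis \<Longrightarrow> Ck_on U k (\<lambda>x. f' x b)"
  shows "Ck_on U (Suc k) f"
proof -
  have "frechet_derivative f (at x) = f' x" if "x \<in> U" for x
    using assms(2)[OF that] frechet_derivative_at by metis
  then show ?thesis using assms
    by (auto simp: differentiable_def intro!: Ck_on_cong[OF assms(1) _ assms(3)])
qed

lemma Ck_on_SucD: "Ck_on U (Suc k) f \<Longrightarrow> Ck_on U k f"
proof (induction k arbitrary: f)
  case 0 then show ?case
    by (auto intro!: continuous_at_imp_continuous_on differentiable_imp_continuous_within)
qed auto

lemma Ck_on_frechet: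
  "Ck_on U (Suc k) f \<Longrightarrow> x \<in> U \<Longrightarrow> (f has_derivative frechet_derivative f (at x)) (at x)"
  by (simp add: frechet_derivative_works)

lemma Ck_on_subset: "V \<subseteq> U \<Longrightarrow> Ck_on U k f \<Longrightarrow> Ck_on V k f"
  by (induction k arbitrary: f) (auto intro: continuous_on_subset)

lemma smooth_on_subset: "smooth_on U f \<Longrightarrow> V \<subseteq> U \<Longrightarrow> smooth_on V f"
  unfolding smooth_on_def using Ck_on_subset by blast

lemma Ck_on_Un: "open U \<Longrightarrow> open V \<Longrightarrow> Ck_on U k f \<Longrightarrow> Ck_on V k f \<Longrightarrow> Ck_on (U \<union> V) k f"
  by (induction k arbitrary: f) (auto intro: continuous_on_open_Un)

text \<open>Gluing: applied to an open set and the complement of a compact subset on which the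
  function is 0, it gives smoothness of an extension by zero.\<close>

lemma smooth_on_Un:
  "open U \<Longrightarrow> open V \<Longrightarrow> smooth_on U f \<Longrightarrow> smooth_on V f \<Longrightarrow> smooth_on (U \<union> V) f"
  unfolding smooth_on_def using Ck_on_Un by blast

lemma Ck_on_const: "open U \<Longrightarrow> Ck_on U k (\<lambda>x. c)"
proof (induction k arbitrary: c)
  case (Suc k) show ?case
    by (rule Ck_on_SucI[where f'="\<lambda>_ _. 0"]) (use Suc in auto)
qed auto

lemma Ck_on_add: "open U \<Longrightarrow> Ck_on U k f \<Longrightarrow> Ck_on U k g \<Longrightarrow> Ck_on U k (\<lambda>x. f x + g x)"
proof (induction k arbitrary: f g)
  case (Suc k)
  have "((\<lambda>x. f x + g x) has_derivative
      (\<lambda>h. frechet_derivative f (at x) h + frechet_derivative g (at x) h)) (at x)" if "x \<in> U" for x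
    by (intro has_derivative_add Ck_on_frechet[OF _ that]) (fact Suc.prems)+
  then show ?case using Suc by (intro Ck_on_SucI) auto
qed (auto intro: continuous_intros)

lemma Ck_on_mult: "open U \<Longrightarrow> Ck_on U k f \<Longrightarrow> Ck_on U k g \<Longrightarrow> Ck_on U k (\<lambda>x. f x * g x)"
proof (induction k arbitrary: f g)
  case (Suc k)
  have "((\<lambda>x. f x * g x) has_derivative
      (\<lambda>h. f x * frechet_derivative g (at x) h + frechet_derivative f (at x) h * g x)) (at x)"
    if "x \<in> U" for x
    by (intro has_derivative_mult Ck_on_frechet[OF _ that]) (fact Suc.prems)+
  note der = this
  \<comment> \<open>The product rule keeps one factor undifferentiated, so the induction hypothesis
    is applied to the factors one order lower.\<close>
  have "Ck_on U k f" "Ck_on U k g" using Suc.prems Ck_on_SucD by blast+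
  then show ?case
    using Suc.prems by (intro Ck_on_SucI[OF Suc.prems(1) der]) (auto intro!: Ck_on_add Suc.IH)
qed (auto intro: continuous_intros)

lemma Ck_on_sum:
  "open U \<Longrightarrow> (\<And>i. i \<in> I \<Longrightarrow> Ck_on U k (f i)) \<Longrightarrow> Ck_on U k (\<lambda>x. \<Sum>i\<in>I. f i x)"
  by (induction I rule: infinite_finite_induct) (auto intro: Ck_on_const Ck_on_add)

lemma Ck_on_inner: "open U \<Longrightarrow> Ck_on U k (\<lambda>x. x \<bullet> c)"
proof (cases k)
  case (Suc j) assume "open U"
  then show ?thesis unfolding Suc
    by (intro Ck_on_SucI[where f'="\<lambda>x h. h \<bullet> c"] Ck_on_const)
       (auto intro: derivative_intros)
qed (auto intro!: continuous_intros)

text \<open>By the chain rule each partial derivative is a finite sum of products of a partial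
  derivative of a component of S and a partial derivative of f composed with S. The induction runs
  over all f at once, so that it covers these partial derivatives.\<close>

lemma Ck_on_compose:
  fixes f :: "'b::euclidean_space \<Rightarrow> real" and S :: "'a::euclidean_space \<Rightarrow> 'b"
  assumes "open U" "open V" "S ` U \<subseteq> V" "Ck_on V k f" "\<And>c. c \<in> Basis \<Longrightarrow> Ck_on U k (\<lambda>x. S x \<bullet> c)"
  shows "Ck_on U k (\<lambda>x. f (S x))"
  using assms(4,5)
proof (induction k arbitrary: f)
  case 0
  then have "continuous_on U S" using continuous_on_componentwise[of U S] by auto
  with 0 assms(3) show ?case by (auto intro: continuous_on_compose2)
next
  case (Suc k)
  define D where "D x h = (\<Sum>c\<in>Basis. frechet_derivative (\<lambda>x. S x \<bullet> c) (at x) h *\<^sub>R c)" for x h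
  have S: "(S has_derivative D x) (at x)" if "x \<in> U" for x
  proof (subst has_derivative_componentwise_within, rule ballI)
    fix c :: 'b assume c: "c \<in> Basis"
    then have "D x h \<bullet> c = frechet_derivative (\<lambda>x. S x \<bullet> c) (at x) h" for h
      unfolding D_def by (simp add: inner_sum_left inner_Basis if_distrib cong: if_cong)
    then show "((\<lambda>x. S x \<bullet> c) has_derivative (\<lambda>y. D x y \<bullet> c)) (at x)"
      using Ck_on_frechet[OF Suc.prems(2)[OF c] that] by simp
  qed
  have f: "(f has_derivative frechet_derivative f (at (S x))) (at (S x))" if "x \<in> U" for x
    using Ck_on_frechet[OF Suc.prems(1)] that assms(3) by auto
  have "((\<lambda>x. f (S x)) has_derivative (\<lambda>h. \<Sum>c\<in>Basis.
      frechet_derivative (\<lambda>x. S x \<bullet> c) (at x) h * frechet_derivative f (at (S x)) c)) (at x)"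
    if "x \<in> U" for x
  proof -
    have lin: "linear (frechet_derivative f (at (S x)))"
      using f[OF that] has_derivative_linear by blast
    have "((\<lambda>x. f (S x)) has_derivative (\<lambda>h. frechet_derivative f (at (S x)) (D x h))) (at x)"
      using has_derivative_compose[OF S[OF that] f[OF that]] .
    then show ?thesis unfolding D_def linear_sum[OF lin] linear_scale[OF lin] by simp
  qed
  then show ?case
  proof (rule Ck_on_SucI[OF assms(1)])
    fix b :: 'a assume b: "b \<in> Basis"
    have S': "Ck_on U k (\<lambda>x. S x \<bullet> c)" if "c \<in> Basis" for c using Suc.prems(2) that Ck_on_SucD by blast
    show "Ck_on U k (\<lambda>x. \<Sum>c\<in>Basis. frechet_derivative (\<lambda>x. S x \<bullet> c) (at x) b *
        frechet_derivative f (at (S x)) c)"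
    proof (intro Ck_on_sum[OF assms(1)] Ck_on_mult[OF assms(1)])
      fix c :: 'b assume c: "c \<in> Basis"
      show "Ck_on U k (\<lambda>x. frechet_derivative (\<lambda>x. S x \<bullet> c) (at x) b)"
        using Suc.prems(2)[OF c] b by simp
      show "Ck_on U k (\<lambda>x. frechet_derivative f (at (S x)) c)"
        by (rule Suc.IH[of "\<lambda>y. frechet_derivative f (at y) c", OF _ S']) (use Suc.prems(1) c in simp)
    qed
  qed
qed

lemma Ck_on_compose_real:
  fixes f :: "real \<Rightarrow> real"
  assumes "open U" "open V" "Ck_on V k f" "Ck_on U k g" "g ` U \<subseteq> V"
  shows "Ck_on U k (\<lambda>x. f (g x))"
  by (rule Ck_on_compose[where f=f and S=g, OF assms(1,2,5,3)]) (use assms(4) in simp)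

lemma Ck_on_real_SucI:
  fixes f :: "real \<Rightarrow> real"
  assumes "open U" "\<And>x. x \<in> U \<Longrightarrow> (f has_real_derivative f' x) (at x)" "Ck_on U k f'"
  shows "Ck_on U (Suc k) f"
  by (rule Ck_on_SucI[where f'="\<lambda>x h. f' x * h"])
     (use assms in \<open>auto simp: has_field_derivative_def\<close>)

lemma smooth_on_const: "open U \<Longrightarrow> smooth_on U (\<lambda>x. c)"
  by (simp add: smooth_on_def Ck_on_const)
lemma smooth_on_add: "open U \<Longrightarrow> smooth_on U f \<Longrightarrow> smooth_on U g \<Longrightarrow> smooth_on U (\<lambda>x. f x + g x)"
  by (simp add: smooth_on_def Ck_on_add)
lemma smooth_on_mult: "open U \<Longrightarrow> smooth_on U f \<Longrightarrow> smooth_on U g \<Longrightarrow> smooth_on U (\<lambda>x. f x * g x)"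
  by (simp add: smooth_on_def Ck_on_mult)
lemma smooth_on_diff: "open U \<Longrightarrow> smooth_on U f \<Longrightarrow> smooth_on U g \<Longrightarrow> smooth_on U (\<lambda>x. f x - g x)"
  using smooth_on_add[of U f "\<lambda>x. (-1) * g x"] smooth_on_mult[of U "\<lambda>_. -1" g] smooth_on_const[of U "-1"] by simp
lemma smooth_on_inner: "open U \<Longrightarrow> smooth_on U (\<lambda>x. x \<bullet> c)"
  by (simp add: smooth_on_def Ck_on_inner)
lemma smooth_on_compose_real:
  fixes f :: "real \<Rightarrow> real"
  assumes "open U" "open V" "smooth_on V f" "smooth_on U g" "g ` U \<subseteq> V"
  shows "smooth_on U (\<lambda>x. f (g x))"
  using Ck_on_compose_real[of U V _ f g] assms by (simp add: smooth_on_def)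
lemma smooth_on_compose:
  fixes f :: "'b::euclidean_space \<Rightarrow> real" and S :: "'a::euclidean_space \<Rightarrow> 'b"
  assumes "open U" "open V" "S ` U \<subseteq> V" "smooth_on V f" "\<And>c. c \<in> Basis \<Longrightarrow> smooth_on U (\<lambda>x. S x \<bullet> c)"
  shows "smooth_on U (\<lambda>x. f (S x))"
  using Ck_on_compose[of U V S _ f] assms by (simp add: smooth_on_def)
lemma smooth_on_prod:
  "open U \<Longrightarrow> (\<And>i. i \<in> I \<Longrightarrow> smooth_on U (f i)) \<Longrightarrow> smooth_on U (\<lambda>x. \<Prod>i\<in>I. f i x)"
  by (induction I rule: infinite_finite_induct) (auto intro: smooth_on_const smooth_on_mult)
lemma smooth_on_sum:
  "open U \<Longrightarrow> (\<And>i. i \<in> I \<Longrightarrow> smooth_on U (f i)) \<Longrightarrow> smooth_on U (\<lambda>x. \<Sum>i\<in>I. f i x)"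
  by (simp add: smooth_on_def Ck_on_sum)

lemma smooth_on_powr: "smooth_on {0<..} (\<lambda>x::real. x powr r)"
proof -
  have "Ck_on {0<..} k (\<lambda>x::real. x powr r)" for k
  proof (induction k arbitrary: r)
    case (Suc k)
    show ?case
      by (rule Ck_on_real_SucI[where f'="\<lambda>x. r * x powr (r - 1)"])
         (auto intro!: Ck_on_mult Ck_on_const Suc has_real_derivative_powr)
  qed (auto intro!: continuous_intros)
  then show ?thesis by (simp add: smooth_on_def)
qed

lemma smooth_on_ln: "smooth_on {0<..} (ln :: real \<Rightarrow> real)"
proof -
  have "Ck_on {0<..} k (ln :: real \<Rightarrow> real)" for k
  proof (cases k)
    case (Suc j)
    show ?thesis unfolding Suc
    proof (rule Ck_on_real_SucI[where f'="\<lambda>x. x powr (-1)"])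
      show "(ln has_real_derivative x powr (-1)) (at x)" if "x \<in> {0<..}" for x :: real
        using that DERIV_ln_divide[of x] by (simp add: powr_minus_divide)
      show "Ck_on {0<..} j (\<lambda>x::real. x powr (-1))"
        using smooth_on_powr by (simp only: smooth_on_def)
    qed simp
  qed (auto intro!: continuous_intros)
  then show ?thesis by (simp add: smooth_on_def)
qed

text \<open>The norm is rewritten as a power of the sum of squares, a polynomial that is positive
  off the origin.\<close>

lemma smooth_on_norm_powr:
  "smooth_on (- {0}) (\<lambda>x::'a::euclidean_space. norm x powr r)"
proof -
  have "smooth_on (- {0::'a}) (\<lambda>x. (\<Sum>b\<in>Basis. (x \<bullet> b) * (x \<bullet> b)) powr (r / 2))"
    by (intro smooth_on_compose_real[OF _ _ smooth_on_powr] smooth_on_sum smooth_on_mult smooth_on_inner)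
       (auto simp: euclidean_inner[symmetric])
  then show ?thesis
    by (rule smooth_on_cong[rotated 2])
       (auto simp: euclidean_inner[symmetric] norm_eq_sqrt_inner powr_half_sqrt[symmetric] powr_powr)
qed

section \<open>A smooth transition between two constants\<close>

definition flat :: "real \<Rightarrow> real" where
  "flat x = (if x \<le> 0 then 0 else exp (- (1 / x)))"

text \<open>The functions x^(-j) exp(-1/x), extended by 0, have derivatives that are linear
  combinations of functions of the same family. Induction on k for all j at once therefore shows
  that they are C^k; \<open>flat\<close> is the member j = 0.\<close>

lemma smooth_on_flat: "smooth_on UNIV flat"
proof -
  define F where "F j x = (if x \<le> 0 then 0 else x powr (- real j) * exp (- (1 / x)))" for j and x :: real
  have lim: "(F j \<longlongrightarrow> 0) (at_right 0)" for j
  proof -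
    have "((\<lambda>x::real. (inverse x) ^ j / exp (inverse x)) \<longlongrightarrow> 0) (at_right 0)"
      by (rule filterlim_compose[OF tendsto_power_div_exp_0 filterlim_inverse_at_top_right])
    moreover have "\<forall>\<^sub>F x in at_right 0. (inverse x) ^ j / exp (inverse x) = F j x"
      by (rule eventually_at_rightI[of 0 1])
         (auto simp: F_def powr_minus powr_realpow exp_minus field_simps)
    ultimately show ?thesis by (rule Lim_transform_eventually)
  qed
  have der: "(F j has_real_derivative (- real j * F (Suc j) x + F (j + 2) x)) (at x)" for j x
  proof -
    consider "x > 0" | "x < 0" | "x = 0" by linarith
    then show ?thesis
    proof cases
      case 1
      have "((\<lambda>x. x powr (- real j) * exp (- (1 / x))) has_real_derivative
          (- real j * F (Suc j) x + F (j + 2) x)) (at x)"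
        using 1 by (auto intro!: derivative_eq_intros simp: F_def)
          (simp add: powr_diff powr_minus field_simps power2_eq_square)
      then show ?thesis
        by (rule has_field_derivative_transform_within_open[where S="{0<..}"]) (use 1 in \<open>auto simp: F_def\<close>)
    next
      case 2
      have "((\<lambda>_. 0) has_real_derivative (- real j * F (Suc j) x + F (j + 2) x)) (at x)"
        using 2 by (auto simp: F_def)
      then show ?thesis
        by (rule has_field_derivative_transform_within_open[where S="{..<0}"]) (use 2 in \<open>auto simp: F_def\<close>)
    next
      \<comment> \<open>At 0 the difference quotient of F j is F (Suc j) on the right and 0 on the
        left, and both tend to 0.\<close>
      case 3
      have "((\<lambda>h. F j h / h) \<longlongrightarrow> 0) (at_left 0)"
        by (rule tendsto_eventually) (auto simp: F_def eventually_at_left_field intro!: exI[of _ "-1"])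
      moreover have "((\<lambda>h. F j h / h) \<longlongrightarrow> 0) (at_right 0)"
      proof (rule Lim_transform_eventually[OF lim[of "Suc j"]])
        show "\<forall>\<^sub>F x in at_right 0. F (Suc j) x = F j x / x"
          by (rule eventually_at_rightI[of 0 1]) (auto simp: F_def powr_diff powr_minus powr_add field_simps)
      qed
      ultimately have "((\<lambda>h. F j h / h) \<longlongrightarrow> 0) (at 0)" by (simp add: filterlim_split_at)
      then show ?thesis using 3 by (simp add: has_field_derivative_iff F_def)
    qed
  qed
  have "Ck_on UNIV k (F j)" for k j
  proof (induction k arbitrary: j)
    case 0 then show ?case
      using DERIV_isCont[OF der] by (simp add: continuous_at_imp_continuous_on)
  next
    case (Suc k) show ?case
      by (rule Ck_on_real_SucI[OF _ der]) (intro Ck_on_add Ck_on_mult Ck_on_const Suc open_UNIV)+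
  qed
  then have "smooth_on UNIV (F 0)" by (simp add: smooth_on_def)
  then show ?thesis by (rule smooth_on_cong[rotated 2]) (auto simp: F_def flat_def)
qed

text \<open>The denominator is positive everywhere because x and 1 - x are never both
  nonpositive.\<close>

definition smooth_step :: "real \<Rightarrow> real" where
  "smooth_step x = flat x * (flat x + flat (1 - x)) powr (- 1)"

lemma smooth_on_smooth_step: "smooth_on UNIV smooth_step"
proof -
  have "smooth_on UNIV (\<lambda>x. flat (1 - x))"
    by (intro smooth_on_compose_real[OF _ _ smooth_on_flat] smooth_on_diff smooth_on_const)
       (use smooth_on_inner[of UNIV "1::real"] in auto)
  then have "smooth_on UNIV (\<lambda>x. (flat x + flat (1 - x)) powr (-1))"
    by (intro smooth_on_compose_real[OF _ _ smooth_on_powr] smooth_on_add smooth_on_flat)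
       (auto simp: flat_def add_pos_pos)
  then show ?thesis unfolding smooth_step_def
    by (intro smooth_on_mult smooth_on_flat) auto
qed

lemma smooth_step_simps:
  "x \<le> 0 \<Longrightarrow> smooth_step x = 0" "x \<ge> 1 \<Longrightarrow> smooth_step x = 1" "0 \<le> smooth_step x" "smooth_step x \<le> 1"
  by (auto simp: smooth_step_def flat_def powr_minus field_simps add_pos_pos)

section \<open>Test functions and integration by parts\<close>

lemma integral_lebesgue_on_eq_lebesgue:
  fixes f :: "'a::euclidean_space \<Rightarrow> 'b::euclidean_space"
  assumes "\<Omega> \<in> sets lebesgue" "\<And>x. x \<notin> \<Omega> \<Longrightarrow> f x = 0"
  shows "integral\<^sup>L (lebesgue_on \<Omega>) f = integral\<^sup>L lebesgue f"
    and "integrable (lebesgue_on \<Omega>) f \<longleftrightarrow> integrable lebesgue f"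
proof -
  have "(\<lambda>x. indicator \<Omega> x *\<^sub>R f x) = f" using assms(2) by (auto simp: indicator_def fun_eq_iff)
  then show "integral\<^sup>L (lebesgue_on \<Omega>) f = integral\<^sup>L lebesgue f"
    "integrable (lebesgue_on \<Omega>) f \<longleftrightarrow> integrable lebesgue f"
    using assms(1) by (simp_all add: integral_restrict_space integrable_restrict_space)
qed

text \<open>Bridge between the measures: weak gradients and Sobolev norms integrate over
  \<open>lebesgue_on\<close>, integration by parts is carried out over
  \<open>lborel\<close>.\<close>

lemma integral_continuous_compact_support:
  fixes f :: "'a::euclidean_space \<Rightarrow> 'b::euclidean_space"
  assumes "continuous_on UNIV f" "compact K" "\<And>x. x \<notin> K \<Longrightarrow> f x = 0" "K \<subseteq> \<Omega>" "\<Omega> \<in> sets lebesgue"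
  shows "integrable lborel f" "integrable (lebesgue_on \<Omega>) f"
    "integral\<^sup>L (lebesgue_on \<Omega>) f = integral\<^sup>L lborel f"
proof -
  have "(\<lambda>x. indicator K x *\<^sub>R f x) = f" using assms(3) by (auto simp: indicator_def fun_eq_iff)
  then show 1: "integrable lborel f"
    using borel_integrable_compact[OF assms(2) continuous_on_subset[OF assms(1)]] by simp
  have "f \<in> borel_measurable lborel" by (rule borel_measurable_integrable[OF 1])
  then show "integrable (lebesgue_on \<Omega>) f" "integral\<^sup>L (lebesgue_on \<Omega>) f = integral\<^sup>L lborel f"
    using integral_lebesgue_on_eq_lebesgue[OF assms(5), of f] assms(3,4) 1
    by (auto simp: integral_completion integrable_completion)
qed

lemma test_functionsI:
  assumes "smooth_on UNIV \<phi>" "compact K" "K \<subseteq> \<Omega>" "\<And>x. x \<notin> K \<Longrightarrow> \<phi> x = 0"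
  shows "\<phi> \<in> test_functions \<Omega>"
proof -
  have "closure {x. \<phi> x \<noteq> 0} \<subseteq> K"
    using assms(2,4) by (intro closure_minimal compact_imp_closed) auto
  then show ?thesis using assms
    compact_Int_closed[OF assms(2) closed_closure, of "{x. \<phi> x \<noteq> 0}"]
    by (simp add: test_functions_def smooth_on_def Ck_fun_eq_Ck_on Int_absorb1)
qed

lemma test_functionsE:
  assumes "\<phi> \<in> test_functions \<Omega>"
  obtains K where "smooth_on UNIV \<phi>" "compact K" "K \<subseteq> \<Omega>" "\<And>x. x \<notin> K \<Longrightarrow> \<phi> x = 0"
proof (rule that[of "closure {x. \<phi> x \<noteq> 0}"])
  show "\<phi> x = 0" if "x \<notin> closure {x. \<phi> x \<noteq> 0}" for x
    using that closure_subset[of "{x. \<phi> x \<noteq> 0}"] by auto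
qed (use assms in \<open>auto simp: test_functions_def smooth_on_def Ck_fun_eq_Ck_on\<close>)

section \<open>Gradients, and integration by parts against test functions\<close>

definition gradient :: "('a::euclidean_space \<Rightarrow> real) \<Rightarrow> 'a \<Rightarrow> 'a" where
  "gradient f x = (\<Sum>b\<in>Basis. frechet_derivative f (at x) b *\<^sub>R b)"

text \<open>Translates into the partial derivatives that occur in \<open>has_weak_gradient\<close>;
  it holds at every point, since \<open>gradient\<close> is assembled from
  \<open>frechet_derivative\<close> itself.\<close>

lemma gradient_inner_Basis: "b \<in> Basis \<Longrightarrow> gradient f x \<bullet> b = frechet_derivative f (at x) b"
  unfolding gradient_def by (simp add: inner_sum_left inner_Basis if_distrib cong: if_cong)

lemma smooth_on_has_derivative:
  assumes "smooth_on U f" "x \<in> U"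
  shows "(f has_derivative (\<lambda>h. gradient f x \<bullet> h)) (at x)"
proof -
  have D: "(f has_derivative frechet_derivative f (at x)) (at x)"
    using assms Ck_on_frechet[of U 0] unfolding smooth_on_def by blast
  then have lin: "linear (frechet_derivative f (at x))" by (rule has_derivative_linear)
  have "frechet_derivative f (at x) h = gradient f x \<bullet> h" for h
  proof -
    have "frechet_derivative f (at x) h = frechet_derivative f (at x) (\<Sum>b\<in>Basis. (h \<bullet> b) *\<^sub>R b)"
      by (simp add: euclidean_representation)
    also have "\<dots> = gradient f x \<bullet> h"
      unfolding linear_sum[OF lin] linear_scale[OF lin] gradient_def
      by (simp add: inner_sum_left inner_commute[of h] mult.commute)
    finally show ?thesis .
  qed
  then have "frechet_derivative f (at x) = (\<lambda>h. gradient f x \<bullet> h)" by blast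
  with D show ?thesis by simp
qed

lemma gradient_unique:
  assumes "(f has_derivative (\<lambda>h. g \<bullet> h)) (at x)"
  shows "gradient f x = g"
  unfolding gradient_def frechet_derivative_at[OF assms, symmetric] by (rule euclidean_representation)

lemma continuous_on_gradient:
  assumes "smooth_on U f" shows "continuous_on U (gradient f)"
proof -
  have "Ck_on U (Suc 0) f" using assms by (simp only: smooth_on_def)
  then show ?thesis unfolding gradient_def by (auto intro!: continuous_intros)
qed

lemma smooth_on_continuous: "smooth_on U f \<Longrightarrow> continuous_on U f"
  unfolding smooth_on_def using Ck_on.simps(1) by blast

lemma gradient_eq_0_outside:
  assumes "closed K" "\<And>x. x \<notin> K \<Longrightarrow> f x = 0" "x \<notin> K"
  shows "gradient f x = 0"
proof (rule gradient_unique)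
  have "((\<lambda>x. 0::real) has_derivative (\<lambda>h. 0 \<bullet> h)) (at x)" by simp
  then show "(f has_derivative (\<lambda>h. 0 \<bullet> h)) (at x)"
    by (rule has_derivative_transform_within_open[where s="- K"]) (use assms in auto)
qed

text \<open>By translation invariance the integral of every difference quotient of f in direction b
  is 0. The quotients converge to the directional derivative, and by the mean value theorem they
  have a common bound and vanish outside one compact set, so dominated convergence applies.\<close>

lemma integral_partial_derivative_eq_0:
  fixes f :: "'a::euclidean_space \<Rightarrow> real"
  assumes der: "\<And>x. (f has_derivative (\<lambda>h. g x \<bullet> h)) (at x)"
    and cont: "continuous_on UNIV (\<lambda>x. g x \<bullet> b)"
    and K: "compact K" "\<And>x. x \<notin> K \<Longrightarrow> f x = 0"
  shows "(\<integral>x. g x \<bullet> b \<partial>lborel) = 0"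
proof -
  have fc: "continuous_on UNIV f"
    by (metis der continuous_at_imp_continuous_on has_derivative_continuous)
  have g0: "g x = 0" if "x \<notin> K" for x
    using gradient_eq_0_outside[of K f x] gradient_unique[OF der] K that compact_imp_closed by metis
  obtain M where M: "\<And>x. \<bar>g x \<bullet> b\<bar> \<le> M"
  proof -
    have "bounded ((\<lambda>x. g x \<bullet> b) ` K)"
      using K(1) cont by (intro compact_imp_bounded compact_continuous_image) (auto intro: continuous_on_subset)
    then obtain M where "\<And>x. x \<in> K \<Longrightarrow> \<bar>g x \<bullet> b\<bar> \<le> M" by (auto simp: bounded_real)
    then have "\<bar>g x \<bullet> b\<bar> \<le> max M 0" for x
      using g0[of x] by (cases "x \<in> K") (force simp: max_def)+
    then show ?thesis by (rule that)
  qed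
  define e where "e m = 1 / real (Suc m)" for m
  define q where "q m x = (f (x + e m *\<^sub>R b) - f x) / e m" for m x
  have e: "0 < e m" "e m \<le> 1" for m by (auto simp: e_def)
  have e0: "e \<longlonglongrightarrow> 0" unfolding e_def using LIMSEQ_inverse_real_of_nat by (simp add: inverse_eq_divide)
  have int: "integrable lborel f"
    using integral_continuous_compact_support[OF fc K order_refl] K(1) by (auto intro: lmeasurable_compact fmeasurableD)
  have [measurable]: "f \<in> borel_measurable borel" using fc by (rule borel_measurable_continuous_onI)
  have int': "integrable lborel (\<lambda>x. f (x + c))" "(\<integral>x. f (x + c) \<partial>lborel) = (\<integral>x. f x \<partial>lborel)" for c
  proof -
    have "integrable (distr lborel borel ((+) c)) f" using int by (simp add: lborel_distr_plus)
    then show "integrable lborel (\<lambda>x. f (x + c))" 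
      by (simp add: integrable_distr_eq add.commute[of _ c])
    have "(\<integral>x. f x \<partial>lborel) = (\<integral>x. f x \<partial>distr lborel borel ((+) c))" by (simp add: lborel_distr_plus)
    also have "\<dots> = (\<integral>x. f (x + c) \<partial>lborel)" by (simp add: integral_distr add.commute[of _ c])
    finally show "(\<integral>x. f (x + c) \<partial>lborel) = (\<integral>x. f x \<partial>lborel)" by simp
  qed
  have "(\<integral>x. q m x \<partial>lborel) = 0" for m
    unfolding q_def using int int' by simp
  moreover have "(\<lambda>m. \<integral>x. q m x \<partial>lborel) \<longlonglongrightarrow> (\<integral>x. g x \<bullet> b \<partial>lborel)"
  proof (rule integral_dominated_convergence)
    \<comment> \<open>K' contains every x such that x + t b lies in K for some t in [0, 1]; as e m
      is at most 1, all quotients vanish outside it.\<close>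
    define K' where "K' = {x - y | x y. x \<in> K \<and> y \<in> closed_segment 0 b}"
    have K': "compact K'" unfolding K'_def by (intro compact_differences K) auto
    show "(\<lambda>x. g x \<bullet> b) \<in> borel_measurable lborel" using cont by (simp add: borel_measurable_continuous_onI)
    show "q m \<in> borel_measurable lborel" for m
      unfolding q_def using int int' by measurable
    show "integrable lborel (\<lambda>x. indicator K' x *\<^sub>R M)"
      by (rule borel_integrable_compact[OF K']) auto
    show "AE x in lborel. (\<lambda>m. q m x) \<longlonglongrightarrow> g x \<bullet> b"
    proof (rule AE_I2)
      fix x
      have "((\<lambda>t. f (x + t *\<^sub>R b)) has_real_derivative g x \<bullet> b) (at 0)"
        unfolding has_field_derivative_def
        by (rule has_derivative_eq_rhs, rule has_derivative_compose[where f="\<lambda>t. x + t *\<^sub>R b", OF _ der[of "x + 0 *\<^sub>R b"]])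
           (auto intro!: derivative_eq_intros simp: mult.commute)
      then have "((\<lambda>t. (f (x + t *\<^sub>R b) - f x) / t) \<longlongrightarrow> g x \<bullet> b) (at 0)"
        by (simp add: has_field_derivative_iff)
      moreover have "filterlim e (at 0) sequentially"
        using e0 e(1) by (auto simp: filterlim_at less_imp_neq[THEN not_sym])
      ultimately show "(\<lambda>m. q m x) \<longlonglongrightarrow> g x \<bullet> b"
        unfolding q_def by (rule filterlim_compose)
    qed
    show "AE x in lborel. norm (q m x) \<le> indicator K' x *\<^sub>R M" for m
    proof (rule AE_I2)
      fix x
      show "norm (q m x) \<le> indicator K' x *\<^sub>R M"
      proof (cases "x \<in> K'")
        case True
        have "\<exists>t. 0 < t \<and> t < e m \<and> f (x + e m *\<^sub>R b) - f (x + 0 *\<^sub>R b) = (e m - 0) * (g (x + t *\<^sub>R b) \<bullet> b)"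
        proof (rule MVT2[OF e(1)])
          fix t :: real
          show "((\<lambda>t. f (x + t *\<^sub>R b)) has_real_derivative g (x + t *\<^sub>R b) \<bullet> b) (at t)"
            unfolding has_field_derivative_def
            by (rule has_derivative_eq_rhs, rule has_derivative_compose[where f="\<lambda>t. x + t *\<^sub>R b", OF _ der])
               (auto intro!: derivative_eq_intros simp: mult.commute)
        qed
        then obtain t where "f (x + e m *\<^sub>R b) - f x = e m * (g (x + t *\<^sub>R b) \<bullet> b)" by auto
        then have "q m x = g (x + t *\<^sub>R b) \<bullet> b" using e(1)[of m] by (simp add: q_def)
        then show ?thesis using M True by simp
      next
        case False
        have "e m *\<^sub>R b = (1 - e m) *\<^sub>R 0 + e m *\<^sub>R b \<and> 0 \<le> e m \<and> e m \<le> 1"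
          using e[of m] by auto
        then have "e m *\<^sub>R b \<in> closed_segment 0 b" "0 \<in> closed_segment 0 b"
          unfolding in_segment by (blast, auto intro: exI[of _ 0])
        then have "z \<in> K \<Longrightarrow> z - e m *\<^sub>R b \<in> K'" "z \<in> K \<Longrightarrow> z - 0 \<in> K'" for z
          unfolding K'_def by blast+
        from this(1)[of "x + e m *\<^sub>R b"] this(2)[of x] False have "x + e m *\<^sub>R b \<notin> K" "x \<notin> K" by auto
        then show ?thesis using K(2) False by (simp add: q_def)
      qed
    qed
  qed
  ultimately have "(\<lambda>m::nat. 0::real) \<longlonglongrightarrow> (\<integral>x. g x \<bullet> b \<partial>lborel)" by simp
  then show ?thesis by (simp add: LIMSEQ_const_iff)
qed

text \<open>Only the product with a test function has compact support, so
  \<open>integral_partial_derivative_eq_0\<close> is applied to f times \<phi> and the product rule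
  splits the result.\<close>

lemma has_weak_gradient_gradient:
  fixes f :: "'a::euclidean_space \<Rightarrow> real"
  assumes f: "smooth_on UNIV f" and \<Omega>: "open \<Omega>"
  shows "has_weak_gradient \<Omega> f (gradient f)"
  unfolding has_weak_gradient_def
proof (intro conjI ballI)
  have loc: "locally_integrable \<Omega> h" if "continuous_on UNIV h" for h :: "'a \<Rightarrow> 'd::euclidean_space"
    unfolding locally_integrable_def
  proof safe
    fix K :: "'a set" assume K: "compact K"
    have "integrable lborel (\<lambda>x. indicator K x *\<^sub>R h x)"
      by (rule borel_integrable_compact[OF K continuous_on_subset[OF that]]) auto
    then have "integrable lebesgue (\<lambda>x. indicator K x *\<^sub>R h x)"
      using integrable_completion borel_measurable_integrable by blast
    then show "integrable (lebesgue_on K) h"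
      using K by (simp add: integrable_restrict_space fmeasurableD lmeasurable_compact)
  qed
  show "locally_integrable \<Omega> f" "locally_integrable \<Omega> (gradient f)"
    using smooth_on_continuous[OF f] continuous_on_gradient[OF f] loc by auto
  fix \<phi> and b :: 'a assume \<phi>: "\<phi> \<in> test_functions \<Omega>" and b: "b \<in> Basis"
  obtain K where K: "smooth_on UNIV \<phi>" "compact K" "K \<subseteq> \<Omega>" "\<And>x. x \<notin> K \<Longrightarrow> \<phi> x = 0"
    using test_functionsE[OF \<phi>] by metis
  note gb = gradient_inner_Basis[OF b, symmetric]
  have \<Omega>': "\<Omega> \<in> sets lebesgue" using \<Omega> by auto
  have g0: "gradient \<phi> x = 0" if "x \<notin> K" for x
    using gradient_eq_0_outside[of K \<phi> x] K that compact_imp_closed by metis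
  have c: "continuous_on UNIV (\<lambda>x. f x * (gradient \<phi> x \<bullet> b))" "continuous_on UNIV (\<lambda>x. (gradient f x \<bullet> b) * \<phi> x)"
    by (intro continuous_intros smooth_on_continuous[OF f] smooth_on_continuous[OF K(1)]
        continuous_on_gradient[OF f] continuous_on_gradient[OF K(1)])+
  note I = integral_continuous_compact_support[OF c(1) K(2) _ K(3) \<Omega>']
    integral_continuous_compact_support[OF c(2) K(2) _ K(3) \<Omega>']
  have "(\<integral>x. (f x *\<^sub>R gradient \<phi> x + \<phi> x *\<^sub>R gradient f x) \<bullet> b \<partial>lborel) = 0"
  proof (rule integral_partial_derivative_eq_0[OF _ _ K(2), where f="\<lambda>x. f x * \<phi> x"])
    show "((\<lambda>x. f x * \<phi> x) has_derivative (\<lambda>h. (f x *\<^sub>R gradient \<phi> x + \<phi> x *\<^sub>R gradient f x) \<bullet> h)) (at x)" for x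
      by (rule has_derivative_eq_rhs, rule has_derivative_mult[OF smooth_on_has_derivative[OF f] smooth_on_has_derivative[OF K(1)]])
         (auto simp: inner_add_left)
    show "continuous_on UNIV (\<lambda>x. (f x *\<^sub>R gradient \<phi> x + \<phi> x *\<^sub>R gradient f x) \<bullet> b)"
      using continuous_on_add[OF c] by (simp add: inner_add_left mult.commute)
  qed (use K in auto)
  moreover have "(\<integral>x. (f x *\<^sub>R gradient \<phi> x + \<phi> x *\<^sub>R gradient f x) \<bullet> b \<partial>lborel) =
      (\<integral>x. f x * (gradient \<phi> x \<bullet> b) \<partial>lborel) + (\<integral>x. (gradient f x \<bullet> b) * \<phi> x \<partial>lborel)"
    using I(1,4) g0 K(4) by (simp add: inner_add_left mult.commute)
  ultimately show "(LINT x|lebesgue_on \<Omega>. f x * frechet_derivative \<phi> (at x) b)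
          = - (LINT x|lebesgue_on \<Omega>. (gradient f x \<bullet> b) * \<phi> x)"
    unfolding gb using I(3,6) g0 K(4) by simp
qed

section \<open>Uniqueness of weak gradients\<close>

text \<open>Dynkin's argument: boxes form an intersection-stable generator of the Borel sets, and
  vanishing of the integral of g passes to complements and countable disjoint unions. A function
  whose integral over every Borel set is 0 vanishes almost everywhere.\<close>

lemma AE_zero_if_box_integrals_zero:
  fixes g :: "'a::euclidean_space \<Rightarrow> real"
  assumes g: "integrable lborel g"
    and box: "\<And>a b. (\<integral>x. indicator (box a b) x * g x \<partial>lborel) = 0"
  shows "AE x in lborel. g x = 0"
proof (rule sigma_finite_measure.density_zero[OF lborel.sigma_finite_measure_axioms g])
  have ind: "integrable lborel (\<lambda>x. indicator A x * g x)" if "A \<in> sets borel" for A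
    using integrable_mult_indicator[OF _ g, of A] that by simp
  fix A assume "A \<in> sets (lborel :: 'a measure)"
  then have A: "A \<in> sigma_sets UNIV (range (\<lambda>(a, b). box a b :: 'a set))"
    by (simp add: borel_eq_box)
  have stable: "Int_stable (range (\<lambda>(a, b). box a b :: 'a set))"
  proof (rule Int_stableI, clarsimp)
    fix a b c d :: 'a
    have "box a b \<inter> box c d =
        box (\<Sum>i\<in>Basis. max (a\<bullet>i) (c\<bullet>i) *\<^sub>R i) (\<Sum>i\<in>Basis. min (b\<bullet>i) (d\<bullet>i) *\<^sub>R i)"
      by (auto simp: set_eq_iff mem_box)
    then show "box a b \<inter> box c d \<in> range (\<lambda>(a, b). box a b)" by auto
  qed
  have sub: "range (\<lambda>(a, b). box a b :: 'a set) \<subseteq> Pow UNIV" by simp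
  from stable sub A have "(\<integral>x. indicator A x * g x \<partial>lborel) = 0"
  proof (induction rule: sigma_sets_induct_disjoint)
    case (basic A) then show ?case using box by auto
  next
    case empty then show ?case by simp
  next
    case (compl A)
    have A: "A \<in> sets borel" using compl.hyps by (simp add: borel_eq_box)
    \<comment> \<open>Complements require the integral over the whole space, which is exhausted by
      boxes.\<close>
    have "(\<lambda>n. \<integral>x. indicator (box (- (real n *\<^sub>R One)) (real n *\<^sub>R One)) x * g x \<partial>lborel) \<longlonglongrightarrow> (\<integral>x. g x \<partial>lborel)"
    proof (rule integral_dominated_convergence[where w="\<lambda>x. norm (g x)"])
      show "AE x in lborel. (\<lambda>n. indicator (box (- (real n *\<^sub>R One)) (real n *\<^sub>R One)) x * g x) \<longlonglongrightarrow> g x"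
      proof (rule AE_I2)
        fix x :: 'a
        obtain N :: nat where N: "norm x < real N" using reals_Archimedean2 by blast
        have "x \<in> box (- (real n *\<^sub>R One)) (real n *\<^sub>R One)" if "n \<ge> N" for n
          using that N Basis_le_norm[of _ x] by (fastforce simp: mem_box abs_le_iff)
        then show "(\<lambda>n. indicator (box (- (real n *\<^sub>R One)) (real n *\<^sub>R One)) x * g x) \<longlonglongrightarrow> g x"
          by (intro tendsto_eventually eventually_sequentiallyI[of N]) simp
      qed
    qed (use g ind in \<open>auto simp: indicator_def abs_mult intro: borel_measurable_integrable\<close>)
    then have "(\<integral>x. g x \<partial>lborel) = 0" using box by (simp add: LIMSEQ_const_iff)
    moreover have "indicator (UNIV - A) x * g x = g x - indicator A x * g x" for x
      by (auto simp: indicator_def)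
    ultimately show ?case using compl.IH g ind[OF A] by simp
  next
    case (union A)
    have A: "A i \<in> sets borel" for i using union.hyps by (auto simp: borel_eq_box)
    have "(\<integral>x. g x * indicator (\<Union>i. A i) x \<partial>lborel) = (\<Sum>i. \<integral>x. g x * indicator (A i) x \<partial>lborel)"
      using lebesgue_integral_countable_add[where M=lborel and A=A and f=g] 
      using union.hyps(1) A ind[of "\<Union>i. A i"]
      by (simp add: set_lebesgue_integral_def set_integrable_def disjoint_family_on_def mult.commute)
    then show ?case using union.IH by (simp add: mult.commute)
  qed
  then show "set_lebesgue_integral lborel A g = 0" by (simp add: set_lebesgue_integral_def)
qed

text \<open>For s > 0 the value flat (n s) = exp (-1 / (n s)) tends to 1, so these bumps converge to
  the indicator of the open box while all of them vanish outside the closed box. They take the place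
  of mollified indicators.\<close>

definition box_bump :: "'a::euclidean_space \<Rightarrow> 'a \<Rightarrow> nat \<Rightarrow> 'a \<Rightarrow> real" where
  "box_bump c d n x = (\<Prod>b\<in>Basis. flat (real n * (x \<bullet> b - c \<bullet> b)) * flat (real n * (d \<bullet> b - x \<bullet> b)))"

lemma flat_bounds: "0 \<le> flat x" "flat x \<le> 1"
  by (auto simp: flat_def)

lemma box_bump_outside: "x \<notin> cbox c d \<Longrightarrow> box_bump c d n x = 0"
  by (force simp: box_bump_def mem_box flat_def mult_le_0_iff not_le intro!: prod_zero)

lemma box_bump_bounds: "0 \<le> box_bump c d n x" "box_bump c d n x \<le> 1"
  unfolding box_bump_def by (auto intro!: prod_nonneg prod_le_1 mult_le_one simp: flat_bounds)

lemma box_bump_test_function: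
  assumes "cbox c d \<subseteq> \<Omega>"
  shows "box_bump c d n \<in> test_functions \<Omega>"
proof (rule test_functionsI[OF _ compact_cbox assms])
  have 1: "smooth_on UNIV (\<lambda>x::'a. flat (real n * (x \<bullet> b - c \<bullet> b)))" for b
    by (rule smooth_on_compose_real[OF _ _ smooth_on_flat])
       (simp_all add: smooth_on_mult smooth_on_const smooth_on_diff smooth_on_inner)
  have 2: "smooth_on UNIV (\<lambda>x::'a. flat (real n * (d \<bullet> b - x \<bullet> b)))" for b
    by (rule smooth_on_compose_real[OF _ _ smooth_on_flat])
       (simp_all add: smooth_on_mult smooth_on_const smooth_on_diff smooth_on_inner)
  show "smooth_on UNIV (box_bump c d n)"
    unfolding box_bump_def[abs_def] by (intro smooth_on_prod smooth_on_mult 1 2 open_UNIV)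
qed (rule box_bump_outside)

lemma box_bump_tendsto: "(\<lambda>n. box_bump c d n x) \<longlonglongrightarrow> indicator (box c d) x"
proof -
  have f: "(\<lambda>n. flat (real n * s)) \<longlonglongrightarrow> of_bool (s > 0)" for s
  proof (cases "s > 0")
    case True
    have "(\<lambda>n. exp (- ((1 / s) * (1 / real n)))) \<longlonglongrightarrow> exp (- ((1 / s) * 0))"
      by (intro tendsto_intros lim_1_over_n)
    moreover have "eventually (\<lambda>n. exp (- ((1 / s) * (1 / real n))) = flat (real n * s)) sequentially"
      by (rule eventually_sequentiallyI[of 1])
         (use True in \<open>auto simp: flat_def mult_le_0_iff mult.commute\<close>)
    ultimately show ?thesis using True by (simp add: Lim_transform_eventually)
  next
    case False
    then have "flat (real n * s) = 0" for n by (auto simp: flat_def mult_le_0_iff)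
    then show ?thesis using False by simp
  qed
  have "(\<lambda>n. box_bump c d n x) \<longlonglongrightarrow>
      (\<Prod>b\<in>Basis. of_bool (x \<bullet> b - c \<bullet> b > 0) * of_bool (d \<bullet> b - x \<bullet> b > 0))"
    unfolding box_bump_def by (intro tendsto_prod tendsto_mult f)
  also have "(\<Prod>b\<in>Basis. of_bool (x \<bullet> b - c \<bullet> b > 0) * of_bool (d \<bullet> b - x \<bullet> b > 0)) =
      (indicator (box c d) x :: real)"
    by (auto simp: indicator_def mem_box)
  finally show ?thesis .
qed

text \<open>Testing with box bumps and passing to the limit shows that g integrates to 0 over every
  box whose closed version lies in \<Omega>. This gives g = 0 almost everywhere on each such closed
  box, and countably many of them cover \<Omega>.\<close>

lemma fundamental_lemma_variations:
  fixes g :: "'a::euclidean_space \<Rightarrow> real"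
  assumes \<Omega>: "open \<Omega>" and loc: "locally_integrable \<Omega> g"
    and zero: "\<And>\<phi>. \<phi> \<in> test_functions \<Omega> \<Longrightarrow> (LINT x|lebesgue_on \<Omega>. g x * \<phi> x) = 0"
  shows "AE x in lebesgue_on \<Omega>. g x = 0"
proof -
  have gint: "integrable lebesgue (\<lambda>x. indicator (cbox c d) x * g x)" if "cbox c d \<subseteq> \<Omega>" for c d
    using loc that integrable_restrict_space[of "cbox c d" lebesgue g] by (auto simp: locally_integrable_def)
  have box0: "(\<integral>x. indicator (box c d) x * g x \<partial>lebesgue) = 0" if cd: "cbox c d \<subseteq> \<Omega>" for c d
  proof -
    have "(\<lambda>n. \<integral>x. box_bump c d n x * (indicator (cbox c d) x * g x) \<partial>lebesgue) \<longlonglongrightarrow>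
        (\<integral>x. indicator (box c d) x * (indicator (cbox c d) x * g x) \<partial>lebesgue)"
    proof (rule integral_dominated_convergence[where w="\<lambda>x. norm (indicator (cbox c d) x * g x)"])
      show "AE x in lebesgue. (\<lambda>n. box_bump c d n x * (indicator (cbox c d) x * g x)) \<longlonglongrightarrow>
          indicator (box c d) x * (indicator (cbox c d) x * g x)"
        by (intro AE_I2 tendsto_mult box_bump_tendsto tendsto_const)
      show "AE x in lebesgue. norm (box_bump c d n x * (indicator (cbox c d) x * g x)) \<le>
          norm (indicator (cbox c d) x * g x)" for n
        using box_bump_bounds[of c d n] by (intro AE_I2) (auto simp: abs_mult mult_left_le_one_le)
      have "box_bump c d n \<in> borel_measurable borel" for n
        by (intro borel_measurable_continuous_onI smooth_on_continuous)
           (rule test_functionsE[OF box_bump_test_function[OF cd]])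
      then have "box_bump c d n \<in> borel_measurable lebesgue" for n
        by (intro measurable_completion) simp
      then show "(\<lambda>x. box_bump c d n x * (indicator (cbox c d) x * g x)) \<in> borel_measurable lebesgue" for n
        by (intro borel_measurable_times[OF _ borel_measurable_integrable[OF gint[OF cd]]])
      show "(\<lambda>x. indicator (box c d) x * (indicator (cbox c d) x * g x)) \<in> borel_measurable lebesgue"
        by (intro borel_measurable_times[OF _ borel_measurable_integrable[OF gint[OF cd]]] borel_measurable_indicator) auto
      show "integrable lebesgue (\<lambda>x. norm (indicator (cbox c d) x * g x))"
        using gint[OF cd] by (rule integrable_norm)
    qed
    moreover have "(\<integral>x. box_bump c d n x * (indicator (cbox c d) x * g x) \<partial>lebesgue) = 0" for n
    proof -
      have "(\<lambda>x. box_bump c d n x * (indicator (cbox c d) x * g x)) = (\<lambda>x. g x * box_bump c d n x)"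
        using box_bump_outside[of _ c d n] by (auto simp: fun_eq_iff indicator_def)
      moreover have "(LINT x|lebesgue_on \<Omega>. g x * box_bump c d n x) = (\<integral>x. g x * box_bump c d n x \<partial>lebesgue)"
        using box_bump_outside[of _ c d n] cd \<Omega> by (intro integral_lebesgue_on_eq_lebesgue) auto
      ultimately show ?thesis using zero[OF box_bump_test_function[OF cd]] by simp
    qed
    moreover have "indicator (box c d) x * (indicator (cbox c d) x * g x) = indicator (box c d) x * g x" for x
      using box_subset_cbox[of c d] by (auto simp: indicator_def)
    ultimately show ?thesis by (simp add: LIMSEQ_const_iff)
  qed
  have AE_box: "AE x in lebesgue. x \<in> cbox c d \<longrightarrow> g x = 0" if cd: "cbox c d \<subseteq> \<Omega>" for c d
  proof -
    have meas: "(\<lambda>x. indicator (cbox c d) x * g x) \<in> borel_measurable lebesgue"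
      using gint[OF cd] by (rule borel_measurable_integrable)
    \<comment> \<open>g is only Lebesgue measurable, while the criterion on boxes is about
      \<open>lborel\<close>; a Borel representative on the closed box takes its place.\<close>
    obtain g' where g': "g' \<in> borel_measurable lborel" "AE x in lborel. indicator (cbox c d) x * g x = g' x"
      using completion_ex_borel_measurable_real[OF meas] by auto
    have AE: "AE x in lebesgue. indicator (cbox c d) x * g x = g' x" using g'(2) by (rule AE_completion)
    have [measurable]: "g' \<in> borel_measurable lebesgue" using g'(1) by (rule measurable_completion)
    have int': "integrable lebesgue g'"
      using integrable_cong_AE[OF meas _ AE] gint[OF cd] by simp
    then have "integrable lborel g'" using g'(1) by (simp add: integrable_completion)
    then have "AE x in lborel. g' x = 0"
    proof (rule AE_zero_if_box_integrals_zero)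
      fix a b :: 'a
      \<comment> \<open>The criterion asks for arbitrary boxes; intersecting with the given one
        yields a box to which the vanishing of the integrals applies.\<close>
      define a' b' where "a' = (\<Sum>i\<in>Basis. max (a\<bullet>i) (c\<bullet>i) *\<^sub>R i)" and "b' = (\<Sum>i\<in>Basis. min (b\<bullet>i) (d\<bullet>i) *\<^sub>R i)"
      have ab: "box a b \<inter> box c d = box a' b'" "cbox a' b' \<subseteq> cbox c d"
        unfolding a'_def b'_def by (auto simp: set_eq_iff mem_box)
      \<comment> \<open>The representative lives on the closed box and the integrals are over open
        ones; the boundary is a null set.\<close>
      have "AE x in lebesgue. x \<notin> cbox c d - box c d"
        using negligible_frontier_interval[of c d]
        by (intro AE_not_in) (simp add: negligible_iff_null_sets)
      then have "AE x in lebesgue. indicator (box a b) x * g' x = indicator (box a' b') x * g x"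
        using AE by eventually_elim (use box_subset_cbox[of c d] in \<open>auto simp: indicator_def ab(1)[symmetric] split: if_splits\<close>)
      then have "(\<integral>x. indicator (box a b) x * g' x \<partial>lebesgue) = (\<integral>x. indicator (box a' b') x * g x \<partial>lebesgue)"
      proof (rule integral_cong_AE[rotated 2])
        have "(\<lambda>x. indicator (box a' b') x * (indicator (cbox c d) x * g x)) \<in> borel_measurable lebesgue"
          by (intro borel_measurable_times meas borel_measurable_indicator) auto
        moreover have "(\<lambda>x. indicator (box a' b') x * (indicator (cbox c d) x * g x)) = (\<lambda>x. indicator (box a' b') x * g x)"
          using ab(2) box_subset_cbox[of a' b'] by (auto simp: indicator_def fun_eq_iff)
        ultimately show "(\<lambda>x. indicator (box a' b') x * g x) \<in> borel_measurable lebesgue" by simp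
        show "(\<lambda>x. indicator (box a b) x * g' x) \<in> borel_measurable lebesgue"
          by (intro borel_measurable_times borel_measurable_indicator) auto
      qed
      also have "\<dots> = 0" using box0[of a' b'] ab(2) cd by auto
      finally show "(\<integral>x. indicator (box a b) x * g' x \<partial>lborel) = 0"
        using g'(1) by (simp add: integral_completion)
    qed
    then have "AE x in lebesgue. g' x = 0" by (rule AE_completion)
    with AE show ?thesis by eventually_elim (auto simp: indicator_def)
  qed
  obtain D where D: "countable D" "D \<subseteq> Pow \<Omega>" "\<And>X. X \<in> D \<Longrightarrow> \<exists>a b. X = cbox a b" "\<Union>D = \<Omega>"
    using open_countable_Union_open_cbox[OF \<Omega>] by metis
  have "AE x in lebesgue. \<forall>X\<in>D. x \<in> X \<longrightarrow> g x = 0"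
  proof (rule AE_ball_countable'[OF _ D(1)])
    fix X assume X: "X \<in> D"
    obtain a b where "X = cbox a b" using D(3)[OF X] by blast
    then show "AE x in lebesgue. x \<in> X \<longrightarrow> g x = 0" using AE_box[of a b] X D(2) by auto
  qed
  then have "AE x in lebesgue. x \<in> \<Omega> \<longrightarrow> g x = 0"
    by eventually_elim (use D(4) in auto)
  then show ?thesis using \<Omega> by (simp add: AE_restrict_space_iff)
qed

section \<open>Linearity and uniqueness of weak gradients\<close>

lemma integrable_locally_integrable_mult:
  fixes h \<phi> :: "'a::euclidean_space \<Rightarrow> real"
  assumes \<Omega>: "open \<Omega>" and h: "locally_integrable \<Omega> h" and \<phi>: "continuous_on UNIV \<phi>"
    and K: "compact K" "K \<subseteq> \<Omega>" "\<And>x. x \<notin> K \<Longrightarrow> \<phi> x = 0"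
  shows "integrable (lebesgue_on \<Omega>) (\<lambda>x. h x * \<phi> x)"
proof -
  have hK: "integrable (lebesgue_on K) h" using h K by (auto simp: locally_integrable_def)
  have cont: "continuous_on K \<phi>" using \<phi> continuous_on_subset by blast
  have "integrable (lebesgue_on K) (\<lambda>x. \<phi> x * h x)"
  proof (rule Bochner_Integration.integrable_bound)
    show "integrable (lebesgue_on K) (\<lambda>x. (SUP y\<in>K. \<bar>\<phi> y\<bar>) * h x)" using hK by simp
    have "\<phi> \<in> borel_measurable (lebesgue_on K)"
      by (intro continuous_imp_measurable_on_sets_lebesgue cont)
         (use K(1) in \<open>auto intro: fmeasurableD lmeasurable_compact\<close>)
    then show "(\<lambda>x. \<phi> x * h x) \<in> borel_measurable (lebesgue_on K)"
      using hK by (intro borel_measurable_times) auto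
    have "bdd_above ((\<lambda>y. \<bar>\<phi> y\<bar>) ` K)"
      using cont K(1)
      by (intro bounded_imp_bdd_above compact_imp_bounded compact_continuous_image continuous_intros)
    then have "\<bar>\<phi> x\<bar> \<le> (SUP y\<in>K. \<bar>\<phi> y\<bar>)" if "x \<in> K" for x
      using that by (rule cSUP_upper2) auto
    then show "AE x in lebesgue_on K. norm (\<phi> x * h x) \<le> norm ((SUP y\<in>K. \<bar>\<phi> y\<bar>) * h x)"
      by (intro AE_I2) (force simp: abs_mult intro!: mult_right_mono)
  qed
  then have "integrable (lebesgue_on K) (\<lambda>x. h x * \<phi> x)" by (simp add: mult.commute)
  then show ?thesis
    using integral_lebesgue_on_eq_lebesgue(2)[of \<Omega> "\<lambda>x. h x * \<phi> x"]
      integral_lebesgue_on_eq_lebesgue(2)[of K "\<lambda>x. h x * \<phi> x"] K \<Omega>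
    by (auto intro: fmeasurableD lmeasurable_compact)
qed

lemma has_weak_gradient_diff:
  assumes \<Omega>: "open \<Omega>" and G: "has_weak_gradient \<Omega> u G" "has_weak_gradient \<Omega> v H"
  shows "has_weak_gradient \<Omega> (\<lambda>x. u x - v x) (\<lambda>x. G x - H x)"
  unfolding has_weak_gradient_def
proof (intro conjI ballI)
  note loc = G[unfolded has_weak_gradient_def]
  show "locally_integrable \<Omega> (\<lambda>x. u x - v x)" "locally_integrable \<Omega> (\<lambda>x. G x - H x)"
    using loc by (auto simp: locally_integrable_def)
  fix \<phi> and b :: 'a assume \<phi>: "\<phi> \<in> test_functions \<Omega>" and b: "b \<in> Basis"
  obtain K where K: "smooth_on UNIV \<phi>" "compact K" "K \<subseteq> \<Omega>" "\<And>x. x \<notin> K \<Longrightarrow> \<phi> x = 0"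
    using test_functionsE[OF \<phi>] by metis
  have int: "integrable (lebesgue_on \<Omega>) (\<lambda>x. h x * (gradient \<phi> x \<bullet> b))" "integrable (lebesgue_on \<Omega>) (\<lambda>x. h x * \<phi> x)"
    if "locally_integrable \<Omega> h" for h
    using integrable_locally_integrable_mult[OF \<Omega> that _ K(2,3), where \<phi>="\<lambda>x. gradient \<phi> x \<bullet> b"]
      integrable_locally_integrable_mult[OF \<Omega> that smooth_on_continuous[OF K(1)] K(2-4)]
      gradient_eq_0_outside[where f=\<phi>, OF compact_imp_closed[OF K(2)] K(4)] 
      continuous_on_inner[OF continuous_on_gradient[OF K(1)] continuous_on_const[of _ b]]
    by auto
  have loc': "locally_integrable \<Omega> (\<lambda>x. G x \<bullet> b)" "locally_integrable \<Omega> (\<lambda>x. H x \<bullet> b)"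
    using loc by (auto simp: locally_integrable_def)
  have "(LINT x|lebesgue_on \<Omega>. u x * (gradient \<phi> x \<bullet> b)) = - (LINT x|lebesgue_on \<Omega>. (G x \<bullet> b) * \<phi> x)"
    "(LINT x|lebesgue_on \<Omega>. v x * (gradient \<phi> x \<bullet> b)) = - (LINT x|lebesgue_on \<Omega>. (H x \<bullet> b) * \<phi> x)"
    using loc \<phi> b by (auto simp: gradient_inner_Basis)
  then show "(LINT x|lebesgue_on \<Omega>. (u x - v x) * frechet_derivative \<phi> (at x) b)
      = - (LINT x|lebesgue_on \<Omega>. ((G x - H x) \<bullet> b) * \<phi> x)"
    using loc loc' int unfolding gradient_inner_Basis[OF b, symmetric]
    by (simp add: left_diff_distrib inner_diff_left)
qed

lemma weak_gradient_unique:
  assumes \<Omega>: "open \<Omega>" and G: "has_weak_gradient \<Omega> u G" "has_weak_gradient \<Omega> u H"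
  shows "AE x in lebesgue_on \<Omega>. G x = H x"
proof -
  have "AE x in lebesgue_on \<Omega>. (G x - H x) \<bullet> b = 0" if b: "b \<in> Basis" for b
  proof (rule fundamental_lemma_variations[OF \<Omega>])
    have loc: "locally_integrable \<Omega> (\<lambda>x. G x \<bullet> b)" "locally_integrable \<Omega> (\<lambda>x. H x \<bullet> b)"
      using G by (auto simp: has_weak_gradient_def locally_integrable_def)
    then show "locally_integrable \<Omega> (\<lambda>x. (G x - H x) \<bullet> b)"
      by (auto simp: locally_integrable_def inner_diff_left)
    fix \<phi> assume \<phi>: "\<phi> \<in> test_functions \<Omega>"
    obtain K where K: "smooth_on UNIV \<phi>" "compact K" "K \<subseteq> \<Omega>" "\<And>x. x \<notin> K \<Longrightarrow> \<phi> x = 0"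
      using test_functionsE[OF \<phi>] by metis
    have int: "integrable (lebesgue_on \<Omega>) (\<lambda>x. h x * \<phi> x)" if "locally_integrable \<Omega> h" for h
      using integrable_locally_integrable_mult[OF \<Omega> that smooth_on_continuous[OF K(1)] K(2-4)] .
    have "(LINT x|lebesgue_on \<Omega>. (G x - H x) \<bullet> b * \<phi> x) =
        (LINT x|lebesgue_on \<Omega>. (G x \<bullet> b) * \<phi> x) - (LINT x|lebesgue_on \<Omega>. (H x \<bullet> b) * \<phi> x)"
      using int[OF loc(1)] int[OF loc(2)] by (simp add: inner_diff_left left_diff_distrib)
    also have "\<dots> = 0" using G \<phi> b by (force simp: has_weak_gradient_def)
    finally show "(LINT x|lebesgue_on \<Omega>. (G x - H x) \<bullet> b * \<phi> x) = 0" .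
  qed
  then have "AE x in lebesgue_on \<Omega>. \<forall>b\<in>Basis. (G x - H x) \<bullet> b = 0"
    by (simp add: AE_finite_all)
  then show ?thesis
    by eventually_elim (auto simp: inner_diff_left intro: euclidean_eqI)
qed

text \<open>The representative chosen by \<open>weak_gradient\<close> may be replaced under an
  integral by any weak gradient at hand. Sobolev norms and the right-hand side of the inequality are
  evaluated in this way.\<close>

lemma weak_gradient_eq:
  assumes "open \<Omega>" "has_weak_gradient \<Omega> u G"
  shows "AE x in lebesgue_on \<Omega>. weak_gradient \<Omega> u x = G x"
    and "has_weak_gradient \<Omega> u (weak_gradient \<Omega> u)"
proof -
  show *: "has_weak_gradient \<Omega> u (weak_gradient \<Omega> u)"
    unfolding weak_gradient_def using someI[of "has_weak_gradient \<Omega> u"] assms(2) .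
  show "AE x in lebesgue_on \<Omega>. weak_gradient \<Omega> u x = G x"
    using weak_gradient_unique[OF assms(1) * assms(2)] .
qed

section \<open>Density of test functions vanishing near the origin\<close>

text \<open>Convexity of the p-th power at x + y = (1 - \<theta>) (x / (1 - \<theta>)) + \<theta> (y
  / \<theta>). If y is an error term, a small \<theta> brings the factor of the main term
  arbitrarily close to 1, which keeps sharp constants.\<close>

lemma powr_add_le_convex:
  fixes x y :: real
  assumes "1 \<le> p" "0 \<le> x" "0 \<le> y" "0 < \<theta>" "\<theta> < 1"
  shows "(x + y) powr p \<le> (1 - \<theta>) powr (1 - p) * x powr p + \<theta> powr (1 - p) * y powr p"
proof -
  have pow1: "c * (z / c) powr p = c powr (1 - p) * z powr p" if "0 < c" "0 \<le> z" for c z :: real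
    using that by (simp add: powr_divide powr_diff)
  have mono: "1 \<le> c powr (1 - p)" if "0 < c" "c < 1" for c :: real
    using powr_mono'[of "1 - p" 0 c] that assms(1) by simp
  consider "x = 0" | "y = 0" | "x > 0" "y > 0" using assms by linarith
  then show ?thesis
  proof cases
    case 1 then show ?thesis using mono[of \<theta>] assms mult_right_mono[of 1 _ "y powr p"] by simp
  next
    case 2 then show ?thesis using mono[of "1 - \<theta>"] assms mult_right_mono[of 1 _ "x powr p"] by simp
  next
    case 3
    have "((1 - \<theta>) *\<^sub>R (x / (1 - \<theta>)) + \<theta> *\<^sub>R (y / \<theta>)) powr p \<le>
        (1 - \<theta>) * (x / (1 - \<theta>)) powr p + \<theta> * (y / \<theta>) powr p"
      by (rule convex_onD[OF powr_convex[OF assms(1)]]) (use 3 assms in auto)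
    then show ?thesis using pow1[of "1 - \<theta>" x] pow1[of \<theta> y] assms by simp
  qed
qed

lemma norm_powr_add_le_convex:
  fixes x y :: "'b::real_normed_vector"
  assumes "1 \<le> p" "0 < \<theta>" "\<theta> < 1"
  shows "norm x powr p \<le>
    (1 - \<theta>) powr (1 - p) * norm y powr p + \<theta> powr (1 - p) * norm (x - y) powr p"
proof -
  have "norm x powr p \<le> (norm y + norm (x - y)) powr p"
    using norm_triangle_ineq[of y "x - y"] assms by (intro powr_mono2) auto
  also have "\<dots> \<le> (1 - \<theta>) powr (1 - p) * norm y powr p + \<theta> powr (1 - p) * norm (x - y) powr p"
    by (rule powr_add_le_convex) (use assms in auto)
  finally show ?thesis .
qed

section \<open>Functions in L^p, and the Sobolev space through approximation by test
  functions\<close>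

lemma in_Lp_diff:
  assumes "1 \<le> p" "in_Lp \<Omega> p f" "in_Lp \<Omega> p g"
  shows "in_Lp \<Omega> p (\<lambda>x. f x - g x)"
  unfolding in_Lp_def
proof
  have m[measurable]: "f \<in> borel_measurable (lebesgue_on \<Omega>)" "g \<in> borel_measurable (lebesgue_on \<Omega>)"
    using assms by (auto simp: in_Lp_def)
  show "(\<lambda>x. f x - g x) \<in> borel_measurable (lebesgue_on \<Omega>)" by measurable
  show "integrable (lebesgue_on \<Omega>) (\<lambda>x. norm (f x - g x) powr p)"
  proof (rule Bochner_Integration.integrable_bound)
    show "integrable (lebesgue_on \<Omega>)
      (\<lambda>x. (1 / 2) powr (1 - p) * norm (f x) powr p + (1 / 2) powr (1 - p) * norm (g x) powr p)"
      using assms by (auto simp: in_Lp_def)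
    show "AE x in lebesgue_on \<Omega>. norm (norm (f x - g x) powr p) \<le>
        norm ((1 / 2) powr (1 - p) * norm (f x) powr p + (1 / 2) powr (1 - p) * norm (g x) powr p)"
    proof (rule AE_I2)
      fix x
      have "norm (f x - g x) powr p \<le> (1 / 2) powr (1 - p) * norm (f x) powr p + (1 / 2) powr (1 - p) * norm (g x) powr p"
        using norm_powr_add_le_convex[of p "1 / 2" "f x - g x" "f x"] assms(1) by simp
      then show "norm (norm (f x - g x) powr p) \<le>
        norm ((1 / 2) powr (1 - p) * norm (f x) powr p + (1 / 2) powr (1 - p) * norm (g x) powr p)" by simp
    qed
  qed measurable
qed

lemma in_Lp_continuous_compact_support:
  fixes f :: "'a::euclidean_space \<Rightarrow> 'b::euclidean_space"
  assumes "continuous_on UNIV f" "compact K" "\<And>x. x \<notin> K \<Longrightarrow> f x = 0" "K \<subseteq> \<Omega>" "\<Omega> \<in> sets lebesgue" "0 < p"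
  shows "in_Lp \<Omega> p f"
proof -
  have "continuous_on UNIV (\<lambda>x. norm (f x) powr p)"
    using assms by (intro continuous_on_powr' continuous_intros) auto
  then show ?thesis
    using integral_continuous_compact_support[OF assms(1-5)]
      integral_continuous_compact_support(2)[OF _ assms(2) _ assms(4,5), of "\<lambda>x. norm (f x) powr p"] assms(3)
    by (auto simp: in_Lp_def intro: borel_measurable_integrable)
qed

lemma test_function_in_Lp:
  assumes "\<phi> \<in> test_functions \<Omega>" "\<Omega> \<in> sets lebesgue" "0 < p"
  shows "in_Lp \<Omega> p \<phi>" "in_Lp \<Omega> p (gradient \<phi>)"
proof -
  obtain K where K: "smooth_on UNIV \<phi>" "compact K" "K \<subseteq> \<Omega>" "\<And>x. x \<notin> K \<Longrightarrow> \<phi> x = 0"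
    using test_functionsE[OF assms(1)] by metis
  show "in_Lp \<Omega> p \<phi>" "in_Lp \<Omega> p (gradient \<phi>)"
    using in_Lp_continuous_compact_support[OF _ K(2) _ K(3) assms(2,3)] K(4)
      smooth_on_continuous[OF K(1)] continuous_on_gradient[OF K(1)]
      gradient_eq_0_outside[where f=\<phi>, OF compact_imp_closed[OF K(2)] K(4)] by blast+
qed

lemma complete_measure_lebesgue_on: "(\<Omega> :: 'a::euclidean_space set) \<in> sets lebesgue \<Longrightarrow> complete_measure (lebesgue_on \<Omega>)"
proof
  fix A B :: "'a set" assume \<Omega>: "\<Omega> \<in> sets lebesgue" and AB: "B \<subseteq> A" "A \<in> null_sets (lebesgue_on \<Omega>)"
  then have "A \<subseteq> \<Omega>" "A \<in> null_sets lebesgue" by (auto simp: null_sets_restrict_space)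
  then have "B \<in> sets lebesgue" "B \<subseteq> \<Omega>" using AB(1) completion.complete by blast+
  then show "B \<in> sets (lebesgue_on \<Omega>)" using \<Omega> by (simp add: sets_restrict_space_iff)
qed

text \<open>Needed for \<open>weak_gradient\<close>, which is known only almost everywhere;
  completeness of the measure transfers measurability to it.\<close>

lemma borel_measurable_lebesgue_on_AE:
  fixes f g :: "'a::euclidean_space \<Rightarrow> 'b::topological_space"
  assumes "\<Omega> \<in> sets lebesgue" "AE x in lebesgue_on \<Omega>. f x = g x" "f \<in> borel_measurable (lebesgue_on \<Omega>)"
  shows "g \<in> borel_measurable (lebesgue_on \<Omega>)"
proof (rule borel_measurableI)
  fix S :: "'b set" assume "open S"
  show "g -` S \<inter> space (lebesgue_on \<Omega>) \<in> sets (lebesgue_on \<Omega>)"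
  proof (rule complete_measure.in_sets_AE[OF complete_measure_lebesgue_on[OF assms(1)]])
    show "f -` S \<inter> space (lebesgue_on \<Omega>) \<in> sets (lebesgue_on \<Omega>)"
      using assms(3) \<open>open S\<close> by (intro measurable_sets) auto
  qed (use assms(2) in auto)
qed

text \<open>Eliminates the choice of \<open>weak_gradient\<close> and the p-th root. One weak
  gradient G of u serves for all approximations, since u - \<phi> has the weak gradient G minus that
  of \<phi>.\<close>

lemma sobolev_W1_0_iff:
  fixes u :: "'a::euclidean_space \<Rightarrow> real"
  assumes \<Omega>: "open \<Omega>" and p: "1 \<le> p"
  shows "(u \<in> sobolev_W1_0 \<Omega> p) \<longleftrightarrow> (\<exists>G. has_weak_gradient \<Omega> u G \<and> in_Lp \<Omega> p u \<and> in_Lp \<Omega> p G \<and>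
    (\<forall>e>0. \<exists>\<phi>\<in>test_functions \<Omega>.
      (LINT x|lebesgue_on \<Omega>. \<bar>u x - \<phi> x\<bar> powr p + norm (G x - gradient \<phi> x) powr p) < e))"
proof -
  have \<Omega>': "\<Omega> \<in> sets lebesgue" using \<Omega> by auto
  have norm_eq: "sobolev_norm \<Omega> p (\<lambda>x. u x - \<phi> x) =
      (LINT x|lebesgue_on \<Omega>. \<bar>u x - \<phi> x\<bar> powr p + norm (G x - gradient \<phi> x) powr p) powr (1 / p)"
    if G: "has_weak_gradient \<Omega> u G" "in_Lp \<Omega> p u" "in_Lp \<Omega> p G" and \<phi>: "\<phi> \<in> test_functions \<Omega>" for G \<phi>
  proof -
    have \<phi>L: "in_Lp \<Omega> p \<phi>" "in_Lp \<Omega> p (gradient \<phi>)" using test_function_in_Lp[OF \<phi> \<Omega>'] p by auto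
    have smooth: "smooth_on UNIV \<phi>" using test_functionsE[OF \<phi>] by metis
    have AE: "AE x in lebesgue_on \<Omega>. weak_gradient \<Omega> (\<lambda>x. u x - \<phi> x) x = G x - gradient \<phi> x"
      by (rule weak_gradient_eq(1)[OF \<Omega> has_weak_gradient_diff[OF \<Omega> G(1) has_weak_gradient_gradient[OF smooth \<Omega>]]])
    have m[measurable]: "(\<lambda>x. u x - \<phi> x) \<in> borel_measurable (lebesgue_on \<Omega>)"
      "(\<lambda>x. G x - gradient \<phi> x) \<in> borel_measurable (lebesgue_on \<Omega>)"
      using G \<phi>L by (auto simp: in_Lp_def)
    have [measurable]: "weak_gradient \<Omega> (\<lambda>x. u x - \<phi> x) \<in> borel_measurable (lebesgue_on \<Omega>)"
      by (rule borel_measurable_lebesgue_on_AE[OF \<Omega>' _ m(2)]) (use AE in auto)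
    have "(LINT x|lebesgue_on \<Omega>. \<bar>u x - \<phi> x\<bar> powr p + norm (weak_gradient \<Omega> (\<lambda>x. u x - \<phi> x) x) powr p) =
        (LINT x|lebesgue_on \<Omega>. \<bar>u x - \<phi> x\<bar> powr p + norm (G x - gradient \<phi> x) powr p)"
      by (rule integral_cong_AE) (use AE in auto)
    then show ?thesis by (simp add: sobolev_norm_def)
  qed
  have lt_iff: "I powr (1 / p) < e \<longleftrightarrow> I < e powr p" if "0 \<le> I" "0 < e" for I e :: real
  proof -
    have "(I powr (1 / p)) powr p = I" using that p by (simp add: powr_powr)
    then show ?thesis
      using powr_less_mono2[of p "I powr (1/p)" e] powr_mono2[of p e "I powr (1/p)"] p that
      by (metis linorder_not_less order_le_less_trans powr_ge_zero zero_less_one le_less)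
  qed
  show ?thesis
  proof
    assume u: "u \<in> sobolev_W1_0 \<Omega> p"
    then obtain G where G: "has_weak_gradient \<Omega> u G" "in_Lp \<Omega> p u" "in_Lp \<Omega> p G"
      by (auto simp: sobolev_W1_0_def sobolev_W1_def)
    have "\<exists>\<phi>\<in>test_functions \<Omega>.
      (LINT x|lebesgue_on \<Omega>. \<bar>u x - \<phi> x\<bar> powr p + norm (G x - gradient \<phi> x) powr p) < e" if "e > 0" for e
    proof -
      have e: "e powr (1 / p) > 0" "(e powr (1 / p)) powr p = e" using that p by (auto simp: powr_powr)
      obtain \<phi> where \<phi>: "\<phi> \<in> test_functions \<Omega>" "sobolev_norm \<Omega> p (\<lambda>x. u x - \<phi> x) < e powr (1 / p)"
        using u e(1) unfolding sobolev_W1_0_def by blast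
      then show ?thesis
        using norm_eq[OF G \<phi>(1)] lt_iff[OF _ e(1)] e(2) by (auto intro!: bexI[OF _ \<phi>(1)])
    qed
    with G show "\<exists>G. has_weak_gradient \<Omega> u G \<and> in_Lp \<Omega> p u \<and> in_Lp \<Omega> p G \<and>
    (\<forall>e>0. \<exists>\<phi>\<in>test_functions \<Omega>.
      (LINT x|lebesgue_on \<Omega>. \<bar>u x - \<phi> x\<bar> powr p + norm (G x - gradient \<phi> x) powr p) < e)" by blast
  next
    assume "\<exists>G. has_weak_gradient \<Omega> u G \<and> in_Lp \<Omega> p u \<and> in_Lp \<Omega> p G \<and>
    (\<forall>e>0. \<exists>\<phi>\<in>test_functions \<Omega>.
      (LINT x|lebesgue_on \<Omega>. \<bar>u x - \<phi> x\<bar> powr p + norm (G x - gradient \<phi> x) powr p) < e)"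
    then obtain G where G: "has_weak_gradient \<Omega> u G" "in_Lp \<Omega> p u" "in_Lp \<Omega> p G" and
      appr: "\<And>e. e > 0 \<Longrightarrow> \<exists>\<phi>\<in>test_functions \<Omega>.
      (LINT x|lebesgue_on \<Omega>. \<bar>u x - \<phi> x\<bar> powr p + norm (G x - gradient \<phi> x) powr p) < e" by blast
    have "\<exists>\<phi>\<in>test_functions \<Omega>. sobolev_norm \<Omega> p (\<lambda>x. u x - \<phi> x) < e" if "e > 0" for e
    proof -
      have "e powr p > 0" using that by simp
      then obtain \<phi> where \<phi>: "\<phi> \<in> test_functions \<Omega>"
        "(LINT x|lebesgue_on \<Omega>. \<bar>u x - \<phi> x\<bar> powr p + norm (G x - gradient \<phi> x) powr p) < e powr p"
        using appr by blast
      then show ?thesis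
        using norm_eq[OF G \<phi>(1)] lt_iff[OF _ that] by (auto intro!: bexI[OF _ \<phi>(1)])
    qed
    with G show "u \<in> sobolev_W1_0 \<Omega> p" by (auto simp: sobolev_W1_0_def sobolev_W1_def)
  qed
qed

lemma test_functions_subset_sobolev_W1_0:
  assumes "open \<Omega>" "1 \<le> p" "\<phi> \<in> test_functions \<Omega>"
  shows "\<phi> \<in> sobolev_W1_0 \<Omega> p"
proof -
  have "has_weak_gradient \<Omega> \<phi> (gradient \<phi>)"
    using has_weak_gradient_gradient[OF _ assms(1)] test_functionsE[OF assms(3)] by metis
  then show ?thesis
    using assms test_function_in_Lp[OF assms(3), of p]
    by (subst sobolev_W1_0_iff) (auto intro!: exI[of _ "gradient \<phi>"] bexI[OF _ assms(3)])
qed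

text \<open>The squared norm keeps the function smooth at the origin. The transition takes place for
  |x| between \<epsilon> and the square root of 2 times \<epsilon>, hence inside the ball of radius
  2 \<epsilon>.\<close>

definition ball_cutoff :: "real \<Rightarrow> 'a::euclidean_space \<Rightarrow> real" where
  "ball_cutoff \<epsilon> x = smooth_step ((x \<bullet> x) / \<epsilon>\<^sup>2 - 1)"

lemma smooth_on_inner_self: "smooth_on UNIV (\<lambda>x::'a::euclidean_space. x \<bullet> x)"
  by (subst euclidean_inner) (intro smooth_on_sum smooth_on_mult smooth_on_inner open_UNIV)

lemma smooth_on_ball_cutoff: "smooth_on UNIV (ball_cutoff \<epsilon> :: 'a::euclidean_space \<Rightarrow> real)"
proof -
  have "smooth_on UNIV (\<lambda>x::'a. (x \<bullet> x) * (1 / \<epsilon>\<^sup>2) - 1)"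
    by (intro smooth_on_diff smooth_on_mult smooth_on_const smooth_on_inner_self open_UNIV)
  then show ?thesis unfolding ball_cutoff_def[abs_def]
    by (intro smooth_on_compose_real[OF _ _ smooth_on_smooth_step]) auto
qed

lemma ball_cutoff_simps:
  "0 < \<epsilon> \<Longrightarrow> norm x \<le> \<epsilon> \<Longrightarrow> ball_cutoff \<epsilon> x = 0"
  "0 < \<epsilon> \<Longrightarrow> 2 * \<epsilon> \<le> norm x \<Longrightarrow> ball_cutoff \<epsilon> x = 1"
  "0 \<le> ball_cutoff \<epsilon> x" "ball_cutoff \<epsilon> x \<le> 1"
proof -
  show "ball_cutoff \<epsilon> x = 0" if "0 < \<epsilon>" "norm x \<le> \<epsilon>"
  proof -
    have "x \<bullet> x \<le> \<epsilon>\<^sup>2" using that by (simp add: dot_square_norm power_mono)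
    then show ?thesis using that unfolding ball_cutoff_def by (intro smooth_step_simps) (simp add: field_simps)
  qed
  show "ball_cutoff \<epsilon> x = 1" if "0 < \<epsilon>" "2 * \<epsilon> \<le> norm x"
  proof -
    have "(2 * \<epsilon>)\<^sup>2 \<le> x \<bullet> x" unfolding dot_square_norm using that by (intro power_mono) auto
    moreover have "2 * \<epsilon>\<^sup>2 \<le> (2 * \<epsilon>)\<^sup>2" by (simp add: power_mult_distrib)
    ultimately have "2 * \<epsilon>\<^sup>2 \<le> x \<bullet> x" by linarith
    then show ?thesis using that unfolding ball_cutoff_def by (intro smooth_step_simps) (simp add: field_simps)
  qed
qed (simp_all add: ball_cutoff_def smooth_step_simps)

lemma smooth_on_real_derivative:
  fixes f :: "real \<Rightarrow> real"
  assumes "smooth_on U f" "x \<in> U" shows "(f has_real_derivative gradient f x) (at x)"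
  using smooth_on_has_derivative[OF assms] by (simp add: has_field_derivative_def)

text \<open>The chain rule produces the factor 2 |x| / \<epsilon>^2, and the derivative of the step
  vanishes unless |x| is at most 2 \<epsilon>. So four times a bound for that derivative on [0, 1]
  serves for all \<epsilon>.\<close>

lemma ball_cutoff_gradient_bound:
  obtains C where "0 \<le> C" "\<And>\<epsilon> x::'a::euclidean_space. 0 < \<epsilon> \<Longrightarrow> norm (gradient (ball_cutoff \<epsilon>) x) \<le> C / \<epsilon>"
proof -
  define g where "g = gradient smooth_step"
  have "continuous_on UNIV g" unfolding g_def by (rule continuous_on_gradient[OF smooth_on_smooth_step])
  then have "bounded (g ` {0..1})"
    by (intro compact_imp_bounded compact_continuous_image) (auto intro: continuous_on_subset)
  then obtain M where M: "\<And>s. s \<in> {0..1} \<Longrightarrow> \<bar>g s\<bar> \<le> M" unfolding bounded_real by blast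
  have M0: "0 \<le> M" using M[of 0] by simp
  have grad: "gradient (ball_cutoff \<epsilon>) x = (g ((x \<bullet> x) / \<epsilon>\<^sup>2 - 1) * 2 / \<epsilon>\<^sup>2) *\<^sub>R x" for \<epsilon> and x :: 'a
  proof (rule gradient_unique)
    have "(smooth_step has_derivative (\<lambda>h. h * g ((x \<bullet> x) / \<epsilon>\<^sup>2 - 1))) (at ((x \<bullet> x) / \<epsilon>\<^sup>2 - 1))"
      using smooth_on_has_derivative[OF smooth_on_smooth_step, of "(x \<bullet> x) / \<epsilon>\<^sup>2 - 1"]
      by (simp add: g_def mult.commute)
    moreover have "((\<lambda>x. (x \<bullet> x) / \<epsilon>\<^sup>2 - 1) has_derivative (\<lambda>h. 2 * (x \<bullet> h) / \<epsilon>\<^sup>2)) (at x)"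
      unfolding divide_inverse
      by (auto intro!: derivative_eq_intros simp: inner_commute algebra_simps)
    ultimately have "((\<lambda>x. smooth_step ((x \<bullet> x) / \<epsilon>\<^sup>2 - 1)) has_derivative
        (\<lambda>h. 2 * (x \<bullet> h) / \<epsilon>\<^sup>2 * g ((x \<bullet> x) / \<epsilon>\<^sup>2 - 1))) (at x)"
      by (rule has_derivative_compose[rotated])
    then show "(ball_cutoff \<epsilon> has_derivative (\<lambda>h. ((g ((x \<bullet> x) / \<epsilon>\<^sup>2 - 1) * 2 / \<epsilon>\<^sup>2) *\<^sub>R x) \<bullet> h)) (at x)"
      unfolding ball_cutoff_def[abs_def] by (simp add: mult_ac)
  qed
  have "norm (gradient (ball_cutoff \<epsilon>) x) \<le> 4 * M / \<epsilon>" if \<epsilon>: "0 < \<epsilon>" for \<epsilon> and x :: 'a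
  proof (cases "(x \<bullet> x) / \<epsilon>\<^sup>2 - 1 \<in> {0..1}")
    case True
    then have "(x \<bullet> x) / \<epsilon>\<^sup>2 \<le> 2" by simp
    then have "x \<bullet> x \<le> 2 * \<epsilon>\<^sup>2" using \<epsilon> by (simp add: pos_divide_le_eq)
    also have "\<dots> \<le> (2 * \<epsilon>)\<^sup>2" by (simp add: power_mult_distrib)
    finally have "(norm x)\<^sup>2 \<le> (2 * \<epsilon>)\<^sup>2" by (simp only: dot_square_norm)
    then have "norm x \<le> 2 * \<epsilon>" by (rule power2_le_imp_le) (use \<epsilon> in simp)
    then have "\<bar>g ((x \<bullet> x) / \<epsilon>\<^sup>2 - 1)\<bar> * 2 / \<epsilon>\<^sup>2 * norm x \<le> M * 2 / \<epsilon>\<^sup>2 * (2 * \<epsilon>)"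
      using M[OF True] M0 \<epsilon> by (intro mult_mono divide_right_mono) auto
    also have "\<dots> = 4 * M / \<epsilon>" using \<epsilon> by (simp add: power2_eq_square)
    finally show ?thesis unfolding grad by (simp add: abs_mult)
  next
    case False
    have "g s = 0" if "s \<notin> {0..1}" for s
    proof -
      have "((\<lambda>_. if s < 0 then 0 else 1::real) has_derivative (\<lambda>h. 0 \<bullet> h)) (at s)" by simp
      then have "(smooth_step has_derivative (\<lambda>h. 0 \<bullet> h)) (at s)"
        by (rule has_derivative_transform_within_open[where s="if s < 0 then {..<0} else {1<..}"])
           (use that in \<open>auto simp: smooth_step_simps\<close>)
      then show ?thesis unfolding g_def by (rule gradient_unique)
    qed
    then show ?thesis unfolding grad using False M0 \<epsilon> by simp
  qed
  with M0 show ?thesis by (intro that[of "4 * M"]) auto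
qed

lemma gradient_mult:
  assumes "smooth_on U f" "smooth_on U g" "x \<in> U"
  shows "gradient (\<lambda>x. f x * g x) x = f x *\<^sub>R gradient g x + g x *\<^sub>R gradient f x"
  by (rule gradient_unique, rule has_derivative_eq_rhs,
      rule has_derivative_mult[OF smooth_on_has_derivative[OF assms(1,3)] smooth_on_has_derivative[OF assms(2,3)]])
     (auto simp: inner_add_left)

lemma test_functions_mono: "A \<subseteq> B \<Longrightarrow> test_functions A \<subseteq> test_functions B"
  by (auto simp: test_functions_def)

text \<open>Cutting off a small ball of radius \<open>\<epsilon>\<close> changes the Sobolev norm by a power of \<open>\<epsilon>\<close>
  with exponent \<open>DIM('a) - p > 0\<close>: for \<open>p < n\<close> a point has zero \<open>p\<close>-capacity.\<close>

lemma test_function_punctured_approx: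
  fixes \<phi> :: "'a::euclidean_space \<Rightarrow> real" and p :: real
  assumes \<Omega>: "open \<Omega>" and p: "1 \<le> p" "p < DIM('a)" and \<phi>: "\<phi> \<in> test_functions \<Omega>" and e: "0 < e"
  shows "\<exists>\<psi>\<in>test_functions (\<Omega> - {0}).
    (LINT x|lebesgue_on \<Omega>. \<bar>\<phi> x - \<psi> x\<bar> powr p + norm (gradient \<phi> x - gradient \<psi> x) powr p) < e"
proof -
  obtain K where K: "smooth_on UNIV \<phi>" "compact K" "K \<subseteq> \<Omega>" "\<And>x. x \<notin> K \<Longrightarrow> \<phi> x = 0"
    using test_functionsE[OF \<phi>] by metis
  obtain C where C: "0 \<le> C" "\<And>\<epsilon> x::'a. 0 < \<epsilon> \<Longrightarrow> norm (gradient (ball_cutoff \<epsilon>) x) \<le> C / \<epsilon>"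
    using ball_cutoff_gradient_bound by metis
  have cont: "continuous_on UNIV \<phi>" "continuous_on UNIV (gradient \<phi>)"
    using smooth_on_continuous[OF K(1)] continuous_on_gradient[OF K(1)] by auto
  have "bounded (\<phi> ` cball 0 2)" "bounded (gradient \<phi> ` cball 0 2)"
    using cont by (auto intro!: compact_imp_bounded compact_continuous_image intro: continuous_on_subset)
  then obtain M1 M2 where M12: "\<And>y. y \<in> \<phi> ` cball 0 2 \<Longrightarrow> norm y \<le> M1" "\<And>y. y \<in> gradient \<phi> ` cball 0 2 \<Longrightarrow> norm y \<le> M2"
    unfolding bounded_iff by blast
  define M where "M = max 1 (max M1 M2)"
  have "\<bar>\<phi> x\<bar> \<le> M1" "norm (gradient \<phi> x) \<le> M2" if "norm x \<le> 2" for x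
    using M12(1)[of "\<phi> x"] M12(2)[of "gradient \<phi> x"] that by auto
  then have M: "0 < M" "\<And>x. norm x \<le> 2 \<Longrightarrow> \<bar>\<phi> x\<bar> \<le> M" "\<And>x. norm x \<le> 2 \<Longrightarrow> norm (gradient \<phi> x) \<le> M"
    unfolding M_def by (auto intro: max.coboundedI1 max.coboundedI2)
  define n where "n = DIM('a)"
  \<comment> \<open>The factor \<epsilon>^(-p) from the gradient of the cutoff will meet the volume
    of a ball of radius 2 \<epsilon>; Q collects what does not depend on \<epsilon>.\<close>
  define Q where "Q = (M powr p + (M + M * C) powr p) * (unit_ball_vol n * 2 ^ n)"
  have bound: "(LINT x|lebesgue_on \<Omega>. \<bar>\<phi> x - ball_cutoff \<epsilon> x * \<phi> x\<bar> powr p +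
      norm (gradient \<phi> x - gradient (\<lambda>x. ball_cutoff \<epsilon> x * \<phi> x) x) powr p) \<le> Q * \<epsilon> powr (n - p)"
    if \<epsilon>: "0 < \<epsilon>" "\<epsilon> \<le> 1" for \<epsilon>
  proof -
    let ?\<psi> = "\<lambda>x. ball_cutoff \<epsilon> x * \<phi> x"
    let ?B = "(M powr p + (M + M * C) powr p) * \<epsilon> powr (- p)"
    have gr: "gradient ?\<psi> x = ball_cutoff \<epsilon> x *\<^sub>R gradient \<phi> x + \<phi> x *\<^sub>R gradient (ball_cutoff \<epsilon>) x" for x
      by (rule gradient_mult[OF smooth_on_ball_cutoff K(1)]) simp
    have pt: "\<bar>\<phi> x - ?\<psi> x\<bar> powr p + norm (gradient \<phi> x - gradient ?\<psi> x) powr p \<le> indicator (cball 0 (2 * \<epsilon>)) x * ?B" for x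
    proof (cases "norm x \<le> 2 * \<epsilon>")
      case True
      then have x2: "norm x \<le> 2" using \<epsilon> by linarith
      \<comment> \<open>This weakens the bound M^p for the function to the order of the gradient
        term, so that one bound covers both.\<close>
      have \<epsilon>p: "1 \<le> \<epsilon> powr (- p)" using powr_mono'[of "- p" 0 \<epsilon>] \<epsilon> p by simp
      have "\<phi> x - ?\<psi> x = (1 - ball_cutoff \<epsilon> x) * \<phi> x" by (simp add: algebra_simps)
      then have "\<bar>\<phi> x - ?\<psi> x\<bar> = \<bar>1 - ball_cutoff \<epsilon> x\<bar> * \<bar>\<phi> x\<bar>" by (simp only: abs_mult)
      also have "\<dots> \<le> 1 * M"
        using ball_cutoff_simps(3,4)[of \<epsilon> x] M(2)[OF x2] by (intro mult_mono) auto
      finally have "\<bar>\<phi> x - ?\<psi> x\<bar> \<le> 1 * M" .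
      then have "\<bar>\<phi> x - ?\<psi> x\<bar> powr p \<le> M powr p" using p by (intro powr_mono2) auto
      also have "\<dots> \<le> M powr p * \<epsilon> powr (- p)" using \<epsilon>p by (simp add: mult_le_cancel_left1)
      finally have 1: "\<bar>\<phi> x - ?\<psi> x\<bar> powr p \<le> M powr p * \<epsilon> powr (- p)" .
      have "gradient \<phi> x - gradient ?\<psi> x = (1 - ball_cutoff \<epsilon> x) *\<^sub>R gradient \<phi> x - \<phi> x *\<^sub>R gradient (ball_cutoff \<epsilon>) x"
        unfolding gr by (simp add: algebra_simps)
      also have "norm \<dots> \<le> \<bar>1 - ball_cutoff \<epsilon> x\<bar> * norm (gradient \<phi> x) + \<bar>\<phi> x\<bar> * norm (gradient (ball_cutoff \<epsilon>) x)"
        using norm_triangle_ineq4[of "(1 - ball_cutoff \<epsilon> x) *\<^sub>R gradient \<phi> x" "\<phi> x *\<^sub>R gradient (ball_cutoff \<epsilon>) x"] by simp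
      also have "\<dots> \<le> 1 * M + M * (C / \<epsilon>)"
        using ball_cutoff_simps(3,4)[of \<epsilon> x] M(1) M(2,3)[OF x2] C(2)[OF \<epsilon>(1)] by (intro add_mono mult_mono) auto
      also have "\<dots> \<le> (M + M * C) / \<epsilon>" using \<epsilon> M(1) by (simp add: field_simps)
      finally have "norm (gradient \<phi> x - gradient ?\<psi> x) powr p \<le> ((M + M * C) / \<epsilon>) powr p"
        using p by (intro powr_mono2) auto
      also have "\<dots> = (M + M * C) powr p * \<epsilon> powr (- p)"
        using \<epsilon> by (simp add: powr_divide powr_minus_divide)
      finally show ?thesis using 1 True by (simp add: algebra_simps)
    next
      case False
      have "((\<lambda>x. \<phi> x - ?\<psi> x) has_derivative (\<lambda>h. 0 \<bullet> h)) (at x)"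
        by (rule has_derivative_transform_within_open[where s="- cball 0 (2 * \<epsilon>)" and f="\<lambda>_. 0"])
           (use False \<epsilon> in \<open>auto simp: ball_cutoff_simps\<close>)
      moreover have "((\<lambda>x. \<phi> x - ?\<psi> x) has_derivative (\<lambda>h. (gradient \<phi> x - gradient ?\<psi> x) \<bullet> h)) (at x)"
        unfolding inner_diff_left
        by (intro has_derivative_diff smooth_on_has_derivative[where U=UNIV] smooth_on_mult smooth_on_ball_cutoff K(1)) auto
      ultimately have "gradient \<phi> x - gradient ?\<psi> x = 0" using gradient_unique by metis
      then show ?thesis using False \<epsilon> p by (simp add: ball_cutoff_simps)
    qed
    have int_cball: "integrable lebesgue (indicator (cball (0::'a) (2 * \<epsilon>)) :: 'a \<Rightarrow> real)"
      using lmeasurable_cball[of "0::'a" "2 * \<epsilon>"] by (simp only: lmeasurable_iff_integrable)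
    have "(LINT x|lebesgue_on \<Omega>. \<bar>\<phi> x - ?\<psi> x\<bar> powr p + norm (gradient \<phi> x - gradient ?\<psi> x) powr p)
        \<le> (LINT x|lebesgue_on \<Omega>. indicator (cball 0 (2 * \<epsilon>)) x * ?B)"
    proof (rule integral_mono')
      have "integrable lebesgue (\<lambda>x. indicator \<Omega> x *\<^sub>R (indicator (cball 0 (2 * \<epsilon>)) x * ?B))"
      proof (rule Bochner_Integration.integrable_bound)
        show "integrable lebesgue (\<lambda>x. indicator (cball (0::'a) (2 * \<epsilon>)) x * ?B)"
          by (intro integrable_mult_left int_cball)
        show "(\<lambda>x. indicator \<Omega> x *\<^sub>R (indicator (cball 0 (2 * \<epsilon>)) x * ?B)) \<in> borel_measurable lebesgue"
          using \<Omega> by (intro borel_measurable_scaleR borel_measurable_times borel_measurable_indicator borel_measurable_const) auto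
      qed (auto simp: indicator_def)
      then show "integrable (lebesgue_on \<Omega>) (\<lambda>x. indicator (cball 0 (2 * \<epsilon>)) x * ?B)"
        using \<Omega> by (subst integrable_restrict_space) auto
    qed (use pt in auto)
    also have "\<dots> = (LINT x|lebesgue. indicator \<Omega> x *\<^sub>R (indicator (cball 0 (2 * \<epsilon>)) x * ?B))"
      using \<Omega> by (subst integral_restrict_space) auto
    also have "\<dots> \<le> (LINT x|lebesgue. indicator (cball (0::'a) (2 * \<epsilon>)) x * ?B)"
    proof (rule integral_mono')
      show "integrable lebesgue (\<lambda>x. indicator (cball (0::'a) (2 * \<epsilon>)) x * ?B)"
        by (intro integrable_mult_left int_cball)
    qed (auto simp: indicator_def)
    also have "\<dots> = measure lborel (cball (0::'a) (2 * \<epsilon>)) * ?B" by simp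
    also have "\<dots> = Q * (\<epsilon> ^ n * \<epsilon> powr (- p))"
      using \<epsilon> by (simp add: content_cball Q_def n_def power_mult_distrib)
    also have "\<epsilon> ^ n * \<epsilon> powr (- p) = \<epsilon> powr (n - p)"
      using \<epsilon> by (simp add: powr_diff powr_minus powr_realpow field_simps)
    finally show ?thesis .
  qed
  have "((\<lambda>\<epsilon>. Q * \<epsilon> powr (n - p)) \<longlongrightarrow> Q * 0) (at_right 0)"
    using p by (intro tendsto_intros tendsto_zero_powrI[where b="n - p"]) (auto simp: n_def eventually_at_right_less intro: tendsto_ident_at eventually_at_rightI[of 0 1])
  then have "eventually (\<lambda>\<epsilon>. Q * \<epsilon> powr (n - p) < e) (at_right 0)"
    using e by (simp add: order_tendstoD)
  then obtain b where b: "b > 0" "\<And>y. 0 < y \<Longrightarrow> y < b \<Longrightarrow> Q * y powr (n - p) < e"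
    by (auto simp: eventually_at_right_field)
  define \<epsilon> where "\<epsilon> = min 1 (b / 2)"
  have \<epsilon>: "0 < \<epsilon>" "\<epsilon> \<le> 1" "\<epsilon> < b" using b(1) by (auto simp: \<epsilon>_def)
  have "(\<lambda>x. ball_cutoff \<epsilon> x * \<phi> x) \<in> test_functions (\<Omega> - {0})"
  proof (rule test_functionsI)
    show "smooth_on UNIV (\<lambda>x. ball_cutoff \<epsilon> x * \<phi> x)" by (intro smooth_on_mult smooth_on_ball_cutoff K(1)) auto
    show "compact (K - ball 0 \<epsilon>)" using K(2) by (simp add: compact_diff)
    show "K - ball 0 \<epsilon> \<subseteq> \<Omega> - {0}" using K(3) \<epsilon> by auto
    show "ball_cutoff \<epsilon> x * \<phi> x = 0" if "x \<notin> K - ball 0 \<epsilon>" for x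
      using that K(4)[of x] ball_cutoff_simps(1)[OF \<epsilon>(1), of x] by auto
  qed
  moreover have "(LINT x|lebesgue_on \<Omega>. \<bar>\<phi> x - ball_cutoff \<epsilon> x * \<phi> x\<bar> powr p +
      norm (gradient \<phi> x - gradient (\<lambda>x. ball_cutoff \<epsilon> x * \<phi> x) x) powr p) < e"
    using bound[OF \<epsilon>(1,2)] b(2)[OF \<epsilon>(1,3)] by linarith
  ultimately show ?thesis by (intro bexI[where x="\<lambda>x. ball_cutoff \<epsilon> x * \<phi> x"])
qed

lemma sobolev_W1_0_punctured_approx:
  fixes u :: "'a::euclidean_space \<Rightarrow> real" and p :: real
  assumes \<Omega>: "open \<Omega>" and p: "1 \<le> p" "p < DIM('a)" and u: "u \<in> sobolev_W1_0 \<Omega> p"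
  obtains G where "has_weak_gradient \<Omega> u G" "in_Lp \<Omega> p u" "in_Lp \<Omega> p G"
    "\<And>e. e > 0 \<Longrightarrow> \<exists>\<psi>\<in>test_functions (\<Omega> - {0}).
      (LINT x|lebesgue_on \<Omega>. \<bar>u x - \<psi> x\<bar> powr p + norm (G x - gradient \<psi> x) powr p) < e"
proof -
  have \<Omega>': "\<Omega> \<in> sets lebesgue" using \<Omega> by auto
  obtain G where G: "has_weak_gradient \<Omega> u G" "in_Lp \<Omega> p u" "in_Lp \<Omega> p G" and
    appr: "\<And>e. e > 0 \<Longrightarrow> \<exists>\<phi>\<in>test_functions \<Omega>.
    (LINT x|lebesgue_on \<Omega>. \<bar>u x - \<phi> x\<bar> powr p + norm (G x - gradient \<phi> x) powr p) < e"
    using u sobolev_W1_0_iff[OF \<Omega>, of p u] p by auto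
  \<comment> \<open>Convexity with \<theta> = 1/2 multiplies each of the two approximation errors by
    c, so each of them is made smaller than e / (2 c).\<close>
  define c where "c = (1 / 2 :: real) powr (1 - p)"
  have c: "c > 0" by (simp add: c_def)
  have "\<exists>\<psi>\<in>test_functions (\<Omega> - {0}).
      (LINT x|lebesgue_on \<Omega>. \<bar>u x - \<psi> x\<bar> powr p + norm (G x - gradient \<psi> x) powr p) < e" if e: "e > 0" for e
  proof -
    have e': "e / (2 * c) > 0" using e c by simp
    obtain \<phi> where \<phi>: "\<phi> \<in> test_functions \<Omega>"
      "(LINT x|lebesgue_on \<Omega>. \<bar>u x - \<phi> x\<bar> powr p + norm (G x - gradient \<phi> x) powr p) < e / (2 * c)"
      using appr[OF e'] by blast
    obtain \<psi> where \<psi>: "\<psi> \<in> test_functions (\<Omega> - {0})"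
      "(LINT x|lebesgue_on \<Omega>. \<bar>\<phi> x - \<psi> x\<bar> powr p + norm (gradient \<phi> x - gradient \<psi> x) powr p) < e / (2 * c)"
      using test_function_punctured_approx[OF \<Omega> p \<phi>(1) e'] by blast
    have \<psi>': "\<psi> \<in> test_functions \<Omega>" using \<psi>(1) test_functions_mono[of "\<Omega> - {0}" \<Omega>] by auto
    have L: "in_Lp \<Omega> p \<phi>" "in_Lp \<Omega> p (gradient \<phi>)" "in_Lp \<Omega> p \<psi>" "in_Lp \<Omega> p (gradient \<psi>)"
      using test_function_in_Lp[OF \<phi>(1) \<Omega>', of p] test_function_in_Lp[OF \<psi>' \<Omega>', of p] p by auto
    have I: "integrable (lebesgue_on \<Omega>) (\<lambda>x. \<bar>u x - \<phi> x\<bar> powr p + norm (G x - gradient \<phi> x) powr p)"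
      "integrable (lebesgue_on \<Omega>) (\<lambda>x. \<bar>\<phi> x - \<psi> x\<bar> powr p + norm (gradient \<phi> x - gradient \<psi> x) powr p)"
      using in_Lp_diff[OF p(1) G(2) L(1)] in_Lp_diff[OF p(1) G(3) L(2)]
        in_Lp_diff[OF p(1) L(1) L(3)] in_Lp_diff[OF p(1) L(2) L(4)] by (auto simp: in_Lp_def)
    have "(LINT x|lebesgue_on \<Omega>. \<bar>u x - \<psi> x\<bar> powr p + norm (G x - gradient \<psi> x) powr p) \<le>
      (LINT x|lebesgue_on \<Omega>. c * (\<bar>u x - \<phi> x\<bar> powr p + norm (G x - gradient \<phi> x) powr p) +
         c * (\<bar>\<phi> x - \<psi> x\<bar> powr p + norm (gradient \<phi> x - gradient \<psi> x) powr p))"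
    proof (rule integral_mono')
      fix x
      show "\<bar>u x - \<psi> x\<bar> powr p + norm (G x - gradient \<psi> x) powr p \<le>
        c * (\<bar>u x - \<phi> x\<bar> powr p + norm (G x - gradient \<phi> x) powr p) +
         c * (\<bar>\<phi> x - \<psi> x\<bar> powr p + norm (gradient \<phi> x - gradient \<psi> x) powr p)"
        using norm_powr_add_le_convex[of p "1/2" "u x - \<psi> x" "u x - \<phi> x"]
          norm_powr_add_le_convex[of p "1/2" "G x - gradient \<psi> x" "G x - gradient \<phi> x"] p
        by (simp add: c_def algebra_simps)
    qed (use I c in auto)
    also have "\<dots> = c * (LINT x|lebesgue_on \<Omega>. \<bar>u x - \<phi> x\<bar> powr p + norm (G x - gradient \<phi> x) powr p) +
         c * (LINT x|lebesgue_on \<Omega>. \<bar>\<phi> x - \<psi> x\<bar> powr p + norm (gradient \<phi> x - gradient \<psi> x) powr p)"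
      by (subst Bochner_Integration.integral_add) (use I in auto)
    also have "\<dots> < c * (e / (2 * c)) + c * (e / (2 * c))"
      using \<phi>(2) \<psi>(2) c by (intro add_strict_mono mult_strict_left_mono) auto
    also have "\<dots> = e" using c by (simp add: field_simps)
    finally show ?thesis using \<psi>(1) by blast
  qed
  with G show ?thesis by (rule that)
qed

section \<open>The inequality for test functions\<close>

lemma continuous_on_UNIV_extend_zero:
  fixes f :: "'a::euclidean_space \<Rightarrow> 'b::real_normed_vector"
  assumes "continuous_on U f" "open U" "closed K" "K \<subseteq> U" "\<And>x. x \<notin> K \<Longrightarrow> f x = 0"
  shows "continuous_on UNIV f"
proof -
  have "continuous_on (- K) f"
    using continuous_on_const[of "- K" 0] by (rule continuous_on_eq) (use assms(5) in auto)
  then have "continuous_on (U \<union> - K) f" using assms by (intro continuous_on_open_Un) auto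
  moreover have "U \<union> - K = UNIV" using assms(4) by auto
  ultimately show ?thesis by simp
qed

definition hardy_weight :: "real \<Rightarrow> real \<Rightarrow> 'a::euclidean_space \<Rightarrow> real" where
  "hardy_weight p R x = 1 / (norm x powr p * qlog ((real DIM('a) - 1) / (p - 1)) (R / norm x) powr p)"

text \<open>\<open>sobolev_exp p n\<close> and \<open>radial_time p n R\<close> are the \<open>a\<close> and \<open>t\<close> in which the claim becomes
  Hardy's inequality on the half line: \<open>t = r\<^sup>-\<^sup>a - R\<^sup>-\<^sup>a\<close> with \<open>a = (n - p) / (p - 1)\<close>.\<close>

definition sobolev_exp :: "real \<Rightarrow> real \<Rightarrow> real" where
  "sobolev_exp p n = (n - p) / (p - 1)"

definition radial_time :: "real \<Rightarrow> real \<Rightarrow> real \<Rightarrow> real \<Rightarrow> real" where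
  "radial_time p n R r = r powr (- sobolev_exp p n) - R powr (- sobolev_exp p n)"

lemma sobolev_exp_pos: "1 < p \<Longrightarrow> p < n \<Longrightarrow> 0 < sobolev_exp p n"
  by (simp add: sobolev_exp_def)

text \<open>The arithmetic that fixes a: the first identity gives the modulus of the vector field
  and the Jacobian of the scaling, the second one the divergence of the field.\<close>

lemma sobolev_exp_eqs:
  assumes "1 < p" "p < n"
  shows "(1 + sobolev_exp p n) * (p - 1) = n - 1" "p * (1 + sobolev_exp p n) = n + sobolev_exp p n"
  using assms by (simp_all add: sobolev_exp_def field_simps)

lemma radial_time_pos:
  assumes "1 < p" "p < n" "0 < r" "r < R"
  shows "0 < radial_time p n R r"
  using assms powr_less_mono2_neg[of "- sobolev_exp p n" r R] sobolev_exp_pos[of p n]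
  by (simp add: radial_time_def)

text \<open>For q = (n - 1) / (p - 1) one has 1 - q = -a, so the q-logarithm is the time up to an
  elementary factor.\<close>

lemma qlog_eq_radial_time:
  assumes "1 < p" "p < n" "0 < r" "0 < R"
  shows "qlog ((n - 1) / (p - 1)) (R / r) = r powr sobolev_exp p n * radial_time p n R r / sobolev_exp p n"
proof -
  let ?a = "sobolev_exp p n"
  have q: "1 - (n - 1) / (p - 1) = - ?a" using assms by (simp add: sobolev_exp_def field_simps)
  have "(R / r) powr (- ?a) = r powr ?a * R powr (- ?a)"
    using assms by (simp add: powr_divide powr_minus field_simps)
  moreover have "r powr ?a * r powr (- ?a) = 1" using assms by (simp add: powr_minus)
  ultimately show ?thesis
    using sobolev_exp_pos[OF assms(1,2)] unfolding qlog_def q radial_time_def by (simp add: field_simps)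
qed

text \<open>The base of the power is |dt/dr| / t, so the p-th root of the weight is the modulus of
  the radial derivative of ln t.\<close>

lemma hardy_weight_eq:
  fixes x :: "'a::euclidean_space" and p R :: real
  assumes p: "1 < p" "p < DIM('a)" and x: "x \<noteq> 0" "norm x < R"
  defines "a \<equiv> sobolev_exp p DIM('a)" and "t \<equiv> radial_time p DIM('a) R (norm x)"
  shows "hardy_weight p R x = (a * norm x powr (- 1 - a) / t) powr p"
proof -
  have r: "0 < norm x" "0 < R" using x by (auto intro: le_less_trans[OF norm_ge_zero])
  have t: "0 < t" unfolding t_def using radial_time_pos p x r by auto
  have a: "0 < a" unfolding a_def using sobolev_exp_pos p by auto
  have "norm x powr p * qlog ((real DIM('a) - 1) / (p - 1)) (R / norm x) powr p
      = (norm x * (norm x powr a * t / a)) powr p"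
    using r t a qlog_eq_radial_time[OF p r] unfolding a_def[symmetric] t_def[symmetric]
    by (simp add: powr_mult[symmetric])
  also have "norm x * (norm x powr a * t / a) = 1 / (a * norm x powr (- 1 - a) / t)"
    using r t a by (simp add: powr_diff powr_minus field_simps)
  also have "1 / (1 / (a * norm x powr (- 1 - a) / t)) powr p = (a * norm x powr (- 1 - a) / t) powr p"
    using r t a by (simp add: powr_divide)
  finally show ?thesis unfolding hardy_weight_def .
qed

text \<open>The derivative p |s|^(p-1) sgn s is written with positive and negative parts, which
  makes its continuity evident. At 0 the difference quotient is bounded by |h|^(p-1), with a
  positive exponent.\<close>

lemma has_real_derivative_abs_powr:
  assumes "1 < p"
  shows "((\<lambda>s::real. \<bar>s\<bar> powr p) has_real_derivative p * (max s 0 powr (p - 1) - max (- s) 0 powr (p - 1))) (at s)"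
proof -
  consider "s > 0" | "s < 0" | "s = 0" by linarith
  then show ?thesis
  proof cases
    case 1
    have "((\<lambda>s. s powr p) has_real_derivative p * (max s 0 powr (p - 1) - max (- s) 0 powr (p - 1))) (at s)"
      using 1 by (auto intro!: derivative_eq_intros)
    then show ?thesis
      by (rule has_field_derivative_transform_within_open[where S="{0<..}"]) (use 1 in auto)
  next
    case 2
    have "((\<lambda>s. (- s) powr p) has_real_derivative p * (max s 0 powr (p - 1) - max (- s) 0 powr (p - 1))) (at s)"
      using 2 by (auto intro!: derivative_eq_intros)
    then show ?thesis
      by (rule has_field_derivative_transform_within_open[where S="{..<0}"]) (use 2 in auto)
  next
    case 3
    have "((\<lambda>h. \<bar>h\<bar> powr (p - 1)) \<longlongrightarrow> 0) (at 0)"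
      by (rule tendsto_zero_powrI[where b="p - 1"]) (use assms in \<open>auto intro!: tendsto_eq_intros\<close>)
    moreover have "\<forall>\<^sub>F h in at 0. norm (\<bar>h\<bar> powr p / h) \<le> \<bar>h\<bar> powr (p - 1) * 1" for h
      by (rule always_eventually) (auto simp: powr_diff field_simps)
    ultimately have "((\<lambda>h. \<bar>h\<bar> powr p / h) \<longlongrightarrow> 0) (at 0)"
      by (metis (no_types, lifting) Lim_null_comparison eventually_mono mult.right_neutral)
    then show ?thesis using 3 assms by (simp add: has_field_derivative_iff)
  qed
qed

text \<open>The choice of \<open>\<kappa>\<close> is the one that produces the optimal constant.\<close>

lemma hardy_young:
  fixes x y p :: real
  assumes p: "1 < p" and xy: "0 \<le> x" "0 \<le> y"
  defines "\<kappa> \<equiv> (p - 1) / p"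
  shows "\<kappa> powr (p - 1) * (p * x powr (p - 1) * y) \<le> \<kappa> powr (p - 1) * ((p - 1) * x powr p) - \<kappa> powr p * x powr p + y powr p"
proof -
  have \<kappa>: "0 < \<kappa>" using p by (simp add: \<kappa>_def)
  define q where "q = p / (p - 1)"
  have q: "q > 1" "1 / p + 1 / q = 1" using p by (auto simp: q_def field_simps)
  have "y * (\<kappa> * x) powr (p - 1) \<le> y powr p / p + ((\<kappa> * x) powr (p - 1)) powr q / q"
    by (rule Youngs_inequality) (use p q xy in auto)
  also have "((\<kappa> * x) powr (p - 1)) powr q = \<kappa> powr p * x powr p"
    using p xy \<kappa> by (simp add: powr_powr q_def powr_mult)
  finally have "p * (y * (\<kappa> powr (p - 1) * x powr (p - 1))) \<le> p * (y powr p / p + \<kappa> powr p * x powr p / q)"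
    using p xy \<kappa> by (intro mult_left_mono) (auto simp: powr_mult)
  also have "\<dots> = y powr p + (p - 1) * (\<kappa> powr p * x powr p)"
    using p by (simp add: q_def field_simps)
  \<comment> \<open>After the product term is absorbed, x^p retains the coefficient (p -
    1)(\<kappa>^(p-1) - \<kappa>^p). As a function of \<kappa> this is maximal at (p - 1) / p, where
    it equals \<kappa>^p.\<close>
  also have "(p - 1) * (\<kappa> powr p * x powr p) = \<kappa> powr (p - 1) * ((p - 1) * x powr p) - \<kappa> powr p * x powr p"
  proof -
    have "\<kappa> powr p = \<kappa> powr (p - 1) * \<kappa>" using \<kappa> by (simp add: powr_diff)
    moreover have "p * \<kappa> = p - 1" using p by (simp add: \<kappa>_def)
    ultimately have "p * \<kappa> powr p = \<kappa> powr (p - 1) * (p - 1)" by (metis mult.assoc mult.commute)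
    then have "p * (\<kappa> powr p * x powr p) = \<kappa> powr (p - 1) * ((p - 1) * x powr p)" by (metis mult.assoc)
    then show ?thesis by (simp add: left_diff_distrib)
  qed
  finally show ?thesis by (simp add: mult_ac)
qed

lemma has_derivative_compose_inner:
  assumes "(f has_derivative (\<lambda>v. w \<bullet> v)) (at x)" "(\<phi> has_real_derivative d) (at (f x))"
  shows "((\<lambda>x. \<phi> (f x)) has_derivative (\<lambda>v. (d *\<^sub>R w) \<bullet> v)) (at x)"
  using has_derivative_compose[OF assms(1), of \<phi> "\<lambda>h. d * h"] assms(2)
  by (simp add: has_field_derivative_def)

lemma has_derivative_norm_powr:
  fixes x :: "'a::euclidean_space"
  assumes "x \<noteq> 0"
  shows "((\<lambda>x. norm x powr r) has_derivative (\<lambda>v. ((r * norm x powr (r - 2)) *\<^sub>R x) \<bullet> v)) (at x)"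
proof -
  have "(norm has_derivative (\<lambda>v. (x /\<^sub>R norm x) \<bullet> v)) (at x)"
    using has_derivative_norm[OF assms] by (simp add: sgn_div_norm inner_commute)
  moreover have "((\<lambda>s. s powr r) has_real_derivative r * norm x powr (r - 1)) (at (norm x))"
    using assms by (intro has_real_derivative_powr) simp
  ultimately have "((\<lambda>x. norm x powr r) has_derivative
      (\<lambda>v. ((r * norm x powr (r - 1)) *\<^sub>R (x /\<^sub>R norm x)) \<bullet> v)) (at x)"
    by (rule has_derivative_compose_inner)
  moreover have "norm x powr (r - 1) / norm x = norm x powr (r - 2)"
    using assms by (simp add: powr_diff powr_numeral power2_eq_square)
  then have "(r * norm x powr (r - 1)) *\<^sub>R (x /\<^sub>R norm x) = (r * norm x powr (r - 2)) *\<^sub>R x"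
    by (simp add: divide_inverse mult.assoc)
  ultimately show ?thesis by (simp only:)
qed

text \<open>The divergence theorem for the compactly supported field h(x) x, obtained by summing the
  coordinate derivatives. Only a continuous gradient is asked of h, because it will contain
  |\<psi>|^p.\<close>

lemma integral_divergence_radial:
  fixes h :: "'a::euclidean_space \<Rightarrow> real"
  assumes der: "\<And>x. (h has_derivative (\<lambda>v. g x \<bullet> v)) (at x)"
    and cont: "continuous_on UNIV g" and K: "compact K" "\<And>x. x \<notin> K \<Longrightarrow> h x = 0"
  shows "(\<integral>x. (g x \<bullet> x + DIM('a) * h x) \<partial>lborel) = 0"
proof -
  have g0: "g x = 0" if "x \<notin> K" for x
    using gradient_eq_0_outside[of K h x] gradient_unique[OF der] K that compact_imp_closed by metis
  have hc: "continuous_on UNIV h"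
    by (metis der continuous_at_imp_continuous_on has_derivative_continuous)
  have c: "continuous_on UNIV (\<lambda>x. ((x \<bullet> b) *\<^sub>R g x + h x *\<^sub>R b) \<bullet> b)" for b
    by (intro continuous_intros cont hc)
  have "(\<integral>x. ((x \<bullet> b) *\<^sub>R g x + h x *\<^sub>R b) \<bullet> b \<partial>lborel) = 0" for b
  proof (rule integral_partial_derivative_eq_0[OF _ c K(1), where f="\<lambda>x. (x \<bullet> b) * h x"])
    show "((\<lambda>x. (x \<bullet> b) * h x) has_derivative (\<lambda>v. ((x \<bullet> b) *\<^sub>R g x + h x *\<^sub>R b) \<bullet> v)) (at x)" for x
      by (rule has_derivative_eq_rhs, rule has_derivative_mult[OF has_derivative_inner_left[OF has_derivative_ident] der])
         (simp add: inner_add_left inner_commute[of b] mult.commute)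
  qed (use K in auto)
  moreover have "integrable lborel (\<lambda>x. ((x \<bullet> b) *\<^sub>R g x + h x *\<^sub>R b) \<bullet> b)" for b
    by (rule integral_continuous_compact_support(1)[OF c K(1) _ order_refl]) (use g0 K in \<open>auto intro: fmeasurableD lmeasurable_compact\<close>)
  ultimately have "(\<integral>x. (\<Sum>b\<in>Basis. ((x \<bullet> b) *\<^sub>R g x + h x *\<^sub>R b) \<bullet> b) \<partial>lborel) = 0"
    by (subst Bochner_Integration.integral_sum) auto
  moreover have "(\<Sum>b\<in>Basis. ((x \<bullet> b) *\<^sub>R g x + h x *\<^sub>R b) \<bullet> b) = g x \<bullet> x + DIM('a) * h x" for x
  proof -
    have "(\<Sum>b\<in>Basis. ((x \<bullet> b) *\<^sub>R g x + h x *\<^sub>R b) \<bullet> b) = (\<Sum>b\<in>Basis. (g x \<bullet> b) * (x \<bullet> b) + h x)"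
      by (rule sum.cong) (auto simp: inner_add_left)
    also have "\<dots> = (\<Sum>b\<in>Basis. (g x \<bullet> b) * (x \<bullet> b)) + DIM('a) * h x" by (simp add: sum.distrib)
    also have "(\<Sum>b\<in>Basis. (g x \<bullet> b) * (x \<bullet> b)) = g x \<bullet> x" by (rule euclidean_inner[symmetric])
    finally show ?thesis .
  qed
  ultimately show ?thesis by simp
qed

lemma continuous_on_hardy_weight:
  fixes R p :: real
  assumes p: "1 < p" "p < DIM('a)"
  shows "continuous_on (ball (0::'a::euclidean_space) R - {0}) (hardy_weight p R)"
proof -
  let ?a = "sobolev_exp p DIM('a)"
  have pos: "radial_time p DIM('a) R (norm x) > 0" if "x \<in> ball 0 R - {0}" for x :: 'a
    using that p by (intro radial_time_pos) auto
  have "continuous_on (ball (0::'a) R - {0}) (\<lambda>x. (?a * norm x powr (- 1 - ?a) / radial_time p DIM('a) R (norm x)) powr p)"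
    using pos sobolev_exp_pos[OF p] unfolding radial_time_def
    by (intro continuous_intros) (auto simp: less_le)
  then show ?thesis
    by (rule continuous_on_eq) (use hardy_weight_eq[OF p] in auto)
qed

lemma hardy_test_function:
  fixes \<psi> :: "'a::euclidean_space \<Rightarrow> real" and p R :: real
  assumes p: "1 < p" "p < DIM('a)" and \<psi>: "\<psi> \<in> test_functions (ball 0 R - {0})"
  shows "integrable (lebesgue_on (ball 0 R)) (\<lambda>x. hardy_weight p R x * \<bar>\<psi> x\<bar> powr p)"
    and "integrable (lebesgue_on (ball 0 R)) (\<lambda>x. \<bar>(x /\<^sub>R norm x) \<bullet> gradient \<psi> x\<bar> powr p)"
    and "((p - 1) / p) powr p * (LINT x|lebesgue_on (ball 0 R). hardy_weight p R x * \<bar>\<psi> x\<bar> powr p)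
      \<le> (LINT x|lebesgue_on (ball 0 R). \<bar>(x /\<^sub>R norm x) \<bullet> gradient \<psi> x\<bar> powr p)"
proof -
  obtain K where K: "smooth_on UNIV \<psi>" "compact K" "K \<subseteq> ball 0 R - {0}" "\<And>x. x \<notin> K \<Longrightarrow> \<psi> x = 0"
    using test_functionsE[OF \<psi>] by metis
  define U where "U = ball (0::'a) R - {0}"
  have U: "open U" unfolding U_def by (simp add: open_delete)
  have KU: "K \<subseteq> U" "closed K" using K unfolding U_def by (auto intro: compact_imp_closed)
  have KR: "K \<subseteq> ball 0 R" using K(3) by auto
  define a where "a = sobolev_exp p DIM('a)"
  define n where "n = real DIM('a)"
  define t where "t x = radial_time p n R (norm x)" for x :: 'a
  have a: "a > 0" using sobolev_exp_pos p by (simp add: a_def)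
  have t: "t x > 0" if "x \<in> U" for x using radial_time_pos p that by (auto simp: t_def U_def n_def)
  have pow: "(1 + a) * (p - 1) = n - 1" "p * (1 + a) = n + a"
    using sobolev_exp_eqs[OF p] by (simp_all add: a_def n_def)
  define W where "W = (hardy_weight p R :: 'a \<Rightarrow> real)"
  define Y where "Y x = \<bar>(x /\<^sub>R norm x) \<bullet> gradient \<psi> x\<bar>" for x
  define \<kappa> where "\<kappa> = (p - 1) / p"
  have \<kappa>: "\<kappa> > 0" using p by (simp add: \<kappa>_def)
  have W: "W x = (a * norm x powr (- 1 - a) / t x) powr p" if "x \<in> U" for x
    using hardy_weight_eq[OF p] that unfolding W_def a_def t_def n_def U_def by auto
  have g0: "gradient \<psi> x = 0" if "x \<notin> K" for x
    by (rule gradient_eq_0_outside[where f=\<psi>, OF KU(2) K(4) that])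
  have cont: "continuous_on A \<psi>" "continuous_on A (gradient \<psi>)" for A
    using smooth_on_continuous[OF K(1)] continuous_on_gradient[OF K(1)] continuous_on_subset by blast+
  have contW: "continuous_on U W" using continuous_on_hardy_weight[OF p] unfolding W_def U_def .
  have c1: "continuous_on UNIV (\<lambda>x. W x * \<bar>\<psi> x\<bar> powr p)"
    by (rule continuous_on_UNIV_extend_zero[OF _ U KU(2,1)])
       (use p K(4) in \<open>auto intro!: continuous_intros contW cont continuous_on_powr'\<close>)
  have c2: "continuous_on UNIV (\<lambda>x. Y x powr p)"
    by (rule continuous_on_UNIV_extend_zero[OF _ U KU(2,1)])
       (use p g0 in \<open>auto simp: Y_def U_def intro!: continuous_intros cont continuous_on_powr'\<close>)
  have B: "ball (0::'a) R \<in> sets lebesgue" by simp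
  note I1 = integral_continuous_compact_support[OF c1 K(2) _ KR B]
  note I2 = integral_continuous_compact_support[OF c2 K(2) _ KR B]
  show "integrable (lebesgue_on (ball 0 R)) (\<lambda>x. hardy_weight p R x * \<bar>\<psi> x\<bar> powr p)"
    using I1(2) K(4) p by (simp add: W_def)
  show "integrable (lebesgue_on (ball 0 R)) (\<lambda>x. \<bar>(x /\<^sub>R norm x) \<bullet> gradient \<psi> x\<bar> powr p)"
    using I2(2) g0 p by (simp add: Y_def)

  \<comment> \<open>The field V is k(x) x. The gradient of k is k'(x) x, s is the derivative of
    |.|^p at \<psi>, and so g is the gradient of h; the field that gets integrated is h(x) x =
    |\<psi>|^p V.\<close>
  define k where "k x = a powr (p - 1) * (norm x powr (- n) * t x powr (1 - p))" for x
  define k' where "k' x = a powr (p - 1) * (norm x powr (- n) * ((p - 1) * a * norm x powr (- a - 2) * t x powr (- p))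
      - n * norm x powr (- n - 2) * t x powr (1 - p))" for x
  define s where "s x = p * (max (\<psi> x) 0 powr (p - 1) - max (- \<psi> x) 0 powr (p - 1))" for x
  define h where "h x = \<bar>\<psi> x\<bar> powr p * k x" for x
  define g where "g x = (\<bar>\<psi> x\<bar> powr p * k' x) *\<^sub>R x + (k x * s x) *\<^sub>R gradient \<psi> x" for x
  have k: "(k has_derivative (\<lambda>v. k' x *\<^sub>R x \<bullet> v)) (at x)" if "x \<in> U" for x
  proof -
    have x: "x \<noteq> 0" using that by (auto simp: U_def)
    have td: "(t has_derivative (\<lambda>v. (- a * norm x powr (- a - 2)) *\<^sub>R x \<bullet> v)) (at x)"
      unfolding t_def[abs_def] radial_time_def a_def[folded n_def, symmetric]
      by (rule has_derivative_eq_rhs, rule has_derivative_diff[OF has_derivative_norm_powr[OF x] has_derivative_const]) auto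
    have "((\<lambda>x. t x powr (1 - p)) has_derivative
        (\<lambda>v. (((1 - p) * t x powr (1 - p - 1)) *\<^sub>R ((- a * norm x powr (- a - 2)) *\<^sub>R x)) \<bullet> v)) (at x)"
      by (rule has_derivative_compose_inner[OF td has_real_derivative_powr[OF t[OF that]]])
    then show ?thesis unfolding k_def[abs_def]
      by (rule has_derivative_eq_rhs[OF has_derivative_mult_right[OF has_derivative_mult[OF has_derivative_norm_powr[OF x]]]])
         (auto simp: k'_def algebra_simps)
  qed
  have h: "(h has_derivative (\<lambda>v. g x \<bullet> v)) (at x)" for x
  proof (cases "x \<in> K")
    case True
    have "((\<lambda>x. \<bar>\<psi> x\<bar> powr p) has_derivative (\<lambda>v. (s x *\<^sub>R gradient \<psi> x) \<bullet> v)) (at x)"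
      unfolding s_def
      by (rule has_derivative_compose_inner[OF smooth_on_has_derivative[OF K(1)] has_real_derivative_abs_powr[OF p(1)]]) simp
    from has_derivative_mult[OF this k] show ?thesis
      using True KU unfolding h_def[abs_def]
      by (rule_tac has_derivative_eq_rhs) (auto simp: g_def inner_add_left algebra_simps)
  next
    case False
    have "((\<lambda>x. 0::real) has_derivative (\<lambda>v. g x \<bullet> v)) (at x)"
      using K(4)[OF False] p by (simp add: g_def s_def)
    then show ?thesis
      by (rule has_derivative_transform_within_open[where s="- K"])
         (use False K(4) KU p in \<open>auto simp: h_def\<close>)
  qed
  have contg: "continuous_on UNIV g"
  proof (rule continuous_on_UNIV_extend_zero[OF _ U KU(2,1)])
    have "continuous_on U t" unfolding t_def[abs_def] radial_time_def
      by (intro continuous_intros) (auto simp: U_def)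
    then have ck: "continuous_on U k" "continuous_on U k'" unfolding k_def[abs_def] k'_def[abs_def]
      using t by (auto intro!: continuous_intros simp: U_def) fastforce+
    have "continuous_on U s" unfolding s_def
      using p by (auto intro!: continuous_intros continuous_on_powr' cont)
    then show "continuous_on U g" unfolding g_def[abs_def]
      using p ck by (auto intro!: continuous_intros continuous_on_powr' cont)
    show "g x = 0" if "x \<notin> K" for x using K(4)[OF that] p by (simp add: g_def s_def)
  qed
  have "(\<integral>x. (g x \<bullet> x + DIM('a) * h x) \<partial>lborel) = 0"
    by (rule integral_divergence_radial[OF h contg K(2)]) (use K(4) p in \<open>simp add: h_def\<close>)
  \<comment> \<open>The integrand of this difference is bounded pointwise by \<kappa>^(p-1) times
    the divergence, whose integral has just been shown to be 0.\<close>
  moreover have "\<kappa> powr p * (\<integral>x. W x * \<bar>\<psi> x\<bar> powr p \<partial>lborel) - (\<integral>x. Y x powr p \<partial>lborel) =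
      (\<integral>x. \<kappa> powr p * (W x * \<bar>\<psi> x\<bar> powr p) - Y x powr p \<partial>lborel)"
    by (subst Bochner_Integration.integral_diff) (use I1(1) I2(1) K(4) g0 p in \<open>auto simp: Y_def\<close>)
  moreover have "\<dots> \<le> (\<integral>x. \<kappa> powr (p - 1) * (g x \<bullet> x + DIM('a) * h x) \<partial>lborel)"
  proof (rule integral_mono)
    show "integrable lborel (\<lambda>x. \<kappa> powr p * (W x * \<bar>\<psi> x\<bar> powr p) - Y x powr p)"
      using I1(1) I2(1) K(4) g0 p by (auto simp: Y_def)
    have "continuous_on UNIV h" by (metis h continuous_at_imp_continuous_on has_derivative_continuous)
    then have "continuous_on UNIV (\<lambda>x. g x \<bullet> x + DIM('a) * h x)" by (intro continuous_intros contg)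
    then show "integrable lborel (\<lambda>x. \<kappa> powr (p - 1) * (g x \<bullet> x + DIM('a) * h x))"
      using integral_continuous_compact_support(1)[OF _ K(2) _ KR B, of "\<lambda>x. g x \<bullet> x + DIM('a) * h x"] K(4) p
      by (auto simp: g_def h_def s_def)
    fix x :: 'a
    show "\<kappa> powr p * (W x * \<bar>\<psi> x\<bar> powr p) - Y x powr p \<le> \<kappa> powr (p - 1) * (g x \<bullet> x + DIM('a) * h x)"
    proof (cases "x \<in> K")
      case False
      then show ?thesis using K(4)[OF False] g0[OF False] p by (simp add: g_def h_def s_def Y_def)
    next
      case True
      then have xU: "x \<in> U" using KU by auto
      then have x: "x \<noteq> 0" "norm x > 0" by (auto simp: U_def)
      define r where "r = norm x"
      define T where "T = t x"
      have rT: "r > 0" "T > 0" using x t[OF xU] by (auto simp: r_def T_def)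
      \<comment> \<open>c is the p-th root of the weight; X = |\<psi>| c and the radial derivative Y
        are the quantities to which Young's inequality is applied.\<close>
      define c where "c = a * r powr (- 1 - a) / T"
      have c: "c > 0" using a rT by (simp add: c_def)
      have c_powr: "c powr q = a powr q * r powr ((- 1 - a) * q) / T powr q" for q
        using a rT by (simp add: c_def powr_mult powr_divide powr_powr)
      have Wc: "W x = c powr p" using W[OF xU] by (simp add: c_def r_def T_def)
      define X where "X = \<bar>\<psi> x\<bar> * c"
      have X0: "X \<ge> 0" using c by (simp add: X_def)
      have X_powr: "X powr q = \<bar>\<psi> x\<bar> powr q * c powr q" for q
        using c unfolding X_def by (simp only: powr_mult)
      have Xp: "X powr p = W x * \<bar>\<psi> x\<bar> powr p" using X_powr[of p] Wc by simp
      \<comment> \<open>The terms with the factor n cancel because |x|^(-n) x is divergence free off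
        the origin; what remains comes from differentiating the power of t.\<close>
      have div: "k' x * (x \<bullet> x) + n * k x = (p - 1) * W x"
      proof -
        define A where "A = a powr (p - 1)"
        have "a powr (1 + (p - 1)) = a powr 1 * a powr (p - 1)" by (rule powr_add)
        then have A: "a powr p = A * a" using a by (simp add: A_def)
        have e: "r powr (- a - 2) = r powr (- a) / (r * r)" "r powr (- n - 2) = r powr (- n) / (r * r)"
          using rT by (simp_all add: powr_diff powr_numeral power2_eq_square)
        have "k' x * (r * r) + n * k x = (p - 1) * (A * a * (r powr (- n) * r powr (- a)) * T powr (- p))"
          unfolding k'_def k_def r_def[symmetric] T_def[symmetric] e A_def[symmetric] using rT(1) by (simp add: field_simps)
        also have "A * a * (r powr (- n) * r powr (- a)) * T powr (- p) = W x"
        proof -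
          have "r powr (- n) * r powr (- a) = r powr (- n + - a)" by (rule powr_add[symmetric])
          also have "- n + - a = (- 1 - a) * p" using pow(2) by (simp add: algebra_simps)
          finally show ?thesis unfolding Wc c_powr A powr_minus_divide by simp
        qed
        finally show ?thesis by (simp add: dot_square_norm r_def power2_eq_square)
      qed
      have abs_s: "\<bar>s x\<bar> = p * \<bar>\<psi> x\<bar> powr (p - 1)"
        using p by (cases "\<psi> x \<ge> 0") (auto simp: s_def abs_mult max_def)
      have kr: "k x * r = c powr (p - 1)"
      proof -
        have "r powr (- n) * r = r powr (- n) * r powr 1" using rT by simp
        also have "\<dots> = r powr (- n + 1)" by (rule powr_add[symmetric])
        also have "- n + 1 = (- 1 - a) * (p - 1)" using pow(1) by (simp add: algebra_simps)
        finally have 1: "r powr (- n) * r = r powr ((- 1 - a) * (p - 1))" .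
        have 2: "T powr (1 - p) = 1 / T powr (p - 1)" using powr_minus_divide[of T "p - 1"] by simp
        have "k x * r = a powr (p - 1) * (r powr (- n) * r) * T powr (1 - p)"
          unfolding k_def r_def[symmetric] T_def[symmetric] by (simp only: mult_ac)
        then show ?thesis unfolding 1 2 c_powr by simp
      qed
      have "\<bar>k x * s x * (gradient \<psi> x \<bullet> x)\<bar> = p * X powr (p - 1) * Y x"
      proof -
        have "gradient \<psi> x \<bullet> x = r * ((x /\<^sub>R norm x) \<bullet> gradient \<psi> x)" using rT by (simp add: r_def inner_commute)
        then have "\<bar>gradient \<psi> x \<bullet> x\<bar> = r * Y x" using rT by (simp add: Y_def abs_mult)
        moreover have "k x \<ge> 0" by (simp add: k_def)
        ultimately have "\<bar>k x * s x * (gradient \<psi> x \<bullet> x)\<bar> = (k x * r) * (p * \<bar>\<psi> x\<bar> powr (p - 1)) * Y x"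
          by (simp add: abs_mult abs_s)
        also have "\<dots> = p * X powr (p - 1) * Y x"
          unfolding kr X_powr by (simp only: mult_ac)
        finally show ?thesis .
      qed
      then have "- (p * X powr (p - 1) * Y x) \<le> k x * s x * (gradient \<psi> x \<bullet> x)" by linarith
      moreover have "g x \<bullet> x + n * h x = \<bar>\<psi> x\<bar> powr p * (k' x * (x \<bullet> x) + n * k x) + k x * s x * (gradient \<psi> x \<bullet> x)"
        by (simp add: g_def h_def inner_add_left algebra_simps)
      ultimately have "(p - 1) * X powr p - p * X powr (p - 1) * Y x \<le> g x \<bullet> x + n * h x"
        unfolding div Xp by (simp add: mult_ac)
      then have "\<kappa> powr (p - 1) * ((p - 1) * X powr p - p * X powr (p - 1) * Y x) \<le> \<kappa> powr (p - 1) * (g x \<bullet> x + n * h x)"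
        by (intro mult_left_mono) auto
      moreover have "\<kappa> powr p * X powr p - Y x powr p \<le> \<kappa> powr (p - 1) * ((p - 1) * X powr p - p * X powr (p - 1) * Y x)"
        using hardy_young[OF p(1) X0, of "Y x"] by (simp add: \<kappa>_def[symmetric] Y_def right_diff_distrib)
      ultimately show ?thesis unfolding Xp n_def by linarith
    qed
  qed
  ultimately have "\<kappa> powr p * (\<integral>x. W x * \<bar>\<psi> x\<bar> powr p \<partial>lborel) \<le> (\<integral>x. Y x powr p \<partial>lborel)" by simp
  then show "((p - 1) / p) powr p * (LINT x|lebesgue_on (ball 0 R). hardy_weight p R x * \<bar>\<psi> x\<bar> powr p)
      \<le> (LINT x|lebesgue_on (ball 0 R). \<bar>(x /\<^sub>R norm x) \<bullet> gradient \<psi> x\<bar> powr p)"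
    using I1(3) I2(3) K(4) g0 p by (simp add: W_def Y_def \<kappa>_def)
qed

section \<open>The inequality on the Sobolev space\<close>

lemma hardy_weight_nonneg: "0 \<le> hardy_weight p R x"
  by (simp add: hardy_weight_def)

lemma hardy_weight_measurable [measurable]: "hardy_weight p R \<in> borel_measurable borel"
  unfolding hardy_weight_def[abs_def] qlog_def by measurable

lemma abs_inner_unit_le: "\<bar>(x /\<^sub>R norm x) \<bullet> y\<bar> \<le> norm y" for x y :: "'a::real_inner"
proof -
  have "\<bar>(x /\<^sub>R norm x) \<bullet> y\<bar> \<le> norm (x /\<^sub>R norm x) * norm y" by (rule Cauchy_Schwarz_ineq2)
  also have "norm (x /\<^sub>R norm x) \<le> 1" by (cases "x = 0") auto
  then have "norm (x /\<^sub>R norm x) * norm y \<le> 1 * norm y" by (rule mult_right_mono) simp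
  finally show ?thesis by simp
qed

lemma norm_radial_projection:
  fixes x y :: "'a::real_inner"
  shows "norm (((x /\<^sub>R norm x) \<bullet> y) *\<^sub>R (x /\<^sub>R norm x)) = \<bar>(x /\<^sub>R norm x) \<bullet> y\<bar>"
proof (cases "x = 0")
  case False
  then have "norm (x /\<^sub>R norm x) = 1" by simp
  then show ?thesis by (simp only: norm_scaleR mult_1_right)
qed simp

lemma in_Lp_radial:
  assumes "in_Lp \<Omega> p G" "0 \<le> p"
  shows "integrable (lebesgue_on \<Omega>) (\<lambda>x. \<bar>(x /\<^sub>R norm x) \<bullet> G x\<bar> powr p)"
proof (rule Bochner_Integration.integrable_bound)
  show "integrable (lebesgue_on \<Omega>) (\<lambda>x. norm (G x) powr p)" using assms by (simp add: in_Lp_def)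
  have [measurable]: "G \<in> borel_measurable (lebesgue_on \<Omega>)" using assms by (simp add: in_Lp_def)
  have "(\<lambda>x::'a. x /\<^sub>R norm x) \<in> borel_measurable lborel" by measurable
  then have [measurable]: "(\<lambda>x::'a. x /\<^sub>R norm x) \<in> borel_measurable (lebesgue_on \<Omega>)"
    by (intro measurable_restrict_space1 measurable_completion)
  show "(\<lambda>x. \<bar>(x /\<^sub>R norm x) \<bullet> G x\<bar> powr p) \<in> borel_measurable (lebesgue_on \<Omega>)" by measurable
  show "AE x in lebesgue_on \<Omega>. norm (\<bar>(x /\<^sub>R norm x) \<bullet> G x\<bar> powr p) \<le> norm (norm (G x) powr p)"
    using assms(2) by (intro AE_I2) (simp add: powr_mono2 abs_inner_unit_le del: inner_scaleR_left)
qed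

text \<open>The factor tends to 1 as \<theta> tends to 0; this recovers what
  \<open>powr_add_le_convex\<close> gives away.\<close>

lemma le_of_le_mult_powr:
  fixes A B q :: real
  assumes "\<And>\<theta>. 0 < \<theta> \<Longrightarrow> \<theta> < 1 \<Longrightarrow> A \<le> (1 - \<theta>) powr q * B"
  shows "A \<le> B"
proof -
  have "((\<lambda>\<theta>. (1 - \<theta>) powr q * B) \<longlongrightarrow> (1 - 0) powr q * B) (at_right 0)"
    by (intro tendsto_intros) auto
  moreover have "\<forall>\<^sub>F \<theta> in at_right 0. A \<le> (1 - \<theta>) powr q * B"
    by (rule eventually_at_rightI[of 0 1]) (use assms in auto)
  ultimately show ?thesis
    by (intro tendsto_lowerbound[where F="at_right 0"]) auto
qed

text \<open>A bounded weight makes the left-hand side finite and controlled by the L^p norm, so that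
  approximation by test functions works without knowing in advance that the full left-hand side is
  finite.\<close>

lemma hardy_truncated:
  fixes u :: "'a::euclidean_space \<Rightarrow> real" and p R :: real
  assumes p: "1 < p" "p < DIM('a)" and Lp: "in_Lp (ball 0 R) p u" "in_Lp (ball 0 R) p G"
    and appr: "\<And>e. e > 0 \<Longrightarrow> \<exists>\<psi>\<in>test_functions (ball 0 R - {0}).
      (LINT x|lebesgue_on (ball 0 R). \<bar>u x - \<psi> x\<bar> powr p + norm (G x - gradient \<psi> x) powr p) < e"
    and m: "0 < m"
  shows "((p - 1) / p) powr p * (LINT x|lebesgue_on (ball 0 R). min m (hardy_weight p R x) * \<bar>u x\<bar> powr p)
    \<le> (LINT x|lebesgue_on (ball 0 R). \<bar>(x /\<^sub>R norm x) \<bullet> G x\<bar> powr p)"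
proof -
  define M where "M = lebesgue_on (ball (0::'a) R)"
  define c where "c = ((p - 1) / p) powr p"
  define W where "W x = min m (hardy_weight p R x)" for x :: 'a
  have W: "0 \<le> W x" "W x \<le> m" "W x \<le> hardy_weight p R x" for x
    using m hardy_weight_nonneg by (auto simp: W_def)
  have "W \<in> borel_measurable lborel" unfolding W_def[abs_def] by measurable
  then have [measurable]: "W \<in> borel_measurable M" unfolding M_def
    by (intro measurable_restrict_space1 measurable_completion)
  define A where "A = (LINT x|M. W x * \<bar>u x\<bar> powr p)"
  define B where "B = (LINT x|M. \<bar>(x /\<^sub>R norm x) \<bullet> G x\<bar> powr p)"
  have intW: "integrable M (\<lambda>x. W x * \<bar>v x\<bar> powr p)" if "in_Lp (ball 0 R) p v" for v :: "'a \<Rightarrow> real"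
  proof (rule Bochner_Integration.integrable_bound)
    show "integrable M (\<lambda>x. m * \<bar>v x\<bar> powr p)" using that by (simp add: in_Lp_def M_def)
    have [measurable]: "v \<in> borel_measurable M" using that by (simp add: in_Lp_def M_def)
    show "(\<lambda>x. W x * \<bar>v x\<bar> powr p) \<in> borel_measurable M" by measurable
    show "AE x in M. norm (W x * \<bar>v x\<bar> powr p) \<le> norm (m * \<bar>v x\<bar> powr p)"
      using W m by (intro AE_I2) (simp add: abs_mult mult_right_mono)
  qed
  have intB: "integrable M (\<lambda>x. \<bar>(x /\<^sub>R norm x) \<bullet> H x\<bar> powr p)" if "in_Lp (ball 0 R) p H" for H :: "'a \<Rightarrow> 'a"
    using in_Lp_radial[OF that] p by (simp add: M_def)
  \<comment> \<open>Convexity is used twice, to pass from u to the test function on the left and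
    from the gradient of the test function to G on the right; hence the square of (1 -
    \<theta>)^(1-p).\<close>
  have "c * A \<le> (1 - \<theta>) powr (2 * (1 - p)) * B" if \<theta>: "0 < \<theta>" "\<theta> < 1" for \<theta>
  proof (rule field_le_epsilon)
    define a b where "a = (1 - \<theta>) powr (1 - p)" and "b = \<theta> powr (1 - p)"
    have ab: "a > 0" "b > 0" "(1 - \<theta>) powr (2 * (1 - p)) = a * a" using \<theta>
      by (auto simp: a_def b_def powr_add[symmetric])
    fix \<epsilon> :: real assume \<epsilon>: "0 < \<epsilon>"
    \<comment> \<open>Q dominates the coefficients c b m and a b with which the two approximation
      errors enter; the summand 1 makes it positive.\<close>
    define Q where "Q = c * b * m + a * b + 1"
    have c0: "c \<ge> 0" by (simp add: c_def)
    have Q: "Q > 0" using ab m c0 by (simp add: Q_def add_nonneg_pos)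
    obtain \<psi> where \<psi>: "\<psi> \<in> test_functions (ball 0 R - {0})"
      and less: "(LINT x|M. \<bar>u x - \<psi> x\<bar> powr p + norm (G x - gradient \<psi> x) powr p) < \<epsilon> / Q"
      using appr[of "\<epsilon> / Q"] \<epsilon> Q unfolding M_def by auto
    have \<psi>': "\<psi> \<in> test_functions (ball 0 R)" using \<psi> test_functions_mono[of "ball 0 R - {0}" "ball 0 R"] by auto
    have L\<psi>: "in_Lp (ball 0 R) p \<psi>" "in_Lp (ball 0 R) p (gradient \<psi>)"
      using test_function_in_Lp[OF \<psi>'] p by auto
    have Ld: "in_Lp (ball 0 R) p (\<lambda>x. u x - \<psi> x)" "in_Lp (ball 0 R) p (\<lambda>x. gradient \<psi> x - G x)" "in_Lp (ball 0 R) p (\<lambda>x. G x - gradient \<psi> x)"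
      using in_Lp_diff[OF _ Lp(1) L\<psi>(1)] in_Lp_diff[OF _ L\<psi>(2) Lp(2)] in_Lp_diff[OF _ Lp(2) L\<psi>(2)] p by auto
    define D1 where "D1 = (LINT x|M. \<bar>u x - \<psi> x\<bar> powr p)"
    define D2 where "D2 = (LINT x|M. norm (G x - gradient \<psi> x) powr p)"
    have intD: "integrable M (\<lambda>x. \<bar>u x - \<psi> x\<bar> powr p)" "integrable M (\<lambda>x. norm (G x - gradient \<psi> x) powr p)"
      using Ld by (auto simp: in_Lp_def M_def)
    have D: "D1 + D2 < \<epsilon> / Q" "0 \<le> D1" "0 \<le> D2"
      using less intD by (auto simp: D1_def D2_def)
    have "A \<le> (LINT x|M. a * (W x * \<bar>\<psi> x\<bar> powr p) + b * (W x * \<bar>u x - \<psi> x\<bar> powr p))"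
      unfolding A_def
    proof (rule integral_mono)
      fix x
      have "\<bar>u x\<bar> powr p \<le> a * \<bar>\<psi> x\<bar> powr p + b * \<bar>u x - \<psi> x\<bar> powr p"
        using norm_powr_add_le_convex[of p \<theta> "u x" "\<psi> x"] \<theta> p by (simp add: a_def b_def)
      then have "W x * \<bar>u x\<bar> powr p \<le> W x * (a * \<bar>\<psi> x\<bar> powr p + b * \<bar>u x - \<psi> x\<bar> powr p)"
        using W(1) by (rule mult_left_mono)
      then show "W x * \<bar>u x\<bar> powr p \<le> a * (W x * \<bar>\<psi> x\<bar> powr p) + b * (W x * \<bar>u x - \<psi> x\<bar> powr p)"
        by (simp add: algebra_simps)
    qed (use intW Lp L\<psi> Ld in auto)
    also have "\<dots> = a * (LINT x|M. W x * \<bar>\<psi> x\<bar> powr p) + b * (LINT x|M. W x * \<bar>u x - \<psi> x\<bar> powr p)"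
      by (subst Bochner_Integration.integral_add) (use intW L\<psi> Ld in auto)
    also have "(LINT x|M. W x * \<bar>u x - \<psi> x\<bar> powr p) \<le> (LINT x|M. m * \<bar>u x - \<psi> x\<bar> powr p)"
      by (rule integral_mono) (use intW[OF Ld(1)] intD W in \<open>auto intro: mult_right_mono\<close>)
    also have "\<dots> = m * D1" by (simp add: D1_def)
    also have "(LINT x|M. W x * \<bar>\<psi> x\<bar> powr p) \<le> (LINT x|M. hardy_weight p R x * \<bar>\<psi> x\<bar> powr p)"
      by (rule integral_mono)
         (use intW[OF L\<psi>(1)] W hardy_test_function(1)[OF p \<psi>] in \<open>auto simp: M_def intro: mult_right_mono\<close>)
    finally have 1: "A \<le> a * (LINT x|M. hardy_weight p R x * \<bar>\<psi> x\<bar> powr p) + b * (m * D1)"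
      using ab by simp
    have 2: "c * (LINT x|M. hardy_weight p R x * \<bar>\<psi> x\<bar> powr p) \<le> (LINT x|M. \<bar>(x /\<^sub>R norm x) \<bullet> gradient \<psi> x\<bar> powr p)"
      using hardy_test_function(3)[OF p \<psi>] by (simp add: c_def M_def)
    have "(LINT x|M. \<bar>(x /\<^sub>R norm x) \<bullet> gradient \<psi> x\<bar> powr p) \<le>
      (LINT x|M. a * \<bar>(x /\<^sub>R norm x) \<bullet> G x\<bar> powr p + b * norm (G x - gradient \<psi> x) powr p)"
    proof (rule integral_mono)
      fix x
      have "\<bar>(x /\<^sub>R norm x) \<bullet> gradient \<psi> x\<bar> powr p \<le> a * \<bar>(x /\<^sub>R norm x) \<bullet> G x\<bar> powr p +
          b * \<bar>(x /\<^sub>R norm x) \<bullet> (gradient \<psi> x - G x)\<bar> powr p"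
        using norm_powr_add_le_convex[of p \<theta> "(x /\<^sub>R norm x) \<bullet> gradient \<psi> x" "(x /\<^sub>R norm x) \<bullet> G x"] \<theta> p
        unfolding a_def b_def inner_diff_right real_norm_def by auto
      also have "\<bar>(x /\<^sub>R norm x) \<bullet> (gradient \<psi> x - G x)\<bar> powr p \<le> norm (G x - gradient \<psi> x) powr p"
        using abs_inner_unit_le[of x "gradient \<psi> x - G x"] p by (intro powr_mono2) (auto simp: norm_minus_commute)
      finally show "\<bar>(x /\<^sub>R norm x) \<bullet> gradient \<psi> x\<bar> powr p \<le> a * \<bar>(x /\<^sub>R norm x) \<bullet> G x\<bar> powr p + b * norm (G x - gradient \<psi> x) powr p"
        using ab by simp
    qed (use intB L\<psi> Lp intD in auto)
    also have "\<dots> = a * B + b * D2"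
      unfolding B_def D2_def by (subst Bochner_Integration.integral_add) (use intB[OF Lp(2)] intD in auto)
    finally have 3: "(LINT x|M. \<bar>(x /\<^sub>R norm x) \<bullet> gradient \<psi> x\<bar> powr p) \<le> a * B + b * D2" .
    have "c * A \<le> c * (a * (LINT x|M. hardy_weight p R x * \<bar>\<psi> x\<bar> powr p) + b * (m * D1))"
      using 1 c0 by (rule mult_left_mono)
    also have "\<dots> = a * (c * (LINT x|M. hardy_weight p R x * \<bar>\<psi> x\<bar> powr p)) + c * b * m * D1"
      by (simp add: algebra_simps)
    also have "\<dots> \<le> a * (a * B + b * D2) + c * b * m * D1"
      using 2 3 ab by (intro add_right_mono mult_left_mono) auto
    also have "\<dots> \<le> a * a * B + Q * (D1 + D2)"
    proof -
      have "a * b * D2 \<le> Q * D2" "c * b * m * D1 \<le> Q * D1"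
        using D ab c0 m by (auto simp: Q_def intro!: mult_right_mono)
      then show ?thesis by (simp add: algebra_simps)
    qed
    also have "\<dots> \<le> a * a * B + \<epsilon>" using D(1) Q by (simp add: pos_less_divide_eq mult.commute)
    finally show "c * A \<le> (1 - \<theta>) powr (2 * (1 - p)) * B + \<epsilon>" unfolding ab(3) by simp
  qed
  then have "c * A \<le> B" by (rule le_of_le_mult_powr)
  then show ?thesis by (simp add: c_def A_def B_def M_def W_def)
qed

lemma hardy_rhs_eq:
  fixes u :: "real ^ 'n \<Rightarrow> real"
  assumes "has_weak_gradient (ball 0 R) u G"
  shows "hardy_rhs p R u = (\<integral>\<^sup>+x. ennreal (\<bar>(x /\<^sub>R norm x) \<bullet> G x\<bar> powr p) \<partial>lebesgue_on (ball 0 R))"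
  unfolding hardy_rhs_def
proof (rule nn_integral_cong_AE)
  have "AE x in lebesgue_on (ball 0 R). weak_gradient (ball 0 R) u x = G x"
    by (rule weak_gradient_eq(1)[OF open_ball assms])
  then show "AE x in lebesgue_on (ball 0 R). ennreal (norm (radial_gradient (ball 0 R) u x) powr p) =
    ennreal (\<bar>(x /\<^sub>R norm x) \<bullet> G x\<bar> powr p)"
    by eventually_elim (simp only: radial_gradient_def norm_radial_projection)
qed

lemma hardy_lhs_eq:
  fixes u :: "real ^ 'n \<Rightarrow> real"
  shows "hardy_lhs p R u = (\<integral>\<^sup>+x. ennreal (hardy_weight p R x * \<bar>u x\<bar> powr p) \<partial>lebesgue_on (ball 0 R))"
  by (simp add: hardy_lhs_def hardy_weight_def)

theorem hardy_inequality:
  fixes u :: "real ^ 'n \<Rightarrow> real"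
  assumes p: "1 < p" "p < real CARD('n)" and u: "u \<in> sobolev_W1_0 (ball 0 R) p"
  shows "ennreal (((p - 1) / p) powr p) * hardy_lhs p R u \<le> hardy_rhs p R u"
proof -
  define M where "M = lebesgue_on (ball (0::real^'n) R)"
  define c where "c = ((p - 1) / p) powr p"
  have p': "p < DIM(real^'n)" using p by simp
  obtain G where G: "has_weak_gradient (ball 0 R) u G" "in_Lp (ball 0 R) p u" "in_Lp (ball 0 R) p G"
    and appr: "\<And>e. e > 0 \<Longrightarrow> \<exists>\<psi>\<in>test_functions (ball 0 R - {0}).
      (LINT x|lebesgue_on (ball 0 R). \<bar>u x - \<psi> x\<bar> powr p + norm (G x - gradient \<psi> x) powr p) < e"
    using sobolev_W1_0_punctured_approx[OF open_ball _ p' u] p by auto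
  define B where "B = (LINT x|M. \<bar>(x /\<^sub>R norm x) \<bullet> G x\<bar> powr p)"
  have intB: "integrable M (\<lambda>x. \<bar>(x /\<^sub>R norm x) \<bullet> G x\<bar> powr p)"
    using in_Lp_radial[OF G(3)] p by (simp add: M_def)
  have rhs: "hardy_rhs p R u = ennreal B"
    unfolding hardy_rhs_eq[OF G(1)] B_def M_def[symmetric] using intB by (intro nn_integral_eq_integral) auto
  have "hardy_weight p R \<in> borel_measurable (lborel :: (real^'n) measure)" by measurable
  then have [measurable]: "hardy_weight p R \<in> borel_measurable M" unfolding M_def
    by (intro measurable_restrict_space1 measurable_completion)
  have [measurable]: "u \<in> borel_measurable M" using G(2) by (simp add: in_Lp_def M_def)
  \<comment> \<open>The weights truncated at Suc k increase to the full weight, and the truncation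
    level is positive from the start; monotone convergence then works with values in
    [0, \<infinity>].\<close>
  define f where "f k x = ennreal (min (real (Suc k)) (hardy_weight p R x) * \<bar>u x\<bar> powr p)" for k x
  have fm[measurable]: "f k \<in> borel_measurable M" for k unfolding f_def[abs_def] by measurable
  have "incseq f"
    by (intro incseq_SucI le_funI) (auto simp: f_def intro!: ennreal_leI mult_right_mono)
  have SUP: "(SUP k. f k x) = ennreal (hardy_weight p R x * \<bar>u x\<bar> powr p)" for x
  proof (rule antisym)
    show "(SUP k. f k x) \<le> ennreal (hardy_weight p R x * \<bar>u x\<bar> powr p)"
      by (rule SUP_least) (auto simp: f_def intro!: ennreal_leI mult_right_mono)
    obtain k :: nat where "hardy_weight p R x < real k" using reals_Archimedean2 by blast
    then have "f k x = ennreal (hardy_weight p R x * \<bar>u x\<bar> powr p)" by (simp add: f_def)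
    then show "ennreal (hardy_weight p R x * \<bar>u x\<bar> powr p) \<le> (SUP k. f k x)" by (metis SUP_upper UNIV_I)
  qed
  have "hardy_lhs p R u = (SUP k. \<integral>\<^sup>+x. f k x \<partial>M)"
    unfolding hardy_lhs_eq M_def[symmetric] SUP[symmetric]
    by (rule nn_integral_monotone_convergence_SUP[OF \<open>incseq f\<close> fm])
  then have "ennreal c * hardy_lhs p R u = (SUP k. ennreal c * (\<integral>\<^sup>+x. f k x \<partial>M))"
    by (simp add: SUP_mult_left_ennreal)
  also have "\<dots> \<le> ennreal B"
  proof (rule SUP_least)
    fix k
    have w: "0 \<le> min (real (Suc k)) (hardy_weight p R x)" for x :: "real^'n"
      using hardy_weight_nonneg[of p R x] by simp
    have "integrable M (\<lambda>x. min (real (Suc k)) (hardy_weight p R x) * \<bar>u x\<bar> powr p)"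
    proof (rule Bochner_Integration.integrable_bound)
      show "integrable M (\<lambda>x. real (Suc k) * \<bar>u x\<bar> powr p)" using G(2) by (simp add: in_Lp_def M_def)
      show "AE x in M. norm (min (real (Suc k)) (hardy_weight p R x) * \<bar>u x\<bar> powr p) \<le> norm (real (Suc k) * \<bar>u x\<bar> powr p)"
        using w by (intro AE_I2) (simp add: abs_mult mult_right_mono)
    qed measurable
    then have "(\<integral>\<^sup>+x. f k x \<partial>M) = ennreal (LINT x|M. min (real (Suc k)) (hardy_weight p R x) * \<bar>u x\<bar> powr p)"
      unfolding f_def using w by (intro nn_integral_eq_integral AE_I2 mult_nonneg_nonneg) auto
    then have "ennreal c * (\<integral>\<^sup>+x. f k x \<partial>M) = ennreal (c * (LINT x|M. min (real (Suc k)) (hardy_weight p R x) * \<bar>u x\<bar> powr p))"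
      by (simp add: c_def ennreal_mult')
    also have "\<dots> \<le> ennreal B"
      using hardy_truncated[OF p(1) p' G(2,3) appr, of "real (Suc k)"] by (intro ennreal_leI) (simp add: c_def B_def M_def)
    finally show "ennreal c * (\<integral>\<^sup>+x. f k x \<partial>M) \<le> ennreal B" .
  qed
  finally show ?thesis by (simp add: rhs c_def)
qed

section \<open>Polar coordinates and the radial scaling\<close>

lemma nn_integral_lborel_scaleR:
  fixes g :: "'a::euclidean_space \<Rightarrow> ennreal"
  assumes [measurable]: "g \<in> borel_measurable borel" and r: "r \<noteq> 0"
  shows "(\<integral>\<^sup>+x. g x \<partial>lborel) = ennreal (\<bar>r\<bar> ^ DIM('a)) * (\<integral>\<^sup>+x. g (r *\<^sub>R x) \<partial>lborel)"
  by (subst lborel_affine[OF r, of 0]) (simp add: nn_integral_density nn_integral_distr nn_integral_cmult)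

text \<open>Polar coordinates in which the average over the sphere is replaced by one over a spherical shell.
  This only needs Tonelli's theorem and the scaling behaviour of Lebesgue measure.\<close>

lemma nn_integral_polar:
  fixes f :: "'a::euclidean_space \<Rightarrow> ennreal"
  assumes [measurable]: "f \<in> borel_measurable borel"
  shows "(\<integral>\<^sup>+x. f x \<partial>lborel) = (\<integral>\<^sup>+y. indicator (cball 0 (exp 1) - ball 0 1) y * ennreal (norm y powr (- DIM('a))) *
    (\<integral>\<^sup>+s. indicator {0<..} s * f (s *\<^sub>R (y /\<^sub>R norm y)) * ennreal (s ^ (DIM('a) - 1)) \<partial>lborel) \<partial>lborel)"
proof -
  define A where "A = cball (0::'a) (exp 1) - ball 0 1"
  have [measurable]: "A \<in> sets borel" by (simp add: A_def)
  define n where "n = DIM('a)"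
  have n: "n \<ge> 1" by (simp add: n_def DIM_positive Suc_leI)
  \<comment> \<open>For x nonzero, x / r lies in the shell exactly for r between |x| / e and |x|,
    and dr / r has mass 1 there. This is why the outer radius is exp 1, and it allows k to be
    inserted under the integral.\<close>
  define k where "k x r = indicator {0<..} r * indicator A ((1 / r) *\<^sub>R x) * ennreal (1 / r)" for x :: 'a and r :: real
  have [measurable]: "(\<lambda>(x, r). k x r) \<in> borel_measurable (lborel \<Otimes>\<^sub>M lborel)"
    unfolding k_def[abs_def] by measurable
  have k1: "(\<integral>\<^sup>+r. k x r \<partial>lborel) = 1" if x: "x \<noteq> 0" for x
  proof -
    have nx: "0 < norm x" using x by simp
    have "k x r = ennreal (1 / r) * indicator {norm x / exp 1 .. norm x} r" for r
    proof (cases "r > 0")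
      case True
      then have "(1 / r) *\<^sub>R x \<in> A \<longleftrightarrow> r \<in> {norm x / exp 1 .. norm x}"
        by (auto simp: A_def field_simps)
      then show ?thesis using True by (simp add: k_def indicator_def)
    next
      case False
      have "0 < norm x / exp 1" using nx by simp
      then have "r \<notin> {norm x / exp 1 .. norm x}" using False by simp
      then show ?thesis using False by (simp add: k_def)
    qed
    then have "(\<integral>\<^sup>+r. k x r \<partial>lborel) = (\<integral>\<^sup>+r. ennreal (1 / r) * indicator {norm x / exp 1 .. norm x} r \<partial>lborel)" by simp
    also have "\<dots> = ennreal (ln (norm x) - ln (norm x / exp 1))"
    proof (rule nn_integral_FTC_Icc)
      fix r assume "r \<in> {norm x / exp 1 .. norm x}"
      moreover have "0 < norm x / exp 1" using nx by simp
      ultimately have r: "0 < r" by (meson atLeastAtMost_iff less_le_trans)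
      show "(ln has_real_derivative 1 / r) (at r)" by (rule DERIV_ln_divide[OF r])
      show "0 \<le> 1 / r" using r by simp
    next
      show "norm x / exp 1 \<le> norm x" using nx by (simp add: field_simps)
    qed measurable
    also have "ln (norm x) - ln (norm x / exp 1) = 1" using nx by (simp add: ln_div)
    finally show ?thesis by simp
  qed
  have "(\<integral>\<^sup>+x. f x \<partial>lborel) = (\<integral>\<^sup>+x. (\<integral>\<^sup>+r. f x * k x r \<partial>lborel) \<partial>lborel)"
  proof (rule nn_integral_cong_AE)
    show "AE x in lborel. f x = (\<integral>\<^sup>+r. f x * k x r \<partial>lborel)"
      using AE_lborel_singleton[of 0]
    proof eventually_elim
      case (elim x)
      have "(\<integral>\<^sup>+r. f x * k x r \<partial>lborel) = f x * (\<integral>\<^sup>+r. k x r \<partial>lborel)"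
        by (rule nn_integral_cmult) measurable
      then show ?case using k1[OF elim] by simp
    qed
  qed
  also have "\<dots> = (\<integral>\<^sup>+r. (\<integral>\<^sup>+x. f x * k x r \<partial>lborel) \<partial>lborel)"
    by (rule lborel_pair.Fubini'[symmetric]) measurable
  \<comment> \<open>Substitution x = r y for fixed r: the measure contributes r^n and the kernel 1 /
    r.\<close>
  also have "\<dots> = (\<integral>\<^sup>+r. (\<integral>\<^sup>+y. indicator {0<..} r * f (r *\<^sub>R y) * indicator A y * ennreal (r ^ (n - 1)) \<partial>lborel) \<partial>lborel)"
  proof (rule nn_integral_cong)
    fix r :: real
    show "(\<integral>\<^sup>+x. f x * k x r \<partial>lborel) = (\<integral>\<^sup>+y. indicator {0<..} r * f (r *\<^sub>R y) * indicator A y * ennreal (r ^ (n - 1)) \<partial>lborel)"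
    proof (cases "r > 0")
      case True
      have "r ^ n * (1 / r) = r ^ (n - 1)" using True n by (simp add: power_diff)
      then have e: "ennreal (r ^ n) * ennreal (1 / r) = ennreal (r ^ (n - 1))"
        using True by (simp add: ennreal_mult'[symmetric])
      have "(\<integral>\<^sup>+x. f x * k x r \<partial>lborel) = ennreal (r ^ n) * (\<integral>\<^sup>+y. f (r *\<^sub>R y) * k (r *\<^sub>R y) r \<partial>lborel)"
        using True by (subst nn_integral_lborel_scaleR[of _ r]) (auto simp: n_def)
      also have "\<dots> = (\<integral>\<^sup>+y. ennreal (r ^ n) * (f (r *\<^sub>R y) * k (r *\<^sub>R y) r) \<partial>lborel)"
        by (rule nn_integral_cmult[symmetric]) measurable
      also have "\<dots> = (\<integral>\<^sup>+y. indicator {0<..} r * f (r *\<^sub>R y) * indicator A y * ennreal (r ^ (n - 1)) \<partial>lborel)"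
        using True unfolding e[symmetric] k_def by (simp add: mult_ac)
      finally show ?thesis .
    qed (simp add: k_def)
  qed
  also have "\<dots> = (\<integral>\<^sup>+y. (\<integral>\<^sup>+r. indicator {0<..} r * f (r *\<^sub>R y) * indicator A y * ennreal (r ^ (n - 1)) \<partial>lborel) \<partial>lborel)"
    by (rule lborel_pair.Fubini') measurable
  \<comment> \<open>Substitution s = |y| r for fixed y: together the Jacobian and the density give
    the factor |y|^(-n).\<close>
  also have "\<dots> = (\<integral>\<^sup>+y. indicator A y * ennreal (norm y powr (- n)) *
      (\<integral>\<^sup>+s. indicator {0<..} s * f (s *\<^sub>R (y /\<^sub>R norm y)) * ennreal (s ^ (n - 1)) \<partial>lborel) \<partial>lborel)"
  proof (rule nn_integral_cong)
    fix y :: 'a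
    show "(\<integral>\<^sup>+r. indicator {0<..} r * f (r *\<^sub>R y) * indicator A y * ennreal (r ^ (n - 1)) \<partial>lborel) =
      indicator A y * ennreal (norm y powr (- n)) *
      (\<integral>\<^sup>+s. indicator {0<..} s * f (s *\<^sub>R (y /\<^sub>R norm y)) * ennreal (s ^ (n - 1)) \<partial>lborel)"
    proof (cases "y \<in> A")
      case True
      then have y: "0 < norm y" by (auto simp: A_def)
      define m where "m = norm y"
      have m: "m > 0" using y by (simp add: m_def)
      have e: "m powr (- n) * m ^ (n - 1) * m = 1"
      proof -
        have "m ^ (n - 1) * m = m ^ n" using n by (simp add: power_eq_if)
        then show ?thesis using m by (simp add: powr_minus powr_realpow mult.assoc)
      qed
      let ?h = "\<lambda>s. indicator {0<..} s * f (s *\<^sub>R (y /\<^sub>R m)) * ennreal (s ^ (n - 1))"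
      have "(\<integral>\<^sup>+s. ?h s \<partial>lborel) = ennreal m * (\<integral>\<^sup>+r. ?h (0 + m * r) \<partial>lborel)"
        using m by (subst nn_integral_real_affine[of _ m 0]) auto
      also have "(\<integral>\<^sup>+r. ?h (0 + m * r) \<partial>lborel) =
          (\<integral>\<^sup>+r. ennreal (m ^ (n - 1)) * (indicator {0<..} r * f (r *\<^sub>R y) * ennreal (r ^ (n - 1))) \<partial>lborel)"
      proof (rule nn_integral_cong)
        fix r :: real
        show "?h (0 + m * r) = ennreal (m ^ (n - 1)) * (indicator {0<..} r * f (r *\<^sub>R y) * ennreal (r ^ (n - 1)))"
        proof -
          have "(0 + m * r) *\<^sub>R (y /\<^sub>R m) = r *\<^sub>R y" using m by (simp add: field_simps)
          then show ?thesis
            using m by (cases "r > 0") (simp_all only:, auto simp: power_mult_distrib ennreal_mult' mult_ac zero_less_mult_iff)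
        qed
      qed
      also have "\<dots> = ennreal (m ^ (n - 1)) * (\<integral>\<^sup>+r. indicator {0<..} r * f (r *\<^sub>R y) * ennreal (r ^ (n - 1)) \<partial>lborel)"
        by (rule nn_integral_cmult) measurable
      finally have "ennreal (m powr (- n)) * (\<integral>\<^sup>+s. ?h s \<partial>lborel) =
          ennreal (m powr (- n) * m ^ (n - 1) * m) * (\<integral>\<^sup>+r. indicator {0<..} r * f (r *\<^sub>R y) * ennreal (r ^ (n - 1)) \<partial>lborel)"
        using m by (simp add: ennreal_mult' mult_ac)
      then show ?thesis using True unfolding e by (simp add: m_def)
    qed simp
  qed
  finally show ?thesis by (simp add: A_def n_def)
qed

section \<open>The scaling on radii\<close>

locale radial_scaling =
  fixes p n R l :: real
  assumes p: "1 < p" and pn: "p < n" and R: "0 < R" and l: "0 < l"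
begin

abbreviation "a \<equiv> sobolev_exp p n"

text \<open>The quotient of new and old radius, with r^(-a) factored out of the formula in the
  statement. In this form it is bounded above and away from 0 on [0, R], with the value l^(-1/a) at
  0.\<close>

definition dil :: "real \<Rightarrow> real" where
  "dil r = (l + (1 - l) * (r / R) powr a) powr (- (1 / a))"

definition rad :: "real \<Rightarrow> real" where "rad r = r * dil r"

text \<open>The derivative of \<open>rad\<close>: differentiating \<open>rad_powr\<close> gives rad'
  r = l (rad r / r)^(1+a).\<close>

definition rad' :: "real \<Rightarrow> real" where "rad' r = l * dil r powr (1 + a)"

lemma a: "0 < a" using sobolev_exp_pos[OF p pn] .

text \<open>With s = (r / R)^a in [0, 1] the expression is the convex combination s + (1 - s) l of 1
  and l.\<close>

lemma base_bounds:
  assumes "0 \<le> r" "r \<le> R"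
  shows "min 1 l \<le> l + (1 - l) * (r / R) powr a" "l + (1 - l) * (r / R) powr a \<le> max 1 l"
    "0 < l + (1 - l) * (r / R) powr a"
proof -
  define s where "s = (r / R) powr a"
  have "s \<le> 1 powr a" unfolding s_def using assms R a by (intro powr_mono2) auto
  then have s: "0 \<le> s" "s \<le> 1" by (auto simp: s_def)
  have "s * min 1 l + (1 - s) * min 1 l \<le> s * 1 + (1 - s) * l" using s by (intro add_mono mult_left_mono) auto
  then show 1: "min 1 l \<le> l + (1 - l) * (r / R) powr a" unfolding s_def[symmetric] by (simp add: algebra_simps)
  have "s * 1 + (1 - s) * l \<le> s * max 1 l + (1 - s) * max 1 l" using s by (intro add_mono mult_left_mono) auto
  then show "l + (1 - l) * (r / R) powr a \<le> max 1 l" unfolding s_def[symmetric] by (simp add: algebra_simps)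
  show "0 < l + (1 - l) * (r / R) powr a" 
    by (rule less_le_trans[OF _ 1]) (use l in simp)
qed

definition "dil_min = max 1 l powr (- (1 / a))"
definition "dil_max = min 1 l powr (- (1 / a))"

lemma dil_bounds:
  assumes "0 \<le> r" "r \<le> R"
  shows "dil_min \<le> dil r" "dil r \<le> dil_max" "0 < dil r" "0 < dil_min" "0 < dil_max"
  using base_bounds[OF assms] a l unfolding dil_min_def dil_max_def dil_def
  by (auto intro!: powr_mono2')

lemma rad_eq:
  assumes "0 < r" "r \<le> R"
  shows "rad r = (l * r powr (- a) + (1 - l) * R powr (- a)) powr (- (1 / a))"
proof -
  have "l * r powr (- a) + (1 - l) * R powr (- a) = r powr (- a) * (l + (1 - l) * (r / R) powr a)"
    using assms R by (simp add: powr_divide powr_minus field_simps)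
  then have "(l * r powr (- a) + (1 - l) * R powr (- a)) powr (- (1 / a)) = (r powr (- a)) powr (- (1 / a)) * dil r"
    using base_bounds[of r] assms by (simp add: powr_mult dil_def)
  then show ?thesis using assms a by (simp add: powr_powr rad_def)
qed

lemma rad_pos: "0 < r \<Longrightarrow> r \<le> R \<Longrightarrow> 0 < rad r"
  using dil_bounds(3)[of r] by (simp add: rad_def)

lemma rad_powr: "0 < r \<Longrightarrow> r \<le> R \<Longrightarrow> rad r powr (- a) = l * r powr (- a) + (1 - l) * R powr (- a)"
proof -
  assume r: "0 < r" "r \<le> R"
  have "0 < r powr (- a) * (l + (1 - l) * (r / R) powr a)" using base_bounds(3)[of r] r by simp
  also have "\<dots> = l * r powr (- a) + (1 - l) * R powr (- a)"
    using r R by (simp add: powr_divide powr_minus field_simps)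
  finally show ?thesis using r a by (simp add: rad_eq powr_powr)
qed

lemma radial_time_rad: "0 < r \<Longrightarrow> r \<le> R \<Longrightarrow> radial_time p n R (rad r) = l * radial_time p n R r"
  by (simp add: radial_time_def rad_powr algebra_simps)

lemma rad_less: "0 < r \<Longrightarrow> r < R \<Longrightarrow> rad r < R"
proof (rule ccontr)
  assume r: "0 < r" "r < R" "\<not> rad r < R"
  then have "rad r powr (- a) \<le> R powr (- a)" using a R by (intro powr_mono2') auto
  then have "radial_time p n R (rad r) \<le> 0" by (simp add: radial_time_def)
  moreover have "0 < l * radial_time p n R r" using radial_time_pos[OF p pn r(1,2)] l by simp
  ultimately show False using radial_time_rad[of r] r by simp
qed

lemma rad'_pos: "0 \<le> r \<Longrightarrow> r \<le> R \<Longrightarrow> 0 < rad' r"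
  using dil_bounds(3)[of r] l by (simp add: rad'_def)

lemma rad'_le: "0 \<le> r \<Longrightarrow> r \<le> R \<Longrightarrow> rad' r \<le> l * dil_max powr (1 + a)"
  using dil_bounds[of r] l a by (simp add: rad'_def powr_mono2)

lemma rad'_ge: "0 \<le> r \<Longrightarrow> r \<le> R \<Longrightarrow> l * dil_min powr (1 + a) \<le> rad' r"
  using dil_bounds[of r] l a by (simp add: rad'_def powr_mono2)

lemma dil_deriv:
  assumes "0 < r" "r < R"
  shows "(dil has_real_derivative (rad' r - dil r) / r) (at r)"
proof -
  define b where "b = l + (1 - l) * (r / R) powr a"
  have b: "0 < b" using base_bounds(3)[of r] assms by (simp add: b_def)
  have "((\<lambda>r. (r / R) powr a) has_real_derivative a * (r / R) powr (a - 1) * (1 / R)) (at r)"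
    using assms R by (auto intro!: derivative_eq_intros)
  moreover have "a * (r / R) powr (a - 1) * (1 / R) = a * (r / R) powr a / r"
    using assms R by (simp add: powr_diff)
  ultimately have "((\<lambda>r. (r / R) powr a) has_real_derivative a * (r / R) powr a / r) (at r)" by simp
  then have "((\<lambda>r. l + (1 - l) * (r / R) powr a) has_real_derivative (1 - l) * (a * (r / R) powr a / r)) (at r)"
    using DERIV_add[OF DERIV_const[of l] DERIV_cmult[of "\<lambda>r. (r / R) powr a" _ r _ "1 - l"]] by fastforce
  from DERIV_fun_powr[OF this b[unfolded b_def], of "- (1 / a)"]
  have "(dil has_real_derivative - (1 / a) * b powr (- (1 / a) - 1) * ((1 - l) * (a * (r / R) powr a / r))) (at r)"
    unfolding dil_def[abs_def] b_def by simp
  moreover have "- (1 / a) * b powr (- (1 / a) - 1) * ((1 - l) * (a * (r / R) powr a / r)) = (rad' r - dil r) / r"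
  proof -
    have 1: "b powr (- (1 / a)) = b powr (- (1 / a) - 1) * b" using b by (simp add: powr_diff)
    have 2: "- (1 / a) * (1 + a) = - (1 / a) - 1" using a by (simp add: field_simps)
    have "dil r = b powr (- (1 / a))" by (simp add: dil_def b_def)
    moreover have "rad' r = l * b powr (- (1 / a) - 1)"
      unfolding rad'_def dil_def b_def[symmetric] powr_powr 2 ..
    ultimately have "rad' r - dil r = b powr (- (1 / a) - 1) * (l - b)" unfolding 1 by (simp add: algebra_simps)
    also have "l - b = - ((1 - l) * (r / R) powr a)" by (simp add: b_def)
    finally show ?thesis using a by simp
  qed
  ultimately show ?thesis by simp
qed

lemma rad_deriv:
  assumes "0 < r" "r < R"
  shows "(rad has_real_derivative rad' r) (at r)"
  unfolding rad_def[abs_def]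
  by (rule DERIV_cong[OF DERIV_mult[OF DERIV_ident dil_deriv[OF assms]]]) (use assms in simp)

lemma continuous_on_dil: "continuous_on {0<..<R} dil"
  using dil_deriv DERIV_isCont by (fastforce intro: continuous_at_imp_continuous_on)

lemma inverse_scaling: "radial_scaling p n R (1 / l)"
  using p pn R l by unfold_locales auto

text \<open>The two scalings multiply the time by l and by 1 / l, and the time determines the
  radius.\<close>

lemma rad_inverse:
  assumes r: "0 < r" "r < R"
  shows "radial_scaling.rad p n R (1 / l) (rad r) = r"
proof -
  interpret I: radial_scaling p n R "1 / l" by (rule inverse_scaling)
  have 1: "0 < rad r" "rad r \<le> R" using rad_pos rad_less r by (auto intro: less_imp_le)
  have "radial_time p n R (I.rad (rad r)) = radial_time p n R r"
    using I.radial_time_rad[OF 1] radial_time_rad[of r] r l by simp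
  then have "I.rad (rad r) powr (- a) = r powr (- a)" by (simp add: radial_time_def)
  then have "(I.rad (rad r) powr (- a)) powr (- (1 / a)) = (r powr (- a)) powr (- (1 / a))" by simp
  then show ?thesis using a r I.rad_pos[OF 1] by (simp add: powr_powr)
qed

lemma strict_mono_rad: "strict_mono_on {0<..<R} rad"
proof (rule strict_mono_onI)
  fix r s assume "r \<in> {0<..<R}" "s \<in> {0<..<R}" "r < s"
  then show "rad r < rad s"
    using rad_deriv rad'_pos by (intro DERIV_pos_imp_increasing[of r s rad]) (auto, smt (verit))
qed

text \<open>The substitution rule is applied on compact subintervals. These exhaust the open
  interval, and so do their images, since \<open>rad\<close> is increasing and the scaling with 1 /
  l inverts it; both sides are limits by monotone convergence.\<close>

lemma nn_integral_rad:
  fixes g :: "real \<Rightarrow> ennreal"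
  assumes [measurable]: "g \<in> borel_measurable borel"
  shows "(\<integral>\<^sup>+r. g (rad r) * ennreal (rad' r) * indicator {0<..<R} r \<partial>lborel) = (\<integral>\<^sup>+s. g s * indicator {0<..<R} s \<partial>lborel)"
proof -
  interpret I: radial_scaling p n R "1 / l" by (rule inverse_scaling)
  \<comment> \<open>b k = R / (k + 3) is at most R / 3, so already the first interval is
    nondegenerate.\<close>
  define b where "b k = R * inverse (real (Suc (k + 2)))" for k
  define A where "A k = {b k .. R - b k}" for k
  have b: "0 < b k" "b k < R - b k" "R - b k < R" for k
  proof -
    have "0 < inverse (real (Suc (k + 2)))" "inverse (real (Suc (k + 2))) \<le> 1 / 3" by (auto simp: field_simps)
    then have "0 < b k" "b k \<le> R * (1 / 3)" unfolding b_def using R by (auto intro!: mult_left_mono)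
    then show "0 < b k" "b k < R - b k" "R - b k < R" using R by auto
  qed
  have b0: "b \<longlonglongrightarrow> 0" unfolding b_def
    by (rule tendsto_mult_right_zero[OF LIMSEQ_ignore_initial_segment[OF LIMSEQ_inverse_real_of_nat]])
  have b_anti: "b j \<le> b k" if "k \<le> j" for j k using that R unfolding b_def by (intro mult_left_mono le_imp_inverse_le) auto
  have Un: "(\<Union>k. A k) = {0<..<R}"
  proof safe
    fix r k assume "r \<in> A k" then show "r \<in> {0<..<R}" using b[of k] by (auto simp: A_def)
  next
    fix r assume "r \<in> {0<..<R}"
    then have "0 < min r (R - r)" by auto
    then have "\<forall>\<^sub>F k in sequentially. b k < min r (R - r)" by (rule order_tendstoD(2)[OF b0])
    then obtain k where "b k < min r (R - r)" by (auto simp: eventually_sequentially)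
    then show "r \<in> (\<Union>k. A k)" by (auto simp: A_def intro!: exI[of _ k])
  qed
  have incA: "incseq A" unfolding A_def using b_anti by (auto intro!: monoI dest: order_trans) (smt (verit))+
  have ArR: "A k \<subseteq> {0<..<R}" for k using Un by auto
  have img: "rad r \<in> {rad (b k) .. rad (R - b k)} \<longleftrightarrow> r \<in> A k" if "r \<in> {0<..<R}" for r k
    using strict_mono_on_leD[OF strict_mono_rad] strict_mono_on_less_eq[OF strict_mono_rad] that b[of k] R unfolding A_def by auto
  define B where "B k = {rad (b k) .. rad (R - b k)}" for k
  have rad_I: "rad (I.rad s) = s" "I.rad s \<in> {0<..<R}" if "s \<in> {0<..<R}" for s
    using I.rad_inverse[of s] I.rad_pos[of s] I.rad_less[of s] that l by auto
  have BR: "B k \<subseteq> {0<..<R}" for k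
    using rad_pos[of "b k"] rad_less[of "R - b k"] b[of k] by (auto simp: B_def)
  have UnB: "(\<Union>k. B k) = {0<..<R}"
  proof (rule antisym)
    show "{0<..<R} \<subseteq> (\<Union>k. B k)"
    proof
      fix s assume s: "s \<in> {0<..<R}"
      then obtain k where "I.rad s \<in> A k" using rad_I(2) Un by blast
      then show "s \<in> (\<Union>k. B k)" using img[OF rad_I(2)[OF s], of k] rad_I(1)[OF s] by (auto simp: B_def)
    qed
  qed (use BR in auto)
  have incB: "incseq B"
  proof (rule monoI, rule subsetI)
    fix j k s assume jk: "j \<le> k" and s: "s \<in> B j"
    then have s': "s \<in> {0<..<R}" using BR[of j] by (meson subsetD)
    have "I.rad s \<in> A j" using img[OF rad_I(2)[OF s'], of j] rad_I(1)[OF s'] s by (simp add: B_def)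
    then have "I.rad s \<in> A k" using incA jk by (auto simp: incseq_def)
    then show "s \<in> B k" using img[OF rad_I(2)[OF s'], of k] rad_I(1)[OF s'] by (simp add: B_def)
  qed
  have SUP_ind: "(\<integral>\<^sup>+x. f x * indicator (\<Union>k. C k) x \<partial>lborel) = (SUP k. \<integral>\<^sup>+x. f x * indicator (C k) x \<partial>lborel)"
    if [measurable]: "f \<in> borel_measurable borel" and C: "incseq C" "\<And>k. C k \<in> sets borel" for f :: "real \<Rightarrow> ennreal" and C
    using SUP_emeasure_incseq[of C "density lborel f"] C by (simp add: emeasure_density image_subset_iff)
  have [measurable]: "rad \<in> borel_measurable borel" "rad' \<in> borel_measurable borel"
    unfolding rad_def[abs_def] rad'_def[abs_def] dil_def[abs_def] by measurable
  have "(\<integral>\<^sup>+s. g s * indicator (B k) s \<partial>lborel) = (\<integral>\<^sup>+r. g (rad r) * ennreal (rad' r) * indicator (A k) r \<partial>lborel)" for k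
    unfolding A_def B_def
  proof (rule nn_integral_substitution_aux)
    fix r assume "r \<in> {b k .. R - b k}"
    then have r: "0 < r" "r < R" using b[of k] by auto
    show "(rad has_real_derivative rad' r) (at r)" by (rule rad_deriv[OF r])
    show "0 \<le> rad' r" using rad'_pos[of r] r by simp
  next
    have "continuous_on {b k .. R - b k} dil"
      using b[of k] by (intro continuous_on_subset[OF continuous_on_dil]) auto
    moreover have "dil x \<noteq> 0" if "x \<in> {b k .. R - b k}" for x
      using dil_bounds(3)[of x] that b[of k] by auto
    ultimately show "continuous_on {b k .. R - b k} rad'" unfolding rad'_def[abs_def]
      by (intro continuous_intros) auto
  qed (use b in auto)
  moreover have "(\<integral>\<^sup>+s. g s * indicator {0<..<R} s \<partial>lborel) = (SUP k. \<integral>\<^sup>+s. g s * indicator (B k) s \<partial>lborel)"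
    unfolding UnB[symmetric] by (rule SUP_ind[OF _ incB]) (auto simp: B_def)
  moreover have "(\<integral>\<^sup>+r. g (rad r) * ennreal (rad' r) * indicator {0<..<R} r \<partial>lborel) =
      (SUP k. \<integral>\<^sup>+r. g (rad r) * ennreal (rad' r) * indicator (A k) r \<partial>lborel)"
    unfolding Un[symmetric] by (rule SUP_ind[OF _ incA]) (auto simp: A_def)
  ultimately show ?thesis by simp
qed

end

section \<open>Change of variables and chain rule for the radial scaling\<close>

lemma nn_integral_lebesgue_on_borel:
  fixes g :: "'a::euclidean_space \<Rightarrow> ennreal"
  assumes "\<Omega> \<in> sets borel"
  shows "(\<integral>\<^sup>+x. g x \<partial>lebesgue_on \<Omega>) = (\<integral>\<^sup>+x. g x * indicator \<Omega> x \<partial>lborel)"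
  using assms by (simp add: nn_integral_restrict_space nn_integral_completion)

context radial_scaling
begin

definition S :: "'a::euclidean_space \<Rightarrow> 'a" where "S x = dil (norm x) *\<^sub>R x"

text \<open>The Jacobian determinant: the derivative of \<open>S\<close> stretches the tangential
  directions by \<open>dil\<close> and the radial one by \<open>rad'\<close>.\<close>

definition jac :: "'a::euclidean_space \<Rightarrow> real" where
  "jac x = dil (norm x) ^ (DIM('a) - 1) * rad' (norm x)"

abbreviation pball :: "'a::euclidean_space set" where "pball \<equiv> ball 0 R - {0}"

lemma norm_S: "norm x \<le> R \<Longrightarrow> norm (S x) = rad (norm x)"
  using dil_bounds(3)[of "norm x"] by (simp add: S_def rad_def)

lemma S_pball: "x \<in> pball \<Longrightarrow> S x \<in> pball"
  using rad_pos[of "norm x"] rad_less[of "norm x"] norm_S[of x] by auto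

lemma S_inverse:
  fixes x :: "'a::euclidean_space"
  assumes "x \<in> pball"
  shows "radial_scaling.S p n R (1 / l) (S x) = x"
proof -
  interpret I: radial_scaling p n R "1 / l" by (rule inverse_scaling)
  have x: "0 < norm x" "norm x < R" using assms by auto
  have nS: "norm (S x) = rad (norm x)" using norm_S[of x] x by simp
  have "I.rad (rad (norm x)) = norm x" using rad_inverse[OF x] .
  then have "I.dil (rad (norm x)) * (norm x * dil (norm x)) = norm x"
    by (simp add: I.rad_def rad_def mult_ac)
  then have "I.dil (rad (norm x)) * dil (norm x) = 1" using x by simp
  then show ?thesis unfolding I.S_def nS by (simp add: S_def)
qed

lemma S_sgn: "x \<in> pball \<Longrightarrow> S x /\<^sub>R norm (S x) = x /\<^sub>R norm x"
  using dil_bounds(3)[of "norm x"] norm_S[of x] by (simp add: S_def rad_def)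

lemma jac_pos: "norm x \<le> R \<Longrightarrow> 0 < jac x"
  using dil_bounds(3)[of "norm x"] rad'_pos[of "norm x"] by (simp add: jac_def)

lemma S_borel [measurable]: "S \<in> borel_measurable borel"
  unfolding S_def[abs_def] dil_def by measurable

lemma jac_borel [measurable]: "jac \<in> borel_measurable borel"
  unfolding jac_def[abs_def] rad'_def[abs_def] dil_def by measurable

lemma pball_borel [measurable]: "pball \<in> sets borel"
  by (simp add: open_delete)

text \<open>\<open>S\<close> preserves rays, so in polar coordinates the claim reduces to
  \<open>nn_integral_rad\<close> on each ray.\<close>

lemma nn_integral_S_borel:
  fixes F :: "'a::euclidean_space \<Rightarrow> ennreal"
  assumes n: "n = DIM('a)" and [measurable]: "F \<in> borel_measurable borel"
  shows "(\<integral>\<^sup>+x. F (S x) * ennreal (jac x) * indicator pball x \<partial>lborel) = (\<integral>\<^sup>+x. F x * indicator pball x \<partial>lborel)"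
proof -
  define N where "N = DIM('a)"
  have eq: "(\<integral>\<^sup>+s. indicator {0<..} s * (F (S (s *\<^sub>R (y /\<^sub>R norm y))) * ennreal (jac (s *\<^sub>R (y /\<^sub>R norm y))) *
        indicator pball (s *\<^sub>R (y /\<^sub>R norm y))) * ennreal (s ^ (N - 1)) \<partial>lborel) =
      (\<integral>\<^sup>+s. indicator {0<..} s * (F (s *\<^sub>R (y /\<^sub>R norm y)) * indicator pball (s *\<^sub>R (y /\<^sub>R norm y))) * ennreal (s ^ (N - 1)) \<partial>lborel)"
    if y: "y \<noteq> 0" for y :: 'a
  proof -
    define \<omega> where "\<omega> = y /\<^sub>R norm y"
    have \<omega>: "norm \<omega> = 1" "\<omega> \<noteq> 0" using y by (auto simp: \<omega>_def)
    define g where "g s = F (s *\<^sub>R \<omega>) * ennreal (s ^ (N - 1))" for s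
    have [measurable]: "g \<in> borel_measurable borel" unfolding g_def[abs_def] by measurable
    have 1: "indicator {0<..} s * (F (S (s *\<^sub>R \<omega>)) * ennreal (jac (s *\<^sub>R \<omega>)) * indicator pball (s *\<^sub>R \<omega>)) * ennreal (s ^ (N - 1)) =
        g (rad s) * ennreal (rad' s) * indicator {0<..<R} s" for s
    proof (cases "0 < s \<and> s < R")
      case True
      have nz: "norm (s *\<^sub>R \<omega>) = s" using True \<omega> by simp
      have "S (s *\<^sub>R \<omega>) = rad s *\<^sub>R \<omega>" unfolding S_def nz by (simp add: rad_def mult.commute)
      moreover have "jac (s *\<^sub>R \<omega>) * s ^ (N - 1) = rad s ^ (N - 1) * rad' s"
        unfolding jac_def nz by (simp add: rad_def N_def power_mult_distrib mult_ac)
      then have "ennreal (jac (s *\<^sub>R \<omega>)) * ennreal (s ^ (N - 1)) = ennreal (rad s ^ (N - 1)) * ennreal (rad' s)"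
        using True rad_pos[of s] rad'_pos[of s] jac_pos[of "s *\<^sub>R \<omega>"] nz by (simp add: ennreal_mult'[symmetric])
      moreover have "s *\<^sub>R \<omega> \<in> pball" using True \<omega> by simp
      ultimately show ?thesis using True by (simp add: g_def mult.assoc)
    next
      case False
      then show ?thesis using \<omega> by (auto simp: indicator_def)
    qed
    have 2: "indicator {0<..} s * (F (s *\<^sub>R \<omega>) * indicator pball (s *\<^sub>R \<omega>)) * ennreal (s ^ (N - 1)) =
        g s * indicator {0<..<R} s" for s
      using \<omega> by (auto simp: indicator_def g_def)
    show ?thesis unfolding \<omega>_def[symmetric] 1 2 by (rule nn_integral_rad) measurable
  qed
  have m: "(\<lambda>x. F (S x) * ennreal (jac x) * indicator pball x) \<in> borel_measurable borel"
    "(\<lambda>x. F x * indicator pball x) \<in> borel_measurable borel" by measurable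
  show ?thesis
    unfolding nn_integral_polar[OF m(1)] nn_integral_polar[OF m(2)]
  proof (rule nn_integral_cong, goal_cases)
    case (1 y)
    then show ?case using eq[of y] unfolding N_def by (cases "y = 0") simp_all
  qed
qed

lemma nn_integral_ball_pball:
  fixes g :: "'a::euclidean_space \<Rightarrow> ennreal"
  shows "(\<integral>\<^sup>+x. g x \<partial>lebesgue_on (ball 0 R)) = (\<integral>\<^sup>+x. g x * indicator pball x \<partial>lborel)"
  unfolding nn_integral_lebesgue_on_borel[OF borel_open[OF open_ball]]
  by (rule nn_integral_cong_AE, use AE_lborel_singleton[of "0::'a"] in eventually_elim) (auto simp: indicator_def)

lemma AE_pball: "AE x in lebesgue_on (ball (0::'a::euclidean_space) R). x \<in> pball"
proof -
  have "AE x::'a in lebesgue. x \<noteq> 0" by (rule AE_completion[OF AE_lborel_singleton])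
  then show ?thesis by (auto simp: AE_restrict_space_iff elim: eventually_mono)
qed

text \<open>The change of variables applied to the indicator of N gives integral 0, and the Jacobian
  is positive; so preimages of null sets are null.\<close>

lemma AE_S_notin_null:
  fixes N :: "'a::euclidean_space set"
  assumes n: "n = DIM('a)" and N: "N \<in> null_sets lborel"
  shows "AE x in lebesgue_on (ball 0 R). S x \<notin> N"
proof -
  have [measurable]: "N \<in> sets borel" using N by auto
  have "(\<integral>\<^sup>+x. indicator N (S x) * ennreal (jac x) * indicator pball x \<partial>lborel) = (\<integral>\<^sup>+x. indicator N x * indicator pball x \<partial>lborel)"
    by (rule nn_integral_S_borel[OF n]) measurable
  also have "\<dots> = 0"
  proof -
    have "AE x in lborel. x \<notin> N" using N by (rule AE_not_in)
    then have "AE x in lborel. indicator N x * indicator pball x = (0::ennreal)" by eventually_elim simp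
    then show ?thesis by (subst nn_integral_0_iff_AE) auto
  qed
  finally have "AE x in lborel. indicator N (S x) * ennreal (jac x) * indicator pball x = 0"
    by (subst (asm) nn_integral_0_iff_AE) auto
  then have "AE x in lebesgue. indicator N (S x) * ennreal (jac x) * indicator pball x = 0" by (rule AE_completion)
  then have "AE x in lebesgue_on (ball 0 R). indicator N (S x) * ennreal (jac x) * indicator pball x = 0"
    by (auto simp: AE_restrict_space_iff elim: eventually_mono)
  then show ?thesis using AE_pball
  proof eventually_elim
    case (elim x)
    then show ?case using jac_pos[of x] by (auto simp: indicator_def ennreal_eq_0_iff split: if_splits)
  qed
qed

lemma S_ball: "x \<in> ball 0 R \<Longrightarrow> S x \<in> ball 0 R"
  using S_pball[of x] R by (cases "x = 0") (auto simp: S_def)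

text \<open>Borel measurability does not suffice for composing with Lebesgue measurable functions;
  preimages of null sets must be null as well.\<close>

lemma S_measurable_lebesgue:
  assumes n: "n = DIM('a)"
  shows "S \<in> lebesgue_on (ball (0::'a::euclidean_space) R) \<rightarrow>\<^sub>M lebesgue_on (ball 0 R)"
proof (rule measurable_restrict_space2)
  let ?M = "lebesgue_on (ball (0::'a) R)"
  interpret complete_measure ?M by (rule complete_measure_lebesgue_on) simp
  show "S \<in> space ?M \<rightarrow> ball 0 R" using S_ball by auto
  have SM: "S \<in> ?M \<rightarrow>\<^sub>M lborel"
    by (intro measurable_restrict_space1 measurable_completion) measurable
  show "S \<in> ?M \<rightarrow>\<^sub>M lebesgue"
  proof (rule measurable_completion2[OF SM], rule subsetI)
    fix N :: "'a set" assume N: "N \<in> null_sets lborel"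
    have "S -` N \<inter> space ?M \<in> null_sets ?M"
      using AE_S_notin_null[OF n N] N measurable_sets[OF SM]
      by (subst null_sets_iff_AE) (auto elim: eventually_mono)
    then show "N \<in> null_sets (distr ?M lborel S)"
      using N SM by (auto simp: null_sets_def emeasure_distr)
  qed
qed

lemma AE_S:
  fixes P :: "'a::euclidean_space \<Rightarrow> bool"
  assumes n: "n = DIM('a)" and P: "AE x in lebesgue_on (ball 0 R). P x"
  shows "AE x in lebesgue_on (ball 0 R). P (S x)"
proof -
  have "AE x in lborel. x \<in> ball 0 R \<longrightarrow> P x" using P by (simp add: AE_restrict_space_iff AE_completion_iff)
  then obtain N where N: "{x \<in> space lborel. \<not> (x \<in> ball 0 R \<longrightarrow> P x)} \<subseteq> N" "N \<in> null_sets lborel"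
    by (auto elim: AE_E simp: null_sets_def)
  have "AE x in lebesgue_on (ball (0::'a) R). x \<in> ball 0 R" by (rule AE_I2) simp
  with AE_S_notin_null[OF n N(2)] show ?thesis
    by eventually_elim (use N(1) S_ball in force)
qed

lemma nn_integral_S:
  fixes f :: "'a::euclidean_space \<Rightarrow> ennreal"
  assumes n: "n = DIM('a)" and f: "f \<in> borel_measurable (lebesgue_on (ball 0 R))"
  shows "(\<integral>\<^sup>+x. f (S x) * ennreal (jac x) \<partial>lebesgue_on (ball 0 R)) = (\<integral>\<^sup>+x. f x \<partial>lebesgue_on (ball 0 R))"
proof -
  let ?M = "lebesgue_on (ball (0::'a) R)"
  have "(\<lambda>x. f x * indicator (ball 0 R) x) \<in> borel_measurable lebesgue"
    using f by (subst (asm) borel_measurable_restrict_space_iff_ennreal) (auto simp: mult.commute)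
  then obtain g where g: "g \<in> borel_measurable lborel" "AE x in lborel. f x * indicator (ball 0 R) x = g x"
    using completion_ex_borel_measurable by blast
  have [measurable]: "g \<in> borel_measurable borel" using g(1) by simp
  have "AE x in lebesgue. f x * indicator (ball 0 R) x = g x" by (rule AE_completion[OF g(2)])
  then have AE: "AE x in ?M. f x = g x" by (auto simp: AE_restrict_space_iff elim: eventually_mono)
  have "(\<integral>\<^sup>+x. f (S x) * ennreal (jac x) \<partial>?M) = (\<integral>\<^sup>+x. g (S x) * ennreal (jac x) \<partial>?M)"
    by (rule nn_integral_cong_AE) (use AE_S[OF n AE] in \<open>auto elim: eventually_mono\<close>)
  also have "\<dots> = (\<integral>\<^sup>+x. g x \<partial>?M)"
    unfolding nn_integral_ball_pball by (rule nn_integral_S_borel[OF n]) measurable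
  also have "\<dots> = (\<integral>\<^sup>+x. f x \<partial>?M)"
    by (rule nn_integral_cong_AE) (use AE in \<open>auto elim: eventually_mono\<close>)
  finally show ?thesis .
qed

definition "jac_min N = dil_min ^ (N - 1) * (l * dil_min powr (1 + a))" for N :: nat

lemma jac_min: "norm x \<le> R \<Longrightarrow> jac_min DIM('a) \<le> jac (x::'a::euclidean_space)" "0 < jac_min N"
  using dil_bounds[of "norm x"] dil_bounds[of 0] rad'_ge[of "norm x"] l R
  by (auto simp: jac_min_def jac_def intro!: mult_mono power_mono)

text \<open>The Jacobian is bounded below by a positive constant. This makes composition with
  \<open>S\<close> a bounded operation on L^p.\<close>

lemma integral_S_le:
  fixes f :: "'a::euclidean_space \<Rightarrow> real"
  assumes n: "n = DIM('a)" and f: "integrable (lebesgue_on (ball 0 R)) f" and f0: "\<And>x. 0 \<le> f x"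
  shows "integrable (lebesgue_on (ball 0 R)) (\<lambda>x. f (S x))"
    and "(LINT x|lebesgue_on (ball 0 R). f (S x)) \<le> (LINT x|lebesgue_on (ball 0 R). f x) / jac_min DIM('a)"
proof -
  let ?M = "lebesgue_on (ball (0::'a) R)"
  let ?c = "jac_min DIM('a)"
  have c: "0 < ?c" by (rule jac_min)
  have [measurable]: "f \<in> borel_measurable ?M" using f by auto
  have m: "(\<lambda>x. f (S x)) \<in> borel_measurable ?M"
    by (rule measurable_compose[OF S_measurable_lebesgue[OF n]]) measurable
  have "(\<integral>\<^sup>+x. ennreal (f (S x)) \<partial>?M) \<le> (\<integral>\<^sup>+x. ennreal (1 / ?c) * (ennreal (f (S x)) * ennreal (jac x)) \<partial>?M)"
  proof (rule nn_integral_mono)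
    fix x assume "x \<in> space ?M"
    then have "?c \<le> jac x" using jac_min(1)[of x] by simp
    then have "f (S x) * 1 \<le> f (S x) * (1 / ?c * jac x)" using c f0 by (intro mult_left_mono) (auto simp: field_simps)
    then show "ennreal (f (S x)) \<le> ennreal (1 / ?c) * (ennreal (f (S x)) * ennreal (jac x))"
      using c f0 \<open>?c \<le> jac x\<close> by (simp add: ennreal_mult'[symmetric] ennreal_leI mult_ac)
  qed
  also have "\<dots> = ennreal (1 / ?c) * (\<integral>\<^sup>+x. ennreal (f (S x)) * ennreal (jac x) \<partial>?M)"
  proof (rule nn_integral_cmult)
    have "jac \<in> borel_measurable ?M"
      by (intro measurable_restrict_space1 measurable_completion) measurable
    then show "(\<lambda>x. ennreal (f (S x)) * ennreal (jac x)) \<in> borel_measurable ?M" using m by measurable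
  qed
  also have "(\<integral>\<^sup>+x. ennreal (f (S x)) * ennreal (jac x) \<partial>?M) = (\<integral>\<^sup>+x. ennreal (f x) \<partial>?M)"
    by (rule nn_integral_S[OF n]) measurable
  also have "\<dots> = ennreal (LINT x|?M. f x)" using f f0 by (intro nn_integral_eq_integral) auto
  finally have le: "(\<integral>\<^sup>+x. ennreal (f (S x)) \<partial>?M) \<le> ennreal ((LINT x|?M. f x) / ?c)"
    using c f0 by (simp add: ennreal_mult'[symmetric] divide_inverse mult.commute)
  show int: "integrable ?M (\<lambda>x. f (S x))"
    using m f0 le by (intro integrableI_nonneg) (auto intro: le_less_trans)
  have "ennreal (LINT x|?M. f (S x)) \<le> ennreal ((LINT x|?M. f x) / ?c)"
    using le int f0 by (subst nn_integral_eq_integral[symmetric]) auto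
  then show "(LINT x|?M. f (S x)) \<le> (LINT x|?M. f x) / ?c"
    using c f0 by (subst (asm) ennreal_le_iff) auto
qed

section \<open>The derivative of the scaling and the chain rule for test functions\<close>

definition DS :: "'a::euclidean_space \<Rightarrow> 'a \<Rightarrow> 'a" where
  "DS x w = dil (norm x) *\<^sub>R w + ((rad' (norm x) - dil (norm x)) * ((x /\<^sub>R norm x) \<bullet> w)) *\<^sub>R (x /\<^sub>R norm x)"

text \<open>\<open>DS x\<close> acts as \<open>dil\<close> on the tangential part and as
  \<open>rad'\<close> on the radial part, hence is self-adjoint; the chain rule for gradients
  therefore involves \<open>DS x\<close> itself and no transposed map.\<close>

lemma DS_symmetric: "DS x v \<bullet> w = v \<bullet> DS x w"
  by (simp add: DS_def inner_add_left inner_add_right inner_commute mult_ac)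

lemma DS_diff: "DS x (v - w) = DS x v - DS x w"
  by (simp add: DS_def algebra_simps inner_diff_right)

lemma inner_DS_radial:
  assumes "x \<noteq> 0"
  shows "(x /\<^sub>R norm x) \<bullet> DS x w = rad' (norm x) * ((x /\<^sub>R norm x) \<bullet> w)"
proof -
  have "(x /\<^sub>R norm x) \<bullet> (x /\<^sub>R norm x) = 1" using assms by (simp add: dot_square_norm power2_eq_square)
  then show ?thesis unfolding DS_def by (simp only: inner_add_right inner_scaleR_right) (simp add: algebra_simps)
qed

definition "DS_max = 2 * dil_max + l * dil_max powr (1 + a)"

lemma norm_DS_le: "norm x \<le> R \<Longrightarrow> norm (DS x w) \<le> DS_max * norm w"
proof -
  assume x: "norm x \<le> R"
  have "norm (DS x w) \<le> norm (dil (norm x) *\<^sub>R w) +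
      norm ((rad' (norm x) - dil (norm x)) *\<^sub>R (((x /\<^sub>R norm x) \<bullet> w) *\<^sub>R (x /\<^sub>R norm x)))"
    unfolding DS_def scaleR_scaleR[symmetric] by (rule norm_triangle_ineq)
  also have "\<dots> = \<bar>dil (norm x)\<bar> * norm w + \<bar>rad' (norm x) - dil (norm x)\<bar> * \<bar>(x /\<^sub>R norm x) \<bullet> w\<bar>"
    unfolding norm_scaleR[of "rad' (norm x) - dil (norm x)"] norm_radial_projection by simp
  also have "\<dots> \<le> dil_max * norm w + (l * dil_max powr (1 + a) + dil_max) * norm w"
    using dil_bounds[of "norm x"] rad'_le[of "norm x"] rad'_pos[of "norm x"] x abs_inner_unit_le[of x w]
    by (intro add_mono mult_mono) auto
  finally show ?thesis by (simp add: DS_max_def algebra_simps)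
qed

lemma DS_max_nonneg: "0 \<le> DS_max"
  using dil_bounds(5)[of 0] R l by (simp add: DS_max_def)

lemma S_has_derivative:
  assumes "x \<in> pball"
  shows "(S has_derivative DS x) (at x)"
proof -
  have x: "x \<noteq> 0" "0 < norm x" "norm x < R" using assms by auto
  have "(norm has_derivative (\<lambda>v. (x /\<^sub>R norm x) \<bullet> v)) (at x)"
    using has_derivative_norm[OF x(1)] by (simp add: sgn_div_norm inner_commute)
  then have "((\<lambda>x. dil (norm x)) has_derivative (\<lambda>v. (((rad' (norm x) - dil (norm x)) / norm x) *\<^sub>R (x /\<^sub>R norm x)) \<bullet> v)) (at x)"
    by (rule has_derivative_compose_inner[where f=norm and \<phi>=dil, OF _ dil_deriv[OF x(2,3)]])
  from has_derivative_scaleR[OF this has_derivative_ident]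
  show ?thesis unfolding S_def[abs_def]
    by (rule has_derivative_eq_rhs) (auto simp: DS_def divide_inverse mult_ac)
qed

lemma smooth_on_S: "c \<in> Basis \<Longrightarrow> smooth_on pball (\<lambda>x. S x \<bullet> c)"
proof -
  have o: "open (pball :: 'a set)" by (simp add: open_delete)
  have "smooth_on pball (\<lambda>x::'a. l + (1 - l) * R powr (- a) * norm x powr a)"
    by (intro smooth_on_add smooth_on_mult smooth_on_const smooth_on_subset[OF smooth_on_norm_powr] o) auto
  moreover have eq: "l + (1 - l) * R powr (- a) * norm x powr a = l + (1 - l) * (norm x / R) powr a" for x :: 'a
    using R by (simp add: powr_divide powr_minus_divide)
  ultimately have "smooth_on pball (\<lambda>x::'a. (l + (1 - l) * R powr (- a) * norm x powr a) powr (- (1 / a)))"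
    by (intro smooth_on_compose_real[OF o _ smooth_on_powr]) (use base_bounds(3) in \<open>auto simp: eq less_imp_le\<close>)
  then have "smooth_on pball (\<lambda>x::'a. dil (norm x))" unfolding eq dil_def .
  then show "smooth_on pball (\<lambda>x::'a. S x \<bullet> c)"
    unfolding S_def inner_scaleR_left by (intro smooth_on_mult smooth_on_inner o)
qed

text \<open>The value 0 outside the punctured ball, where the formula for \<open>S\<close> is not
  controlled, makes the scaled test function a test function on the whole space.\<close>

definition pull :: "('a::euclidean_space \<Rightarrow> real) \<Rightarrow> 'a \<Rightarrow> real" where
  "pull \<phi> x = (if x \<in> pball then l powr (- ((p - 1) / p)) * \<phi> (S x) else 0)"

lemma continuous_on_S: "continuous_on pball S"
  using S_has_derivative has_derivative_continuous by (blast intro: continuous_at_imp_continuous_on)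

text \<open>The support moves to its image under the inverse scaling, which is compact in the
  punctured ball; smoothness there and on the complement of that image are glued.\<close>

lemma pull_test_function:
  assumes \<phi>: "\<phi> \<in> test_functions pball"
  shows "pull \<phi> \<in> test_functions pball"
proof -
  interpret I: radial_scaling p n R "1 / l" by (rule inverse_scaling)
  obtain K where K: "smooth_on UNIV \<phi>" "compact K" "K \<subseteq> pball" "\<And>x. x \<notin> K \<Longrightarrow> \<phi> x = 0"
    using test_functionsE[OF \<phi>] by metis
  have o: "open (pball :: 'a set)" by (simp add: open_delete)
  have K': "compact (I.S ` K)" "I.S ` K \<subseteq> pball"
    by (rule compact_continuous_image[OF continuous_on_subset[OF I.continuous_on_S K(3)] K(2)])
       (intro image_subsetI I.S_pball subsetD[OF K(3)])
  have zero: "pull \<phi> x = 0" if "x \<notin> I.S ` K" for x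
    using that K(4)[of "S x"] S_inverse[of x] by (force simp: pull_def)
  have "smooth_on pball (\<lambda>x. l powr (- ((p - 1) / p)) * \<phi> (S x))"
    by (intro smooth_on_mult[OF o smooth_on_const[OF o]] smooth_on_compose[where S=S, OF o open_UNIV _ K(1)] smooth_on_S) auto
  then have "smooth_on pball (pull \<phi>)" by (rule smooth_on_cong[OF o, rotated]) (simp add: pull_def)
  moreover have "smooth_on (- (I.S ` K)) (pull \<phi>)"
    by (rule smooth_on_cong[OF _ _ smooth_on_const[where c=0]])
       (use K'(1) zero in \<open>auto simp: compact_imp_closed open_Compl\<close>)
  ultimately have "smooth_on (pball \<union> - (I.S ` K)) (pull \<phi>)"
    by (intro smooth_on_Un o) (use K'(1) in \<open>auto simp: compact_imp_closed open_Compl\<close>)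
  moreover have "pball \<union> - (I.S ` K) = UNIV" using K'(2) by auto
  ultimately show ?thesis using test_functionsI[OF _ K' zero] by simp
qed

lemma gradient_pull:
  assumes \<phi>: "smooth_on UNIV \<phi>" and x: "x \<in> pball"
  shows "gradient (pull \<phi>) x = l powr (- ((p - 1) / p)) *\<^sub>R DS x (gradient \<phi> (S x))"
proof (rule gradient_unique)
  have "((\<lambda>x. \<phi> (S x)) has_derivative (\<lambda>v. gradient \<phi> (S x) \<bullet> DS x v)) (at x)"
    by (rule has_derivative_compose[OF S_has_derivative[OF x] smooth_on_has_derivative[OF \<phi>]]) simp
  then have "((\<lambda>x. l powr (- ((p - 1) / p)) * \<phi> (S x)) has_derivative
      (\<lambda>v. l powr (- ((p - 1) / p)) * (gradient \<phi> (S x) \<bullet> DS x v))) (at x)"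
    by (rule has_derivative_mult_right)
  then have "((\<lambda>x. l powr (- ((p - 1) / p)) * \<phi> (S x)) has_derivative
      (\<lambda>v. (l powr (- ((p - 1) / p)) *\<^sub>R DS x (gradient \<phi> (S x))) \<bullet> v)) (at x)"
    by (simp add: DS_symmetric)
  then show "(pull \<phi> has_derivative (\<lambda>v. (l powr (- ((p - 1) / p)) *\<^sub>R DS x (gradient \<phi> (S x))) \<bullet> v)) (at x)"
    by (rule has_derivative_transform_within_open[where s=pball])
       (use x in \<open>auto simp: pull_def open_delete\<close>)
qed

end

section \<open>Invariance\<close>

text \<open>If |s| > d then (|s| / d)^(p-1) is at least 1. On sets of finite measure this does the
  work of Hoelder's inequality: L^p convergence controls integrals of first powers.\<close>

lemma abs_le_add_powr:
  fixes s d p :: real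
  assumes "1 \<le> p" "0 < d"
  shows "\<bar>s\<bar> \<le> d + d powr (1 - p) * \<bar>s\<bar> powr p"
proof (cases "\<bar>s\<bar> \<le> d")
  case True then show ?thesis by (simp add: add_increasing2)
next
  case False
  then have "1 = d powr (1 - p) * d powr (p - 1)" using assms by (simp flip: powr_add)
  also have "\<dots> \<le> d powr (1 - p) * \<bar>s\<bar> powr (p - 1)" using False assms by (intro mult_left_mono powr_mono2) auto
  finally have "1 * \<bar>s\<bar> \<le> d powr (1 - p) * \<bar>s\<bar> powr (p - 1) * \<bar>s\<bar>" by (intro mult_right_mono) auto
  also have "\<dots> = d powr (1 - p) * \<bar>s\<bar> powr p" using False assms by (simp add: powr_diff)
  finally show ?thesis using assms by simp
qed

lemma in_Lp_imp_locally_integrable: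
  fixes f :: "'a::euclidean_space \<Rightarrow> 'b::euclidean_space"
  assumes "1 \<le> p" "open \<Omega>" "in_Lp \<Omega> p f"
  shows "locally_integrable \<Omega> f"
  unfolding locally_integrable_def
proof safe
  fix K :: "'a set" assume K: "compact K" "K \<subseteq> \<Omega>"
  then have KL: "K \<in> sets lebesgue" by (auto intro: fmeasurableD lmeasurable_compact)
  have r: "lebesgue_on K = restrict_space (lebesgue_on \<Omega>) K"
    using K(2) by (simp add: restrict_restrict_space Int_absorb1 assms(2) KL)
  have f: "f \<in> borel_measurable (lebesgue_on \<Omega>)" "integrable (lebesgue_on \<Omega>) (\<lambda>x. norm (f x) powr p)"
    using assms(3) by (auto simp: in_Lp_def)
  have K\<Omega>: "K \<in> sets (lebesgue_on \<Omega>)" using K(2) KL assms(2) by (simp add: sets_restrict_space_iff)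
  show "integrable (lebesgue_on K) f"
  proof (rule Bochner_Integration.integrable_bound)
    have "integrable (lebesgue_on K) (\<lambda>x. norm (f x) powr p)"
      unfolding r using K\<Omega> f(2) by (subst integrable_restrict_space) (auto intro: integrable_mult_indicator[where 'b=real, simplified])
    moreover have "integrable (lebesgue_on K) (\<lambda>x. 1 :: real)"
      using lmeasurable_compact[OF K(1)] KL
      by (subst integrable_restrict_space) (auto simp: lmeasurable_iff_integrable)
    ultimately show "integrable (lebesgue_on K) (\<lambda>x. 1 + norm (f x) powr p)" by (intro Bochner_Integration.integrable_add)
    show "f \<in> borel_measurable (lebesgue_on K)" unfolding r using f(1) by (rule measurable_restrict_space1)
    show "AE x in lebesgue_on K. norm (f x) \<le> norm (1 + norm (f x) powr p)"
    proof (rule AE_I2)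
      fix x
      show "norm (f x) \<le> norm (1 + norm (f x) powr p)"
        using abs_le_add_powr[OF assms(1), of 1 "norm (f x)"] by simp
    qed
  qed
qed

text \<open>Closedness of the weak gradient. The chain rule is available classically for test
  functions only, and this lemma carries it over to Sobolev functions. The integration-by-parts
  functional L is 0 on approximants and small on errors.\<close>

lemma has_weak_gradient_limit:
  fixes v :: "'a::euclidean_space \<Rightarrow> real"
  assumes \<Omega>: "open \<Omega>" "bounded \<Omega>" and p: "1 \<le> p" and Lp: "in_Lp \<Omega> p v" "in_Lp \<Omega> p H"
    and appr: "\<And>e. e > 0 \<Longrightarrow> \<exists>\<psi>\<in>test_functions \<Omega>.
      (LINT x|lebesgue_on \<Omega>. \<bar>v x - \<psi> x\<bar> powr p + norm (H x - gradient \<psi> x) powr p) < e"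
  shows "has_weak_gradient \<Omega> v H"
  unfolding has_weak_gradient_def
proof (intro conjI ballI)
  show loc: "locally_integrable \<Omega> v" "locally_integrable \<Omega> H"
    using in_Lp_imp_locally_integrable[OF p \<Omega>(1)] Lp by auto
  have \<Omega>': "\<Omega> \<in> sets lebesgue" using \<Omega> by auto
  let ?M = "lebesgue_on \<Omega>"
  fix \<phi> and b :: 'a assume \<phi>: "\<phi> \<in> test_functions \<Omega>" and b: "b \<in> Basis"
  obtain K where K: "smooth_on UNIV \<phi>" "compact K" "K \<subseteq> \<Omega>" "\<And>x. x \<notin> K \<Longrightarrow> \<phi> x = 0"
    using test_functionsE[OF \<phi>] by metis
  note g0 = gradient_eq_0_outside[where f=\<phi>, OF compact_imp_closed[OF K(2)] K(4)]
  have contK: "continuous_on K \<phi>" "continuous_on K (\<lambda>x. gradient \<phi> x \<bullet> b)"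
    using smooth_on_continuous[OF K(1)] continuous_on_gradient[OF K(1)]
    by (auto intro!: continuous_intros intro: continuous_on_subset)
  have "bounded (\<phi> ` K)" "bounded ((\<lambda>x. gradient \<phi> x \<bullet> b) ` K)"
    using contK K(2) by (auto intro!: compact_imp_bounded compact_continuous_image)
  then obtain M1 M2 where M12: "\<And>y. y \<in> \<phi> ` K \<Longrightarrow> norm y \<le> M1" "\<And>y. y \<in> (\<lambda>x. gradient \<phi> x \<bullet> b) ` K \<Longrightarrow> norm y \<le> M2"
    unfolding bounded_iff by blast
  define C where "C = 1 + max M1 0 + max M2 0"
  have B12: "\<bar>\<phi> x\<bar> \<le> max M1 0" "\<bar>gradient \<phi> x \<bullet> b\<bar> \<le> max M2 0" for x
    using M12(1)[of "\<phi> x"] M12(2)[of "gradient \<phi> x \<bullet> b"] K(4)[of x] g0[of x]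
    by (cases "x \<in> K"; force)+
  have "0 \<le> max M1 0" "0 \<le> max M2 0" by simp_all
  then have C: "1 \<le> C" "\<bar>\<phi> x\<bar> \<le> C" "\<bar>gradient \<phi> x \<bullet> b\<bar> \<le> C" for x
    unfolding C_def using B12[of x] by linarith+
  have int: "integrable ?M (\<lambda>x. h x * (gradient \<phi> x \<bullet> b))" "integrable ?M (\<lambda>x. h x * \<phi> x)"
    if "locally_integrable \<Omega> h" for h
    using integrable_locally_integrable_mult[OF \<Omega>(1) that _ K(2,3), where \<phi>="\<lambda>x. gradient \<phi> x \<bullet> b"]
      integrable_locally_integrable_mult[OF \<Omega>(1) that smooth_on_continuous[OF K(1)] K(2-4)] g0
      continuous_on_inner[OF continuous_on_gradient[OF K(1)] continuous_on_const[of _ b]]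
    by auto
  have locb: "locally_integrable \<Omega> (\<lambda>x. h x \<bullet> b)" if "locally_integrable \<Omega> h" for h :: "'a \<Rightarrow> 'a"
    using that by (auto simp: locally_integrable_def)
  define L where "L f h = (LINT x|?M. f x * (gradient \<phi> x \<bullet> b)) + (LINT x|?M. (h x \<bullet> b) * \<phi> x)" for f h
  have fin: "emeasure lebesgue \<Omega> < \<infinity>"
    using \<Omega> by (metis bounded_set_imp_lmeasurable \<Omega>' fmeasurableD2 top.not_eq_extremum infinity_ennreal_def)
  have int1: "integrable ?M (\<lambda>x. 1::real)"
    using \<Omega>' fin by (subst integrable_restrict_space) (auto intro!: integrable_real_indicator)
  define V where "V = (LINT x|?M. (1::real))"
  have V: "0 \<le> V" by (simp add: V_def)
  have est: "\<bar>L v H\<bar> \<le> \<epsilon>" if \<epsilon>: "\<epsilon> > 0" for \<epsilon>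
  proof -
    \<comment> \<open>d and e make the two parts of the error, C (2 d V) and C c e, at most
      \<epsilon> / 2 each; V + 1 avoids a division by zero.\<close>
    define d where "d = \<epsilon> / (4 * C * (V + 1))"
    have d: "0 < d" using \<epsilon> C V by (simp add: d_def)
    define c where "c = d powr (1 - p)"
    have c: "0 < c" using d by (simp add: c_def)
    define e where "e = \<epsilon> / (2 * C * c)"
    have e: "0 < e" using \<epsilon> C(1) c by (simp add: e_def)
    obtain \<psi> where \<psi>: "\<psi> \<in> test_functions \<Omega>"
      "(LINT x|?M. \<bar>v x - \<psi> x\<bar> powr p + norm (H x - gradient \<psi> x) powr p) < e"
      using appr[OF e] by blast
    have L\<psi>: "in_Lp \<Omega> p \<psi>" "in_Lp \<Omega> p (gradient \<psi>)" using test_function_in_Lp[OF \<psi>(1) \<Omega>'] p by auto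
    have Ld: "in_Lp \<Omega> p (\<lambda>x. v x - \<psi> x)" "in_Lp \<Omega> p (\<lambda>x. H x - gradient \<psi> x)"
      using in_Lp_diff[OF p] Lp L\<psi> by blast+
    have weak: "has_weak_gradient \<Omega> \<psi> (gradient \<psi>)"
      using has_weak_gradient_gradient[OF _ \<Omega>(1)] test_functionsE[OF \<psi>(1)] by metis
    then have "L \<psi> (gradient \<psi>) = 0"
      using \<phi> b by (simp add: has_weak_gradient_def L_def gradient_inner_Basis)
    moreover have "L v H - L \<psi> (gradient \<psi>) =
        (LINT x|?M. (v x - \<psi> x) * (gradient \<phi> x \<bullet> b) + ((H x - gradient \<psi> x) \<bullet> b) * \<phi> x)"
    proof -
      have l\<psi>: "locally_integrable \<Omega> \<psi>" "locally_integrable \<Omega> (gradient \<psi>)"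
        using weak by (auto simp: has_weak_gradient_def)
      show ?thesis unfolding L_def
        using int[OF loc(1)] int[OF l\<psi>(1)] int[OF locb[OF loc(2)]] int[OF locb[OF l\<psi>(2)]]
        by (simp add: left_diff_distrib inner_diff_left)
    qed
    ultimately have "\<bar>L v H\<bar> = \<bar>LINT x|?M. (v x - \<psi> x) * (gradient \<phi> x \<bullet> b) + ((H x - gradient \<psi> x) \<bullet> b) * \<phi> x\<bar>" by simp
    also have "\<dots> \<le> (LINT x|?M. C * (2 * d + c * (\<bar>v x - \<psi> x\<bar> powr p + norm (H x - gradient \<psi> x) powr p)))"
    proof (rule integral_abs_bound_integral)
      have l: "locally_integrable \<Omega> (\<lambda>x. v x - \<psi> x)" "locally_integrable \<Omega> (\<lambda>x. H x - gradient \<psi> x)"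
        using in_Lp_imp_locally_integrable[OF p \<Omega>(1)] Ld by auto
      show "integrable ?M (\<lambda>x. (v x - \<psi> x) * (gradient \<phi> x \<bullet> b) + ((H x - gradient \<psi> x) \<bullet> b) * \<phi> x)"
        using int(1)[OF l(1)] int(2)[OF locb[OF l(2)]] by (rule Bochner_Integration.integrable_add)
      show "integrable ?M (\<lambda>x. C * (2 * d + c * (\<bar>v x - \<psi> x\<bar> powr p + norm (H x - gradient \<psi> x) powr p)))"
        using Ld integrable_mult_right[OF int1, of d] by (intro integrable_mult_right Bochner_Integration.integrable_add)
          (auto simp: in_Lp_def)
      fix x
      have "\<bar>(v x - \<psi> x) * (gradient \<phi> x \<bullet> b)\<bar> \<le> (d + c * \<bar>v x - \<psi> x\<bar> powr p) * C"
        unfolding abs_mult using abs_le_add_powr[OF p d, of "v x - \<psi> x"] C(1,3) d c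
        by (intro mult_mono) (auto simp: c_def)
      moreover have "\<bar>(H x - gradient \<psi> x) \<bullet> b\<bar> \<le> norm (H x - gradient \<psi> x)"
        using b Basis_le_norm by blast
      then have "\<bar>(H x - gradient \<psi> x) \<bullet> b\<bar> \<le> d + c * norm (H x - gradient \<psi> x) powr p"
        using abs_le_add_powr[OF p d, of "norm (H x - gradient \<psi> x)"] by (simp add: c_def)
      then have "\<bar>((H x - gradient \<psi> x) \<bullet> b) * \<phi> x\<bar> \<le> (d + c * norm (H x - gradient \<psi> x) powr p) * C"
        unfolding abs_mult using C(1,2) d c by (intro mult_mono) auto
      ultimately show "\<bar>(v x - \<psi> x) * (gradient \<phi> x \<bullet> b) + ((H x - gradient \<psi> x) \<bullet> b) * \<phi> x\<bar>
          \<le> C * (2 * d + c * (\<bar>v x - \<psi> x\<bar> powr p + norm (H x - gradient \<psi> x) powr p))"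
        by (simp add: algebra_simps)
    qed
    also have "\<dots> = C * (2 * d * V + c * (LINT x|?M. \<bar>v x - \<psi> x\<bar> powr p + norm (H x - gradient \<psi> x) powr p))"
    proof -
      have "integrable ?M (\<lambda>x. \<bar>v x - \<psi> x\<bar> powr p + norm (H x - gradient \<psi> x) powr p)"
        using Ld by (auto simp: in_Lp_def)
      moreover have "integrable ?M (\<lambda>x. 2 * d)" using integrable_mult_right[OF int1, of "2 * d"] by simp
      moreover have "(LINT x|?M. 2 * d) = 2 * d * V"
        using integral_mult_right_zero[of ?M "2 * d" "\<lambda>_. 1"] unfolding V_def by (simp only: mult_1_right)
      ultimately show ?thesis by (simp only: integral_mult_right_zero Bochner_Integration.integral_add integrable_mult_right)
    qed
    also have "\<dots> \<le> C * (2 * d * V + c * e)" using \<psi>(2) C(1) c by (intro mult_left_mono add_left_mono) auto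
    also have "\<dots> \<le> \<epsilon> / 2 + \<epsilon> / 2"
    proof -
      have "C * (c * e) = \<epsilon> / 2" using C(1) c by (simp add: e_def)
      moreover have "C * (2 * d * V) \<le> C * (2 * d * (V + 1))" using C(1) d by (intro mult_left_mono) auto
      moreover have "C * (2 * d * (V + 1)) = \<epsilon> / 2" using C(1) V by (simp add: d_def)
      ultimately show ?thesis by (simp add: distrib_left)
    qed
    finally show ?thesis by simp
  qed
  have "\<bar>L v H\<bar> \<le> 0" by (rule field_le_epsilon) (use est in simp)
  then show "(LINT x|?M. v x * frechet_derivative \<phi> (at x) b) = - (LINT x|?M. (H x \<bullet> b) * \<phi> x)"
    using b by (simp add: L_def gradient_inner_Basis)
qed

section \<open>The scaling acting on Sobolev functions\<close>

context radial_scaling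
begin

definition push :: "('a::euclidean_space \<Rightarrow> real) \<Rightarrow> 'a \<Rightarrow> real" where
  "push u x = l powr (- ((p - 1) / p)) * u (S x)"

definition push_grad :: "('a::euclidean_space \<Rightarrow> 'a) \<Rightarrow> 'a \<Rightarrow> 'a" where
  "push_grad G x = l powr (- ((p - 1) / p)) *\<^sub>R DS x (G (S x))"

lemma DS_measurable:
  assumes "G \<in> borel_measurable (lebesgue_on (ball (0::'a::euclidean_space) R))" "n = DIM('a)"
  shows "(\<lambda>x. DS x (G (S x))) \<in> borel_measurable (lebesgue_on (ball 0 R))"
proof -
  let ?M = "lebesgue_on (ball (0::'a) R)"
  have [measurable]: "(\<lambda>x. G (S x)) \<in> borel_measurable ?M"
    by (rule measurable_compose[OF S_measurable_lebesgue[OF assms(2)] assms(1)])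
  have m: "f \<in> borel_measurable ?M" if "f \<in> borel_measurable borel" for f :: "'a \<Rightarrow> 'c::topological_space"
    using that by (intro measurable_restrict_space1 measurable_completion) simp
  have [measurable]: "(\<lambda>x::'a. dil (norm x)) \<in> borel_measurable ?M" "(\<lambda>x::'a. rad' (norm x) - dil (norm x)) \<in> borel_measurable ?M"
    "(\<lambda>x::'a. x /\<^sub>R norm x) \<in> borel_measurable ?M"
    unfolding rad'_def dil_def by (rule m, measurable)+
  show ?thesis unfolding DS_def by measurable
qed

lemma push_in_Lp:
  assumes n: "n = DIM('a)" and u: "in_Lp (ball (0::'a::euclidean_space) R) p u"
  shows "in_Lp (ball 0 R) p (push u)"
    and "(LINT x|lebesgue_on (ball 0 R). \<bar>push u x\<bar> powr p) \<le>
      l powr (1 - p) / jac_min DIM('a) * (LINT x|lebesgue_on (ball 0 R). \<bar>u x\<bar> powr p)"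
proof -
  let ?M = "lebesgue_on (ball (0::'a) R)"
  have "(- ((p - 1) / p)) * p = 1 - p" using p by simp
  then have eq: "\<bar>push u x\<bar> powr p = l powr (1 - p) * \<bar>u (S x)\<bar> powr p" for x
    by (simp add: push_def abs_mult powr_mult powr_powr)
  have u': "u \<in> borel_measurable ?M" "integrable ?M (\<lambda>x. \<bar>u x\<bar> powr p)" using u by (auto simp: in_Lp_def)
  have [measurable]: "(\<lambda>x. u (S x)) \<in> borel_measurable ?M"
    by (rule measurable_compose[OF S_measurable_lebesgue[OF n] u'(1)])
  note I = integral_S_le[OF n u'(2)]
  have "push u \<in> borel_measurable ?M" unfolding push_def[abs_def] by measurable
  then show "in_Lp (ball 0 R) p (push u)" unfolding in_Lp_def using I(1) by (simp add: eq)
  have "(LINT x|?M. \<bar>push u x\<bar> powr p) = l powr (1 - p) * (LINT x|?M. \<bar>u (S x)\<bar> powr p)" by (simp add: eq)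
  also have "\<dots> \<le> l powr (1 - p) * ((LINT x|?M. \<bar>u x\<bar> powr p) / jac_min DIM('a))"
    using I(2) by (intro mult_left_mono) auto
  finally show "(LINT x|?M. \<bar>push u x\<bar> powr p) \<le> l powr (1 - p) / jac_min DIM('a) * (LINT x|?M. \<bar>u x\<bar> powr p)"
    by simp
qed

lemma push_grad_in_Lp:
  assumes n: "n = DIM('a)" and G: "in_Lp (ball (0::'a::euclidean_space) R) p G"
  shows "in_Lp (ball 0 R) p (push_grad G)"
    and "(LINT x|lebesgue_on (ball 0 R). norm (push_grad G x) powr p) \<le>
      DS_max powr p * (l powr (1 - p) / jac_min DIM('a)) * (LINT x|lebesgue_on (ball 0 R). norm (G x) powr p)"
proof -
  let ?M = "lebesgue_on (ball (0::'a) R)"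
  have "(- ((p - 1) / p)) * p = 1 - p" using p by simp
  then have eq: "norm (push_grad G x) powr p = l powr (1 - p) * norm (DS x (G (S x))) powr p" for x
    by (simp add: push_grad_def powr_mult powr_powr)
  have le: "norm (push_grad G x) powr p \<le> DS_max powr p * l powr (1 - p) * norm (G (S x)) powr p" if "x \<in> space ?M" for x
  proof -
    have "norm (DS x (G (S x))) powr p \<le> (DS_max * norm (G (S x))) powr p"
      using norm_DS_le[of x] that p by (intro powr_mono2) auto
    also have "\<dots> = DS_max powr p * norm (G (S x)) powr p" using DS_max_nonneg by (simp add: powr_mult)
    finally show ?thesis unfolding eq by (simp add: mult_ac mult_left_mono)
  qed
  have G': "G \<in> borel_measurable ?M" "integrable ?M (\<lambda>x. norm (G x) powr p)" using G by (auto simp: in_Lp_def)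
  have [measurable]: "push_grad G \<in> borel_measurable ?M"
    unfolding push_grad_def[abs_def] using DS_measurable[OF G'(1) n] by measurable
  note I = integral_S_le[OF n G'(2)]
  have int: "integrable ?M (\<lambda>x. norm (push_grad G x) powr p)"
  proof (rule Bochner_Integration.integrable_bound)
    show "integrable ?M (\<lambda>x. DS_max powr p * l powr (1 - p) * norm (G (S x)) powr p)"
      using I(1) by (intro integrable_mult_right) simp
    show "AE x in ?M. norm (norm (push_grad G x) powr p) \<le> norm (DS_max powr p * l powr (1 - p) * norm (G (S x)) powr p)"
      using le by (intro AE_I2) (simp add: abs_mult)
  qed measurable
  then show "in_Lp (ball 0 R) p (push_grad G)" by (simp add: in_Lp_def)
  have "(LINT x|?M. norm (push_grad G x) powr p) \<le> (LINT x|?M. DS_max powr p * l powr (1 - p) * norm (G (S x)) powr p)"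
    using int I(1) le by (intro integral_mono) auto
  also have "\<dots> = DS_max powr p * l powr (1 - p) * (LINT x|?M. norm (G (S x)) powr p)" by simp
  also have "\<dots> \<le> DS_max powr p * l powr (1 - p) * ((LINT x|?M. norm (G x) powr p) / jac_min DIM('a))"
    using I(2) by (intro mult_left_mono) auto
  finally show "(LINT x|?M. norm (push_grad G x) powr p) \<le>
      DS_max powr p * (l powr (1 - p) / jac_min DIM('a)) * (LINT x|?M. norm (G x) powr p)" by simp
qed

text \<open>If \<psi> approximates u off the origin, its scaled version approximates the scaled u:
  the scaling acts linearly on the pair of function and gradient, and the p-th power of its error
  grows by at most a constant factor.\<close>

lemma push_sobolev:
  fixes u :: "'a::euclidean_space \<Rightarrow> real"
  assumes n: "n = DIM('a)" and G: "in_Lp (ball 0 R) p u" "in_Lp (ball 0 R) p G"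
    and appr: "\<And>e. e > 0 \<Longrightarrow> \<exists>\<psi>\<in>test_functions pball.
      (LINT x|lebesgue_on (ball 0 R). \<bar>u x - \<psi> x\<bar> powr p + norm (G x - gradient \<psi> x) powr p) < e"
  shows "has_weak_gradient (ball 0 R) (push u) (push_grad G)" "push u \<in> sobolev_W1_0 (ball 0 R) p"
proof -
  let ?M = "lebesgue_on (ball (0::'a) R)"
  have p1: "1 \<le> p" using p by simp
  have Lp: "in_Lp (ball 0 R) p (push u)" "in_Lp (ball 0 R) p (push_grad G)"
    using push_in_Lp[OF n G(1)] push_grad_in_Lp[OF n G(2)] by auto
  define c where "c = l powr (1 - p) / jac_min DIM('a)"
  define Q where "Q = (1 + DS_max powr p) * c"
  have c: "c > 0" using jac_min(2)[of "DIM('a)"] l by (simp add: c_def)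
  then have Q: "Q > 0" by (simp add: Q_def add_pos_nonneg)
  have appr': "\<exists>\<psi>\<in>test_functions (ball 0 R).
      (LINT x|?M. \<bar>push u x - \<psi> x\<bar> powr p + norm (push_grad G x - gradient \<psi> x) powr p) < e" if e: "e > 0" for e
  proof -
    have "e / Q > 0" using e Q by simp
    then obtain \<psi> where \<psi>: "\<psi> \<in> test_functions pball"
      "(LINT x|?M. \<bar>u x - \<psi> x\<bar> powr p + norm (G x - gradient \<psi> x) powr p) < e / Q" using appr by blast
    have \<psi>': "\<psi> \<in> test_functions (ball 0 R)" using \<psi>(1) test_functions_mono[of pball "ball 0 R"] by auto
    have sm: "smooth_on UNIV \<psi>" using test_functionsE[OF \<psi>(1)] by metis
    have L\<psi>: "in_Lp (ball 0 R) p \<psi>" "in_Lp (ball 0 R) p (gradient \<psi>)" using test_function_in_Lp[OF \<psi>'] p by auto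
    have Ld: "in_Lp (ball 0 R) p (\<lambda>x. u x - \<psi> x)" "in_Lp (ball 0 R) p (\<lambda>x. G x - gradient \<psi> x)"
      using in_Lp_diff[OF p1] G L\<psi> by blast+
    define D1 where "D1 = (LINT x|?M. \<bar>u x - \<psi> x\<bar> powr p)"
    define D2 where "D2 = (LINT x|?M. norm (G x - gradient \<psi> x) powr p)"
    have D: "0 \<le> D1" "0 \<le> D2" "D1 + D2 < e / Q"
      using \<psi>(2) Ld by (auto simp: D1_def D2_def in_Lp_def)
    \<comment> \<open>Scaling the error and taking the error of the scaled functions agree off the
      origin, where the classical chain rule holds for \<psi>.\<close>
    have eq: "AE x in ?M. \<bar>push u x - pull \<psi> x\<bar> powr p + norm (push_grad G x - gradient (pull \<psi>) x) powr p =
        \<bar>push (\<lambda>x. u x - \<psi> x) x\<bar> powr p + norm (push_grad (\<lambda>x. G x - gradient \<psi> x) x) powr p"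
      using AE_pball
    proof eventually_elim
      case (elim x)
      have "push u x - pull \<psi> x = push (\<lambda>x. u x - \<psi> x) x"
        using elim by (simp add: push_def pull_def right_diff_distrib)
      moreover have "push_grad G x - gradient (pull \<psi>) x = push_grad (\<lambda>x. G x - gradient \<psi> x) x"
        unfolding gradient_pull[OF sm elim] push_grad_def DS_diff by (simp add: scaleR_diff_right)
      ultimately show ?case by simp
    qed
    have Lp1: "in_Lp (ball 0 R) p (push (\<lambda>x. u x - \<psi> x))" "in_Lp (ball 0 R) p (push_grad (\<lambda>x. G x - gradient \<psi> x))"
      using push_in_Lp[OF n Ld(1)] push_grad_in_Lp[OF n Ld(2)] by auto
    have pt: "pull \<psi> \<in> test_functions (ball 0 R)"
      using pull_test_function[OF \<psi>(1)] test_functions_mono[of pball "ball 0 R"] by auto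
    have Lp2: "in_Lp (ball 0 R) p (pull \<psi>)" "in_Lp (ball 0 R) p (gradient (pull \<psi>))"
      using test_function_in_Lp[OF pt] p by auto
    have "(LINT x|?M. \<bar>push u x - pull \<psi> x\<bar> powr p + norm (push_grad G x - gradient (pull \<psi>) x) powr p) =
      (LINT x|?M. \<bar>push (\<lambda>x. u x - \<psi> x) x\<bar> powr p + norm (push_grad (\<lambda>x. G x - gradient \<psi> x) x) powr p)"
    proof (rule integral_cong_AE[OF _ _ eq])
      have "integrable ?M (\<lambda>x. \<bar>push u x - pull \<psi> x\<bar> powr p + norm (push_grad G x - gradient (pull \<psi>) x) powr p)"
        using in_Lp_diff[OF p1 Lp(1) Lp2(1)] in_Lp_diff[OF p1 Lp(2) Lp2(2)] by (auto simp: in_Lp_def)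
      then show "(\<lambda>x. \<bar>push u x - pull \<psi> x\<bar> powr p + norm (push_grad G x - gradient (pull \<psi>) x) powr p) \<in> borel_measurable ?M"
        by (rule borel_measurable_integrable)
      have "integrable ?M (\<lambda>x. \<bar>push (\<lambda>x. u x - \<psi> x) x\<bar> powr p + norm (push_grad (\<lambda>x. G x - gradient \<psi> x) x) powr p)"
        using Lp1 by (auto simp: in_Lp_def)
      then show "(\<lambda>x. \<bar>push (\<lambda>x. u x - \<psi> x) x\<bar> powr p + norm (push_grad (\<lambda>x. G x - gradient \<psi> x) x) powr p) \<in> borel_measurable ?M"
        by (rule borel_measurable_integrable)
    qed
    also have "\<dots> = (LINT x|?M. \<bar>push (\<lambda>x. u x - \<psi> x) x\<bar> powr p) + (LINT x|?M. norm (push_grad (\<lambda>x. G x - gradient \<psi> x) x) powr p)"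
      using Lp1 by (intro Bochner_Integration.integral_add) (auto simp: in_Lp_def)
    also have "\<dots> \<le> c * D1 + DS_max powr p * c * D2"
      unfolding D1_def D2_def c_def by (intro add_mono push_in_Lp(2)[OF n Ld(1)] push_grad_in_Lp(2)[OF n Ld(2)])
    also have "\<dots> \<le> Q * D1 + Q * D2"
      using D c by (intro add_mono mult_right_mono) (auto simp: Q_def distrib_right)
    also have "\<dots> = Q * (D1 + D2)" by (simp add: distrib_left)
    also have "\<dots> < Q * (e / Q)" using D(3) Q by (rule mult_strict_left_mono)
    also have "\<dots> = e" using Q by simp
    finally show ?thesis using pt by blast
  qed
  show wg: "has_weak_gradient (ball 0 R) (push u) (push_grad G)"
    by (rule has_weak_gradient_limit[OF open_ball bounded_ball p1 Lp appr'])
  show "push u \<in> sobolev_W1_0 (ball 0 R) p"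
    using sobolev_W1_0_iff[OF open_ball p1, where u="push u"] wg Lp appr' by blast
qed

text \<open>The coincidence behind the invariance: of the p factors \<open>rad'\<close>, one is the
  radial part of the Jacobian, and the other p - 1 give l^(p-1) times \<open>dil\<close> to the
  power (1 + a)(p - 1) = n - 1, the tangential part.\<close>

lemma rad'_powr: "norm (x::'a::euclidean_space) \<le> R \<Longrightarrow> n = DIM('a) \<Longrightarrow> l powr (1 - p) * rad' (norm x) powr p = jac x"
proof -
  assume x: "norm x \<le> R" and n: "n = DIM('a)"
  let ?d = "dil (norm x)"
  have d: "0 < ?d" "0 < rad' (norm x)" using dil_bounds(3)[of "norm x"] rad'_pos[of "norm x"] x by auto
  have "rad' (norm x) powr (p - 1) = l powr (p - 1) * ?d powr ((1 + a) * (p - 1))"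
    unfolding rad'_def using l d by (simp add: powr_mult powr_powr)
  also have "(1 + a) * (p - 1) = real (DIM('a) - 1)"
    using sobolev_exp_eqs(1)[OF p pn] n by (simp add: of_nat_diff DIM_positive Suc_leI)
  also have "?d powr real (DIM('a) - 1) = ?d ^ (DIM('a) - 1)" by (rule powr_realpow[OF d(1)])
  finally have 1: "rad' (norm x) powr (p - 1) = l powr (p - 1) * ?d ^ (DIM('a) - 1)" .
  have "rad' (norm x) powr p = rad' (norm x) powr (p - 1) * rad' (norm x)" using d by (simp add: powr_diff)
  moreover have "l powr (1 - p) * l powr (p - 1) = 1" using l by (simp flip: powr_add)
  ultimately show ?thesis unfolding jac_def 1 by simp
qed

text \<open>Multiplying t by l shifts ln t by a constant, so the p-th root |d ln t / dr| of the
  weight changes by the chain rule factor \<open>rad'\<close> alone; \<open>rad'_powr\<close>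
  evaluates the p-th power of this factor.\<close>

lemma hardy_weight_S:
  fixes x :: "'a::euclidean_space"
  assumes n: "n = DIM('a)" and x: "x \<in> pball"
  shows "l powr (1 - p) * hardy_weight p R x = hardy_weight p R (S x) * jac x"
proof -
  have x': "x \<noteq> 0" "norm x < R" "0 < norm x" "norm x \<le> R" using x by auto
  have Sx: "S x \<noteq> 0" "norm (S x) < R" using S_pball[OF x] by auto
  have pn': "p < DIM('a)" using pn n by simp
  let ?d = "dil (norm x)" and ?r = "norm x" and ?t = "radial_time p n R (norm x)"
  have d: "0 < ?d" "0 < rad' ?r" using dil_bounds(3)[of ?r] rad'_pos[of ?r] x' by auto
  have t: "0 < ?t" using radial_time_pos[OF p pn x'(3,2)] .
  have "hardy_weight p R (S x) = (a * (?r * ?d) powr (- 1 - a) / (l * ?t)) powr p"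
    unfolding hardy_weight_eq[OF p pn' Sx, folded n] norm_S[OF x'(4)] radial_time_rad[OF x'(3,4)]
    by (simp add: rad_def)
  also have "a * (?r * ?d) powr (- 1 - a) / (l * ?t) = (a * ?r powr (- 1 - a) / ?t) * (?d powr (- 1 - a) / l)"
    using d x' by (simp add: powr_mult mult_ac)
  also have "?d powr (- 1 - a) / l = 1 / rad' ?r"
    using powr_minus_divide[of ?d "1 + a"] by (simp add: rad'_def)
  also have "((a * ?r powr (- 1 - a) / ?t) * (1 / rad' ?r)) powr p = (a * ?r powr (- 1 - a) / ?t) powr p * (1 / rad' ?r powr p)"
    using a t d by (simp add: powr_mult powr_divide)
  also have "(a * ?r powr (- 1 - a) / ?t) powr p = hardy_weight p R x"
    using hardy_weight_eq[OF p pn' x'(1,2)] n by simp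
  finally show ?thesis unfolding rad'_powr[OF x'(4) n, symmetric] using d by simp
qed

theorem hardy_lhs_push:
  fixes u :: "real ^ 'n \<Rightarrow> real"
  assumes n: "n = CARD('n)" and u: "u \<in> borel_measurable (lebesgue_on (ball 0 R))"
  shows "hardy_lhs p R (push u) = hardy_lhs p R u"
proof -
  let ?M = "lebesgue_on (ball (0::real^'n) R)"
  have n': "n = DIM(real^'n)" using n by simp
  have e: "(- ((p - 1) / p)) * p = 1 - p" using p by simp
  have W: "(hardy_weight p R :: real^'n \<Rightarrow> real) \<in> borel_measurable ?M"
    by (intro measurable_restrict_space1 measurable_completion) measurable
  have "hardy_lhs p R (push u) = (\<integral>\<^sup>+x. ennreal (hardy_weight p R (S x) * \<bar>u (S x)\<bar> powr p) * ennreal (jac x) \<partial>?M)"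
    unfolding hardy_lhs_eq
  proof (rule nn_integral_cong_AE, use AE_pball in eventually_elim)
    fix x :: "real^'n" assume x: "x \<in> pball"
    have "\<bar>push u x\<bar> powr p = l powr (1 - p) * \<bar>u (S x)\<bar> powr p"
      using e by (simp add: push_def abs_mult powr_mult powr_powr)
    then have "hardy_weight p R x * \<bar>push u x\<bar> powr p = (hardy_weight p R (S x) * \<bar>u (S x)\<bar> powr p) * jac x"
      using hardy_weight_S[OF n' x] by (simp add: mult_ac)
    then show "ennreal (hardy_weight p R x * \<bar>push u x\<bar> powr p) = ennreal (hardy_weight p R (S x) * \<bar>u (S x)\<bar> powr p) * ennreal (jac x)"
      using jac_pos[of x] x by (simp add: ennreal_mult'' less_imp_le)
  qed
  also have "\<dots> = hardy_lhs p R u" unfolding hardy_lhs_eq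
    by (rule nn_integral_S[OF n']) (use u W in measurable)
  finally show ?thesis .
qed

text \<open>By \<open>inner_DS_radial\<close> the radial component of the gradient is multiplied by
  exactly \<open>rad'\<close>, and \<open>S\<close> keeps directions fixed; the prefactor l^(1-p)
  and \<open>rad'_powr\<close> then produce the Jacobian.\<close>

theorem hardy_rhs_push:
  fixes u :: "real ^ 'n \<Rightarrow> real"
  assumes n: "n = CARD('n)" and G: "has_weak_gradient (ball 0 R) u G" "G \<in> borel_measurable (lebesgue_on (ball 0 R))"
    and wg: "has_weak_gradient (ball 0 R) (push u) (push_grad G)"
  shows "hardy_rhs p R (push u) = hardy_rhs p R u"
proof -
  let ?M = "lebesgue_on (ball (0::real^'n) R)"
  have n': "n = DIM(real^'n)" using n by simp
  have e: "(- ((p - 1) / p)) * p = 1 - p" using p by simp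
  have "hardy_rhs p R (push u) = (\<integral>\<^sup>+x. ennreal (\<bar>(S x /\<^sub>R norm (S x)) \<bullet> G (S x)\<bar> powr p) * ennreal (jac x) \<partial>?M)"
    unfolding hardy_rhs_eq[OF wg]
  proof (rule nn_integral_cong_AE, use AE_pball in eventually_elim)
    fix x :: "real^'n" assume x: "x \<in> pball"
    then have x': "x \<noteq> 0" "norm x \<le> R" by auto
    have "(x /\<^sub>R norm x) \<bullet> push_grad G x = l powr (- ((p - 1) / p)) * (rad' (norm x) * ((x /\<^sub>R norm x) \<bullet> G (S x)))"
      unfolding push_grad_def inner_scaleR_right inner_DS_radial[OF x'(1)] ..
    then have "\<bar>(x /\<^sub>R norm x) \<bullet> push_grad G x\<bar> powr p = l powr (1 - p) * rad' (norm x) powr p * \<bar>(x /\<^sub>R norm x) \<bullet> G (S x)\<bar> powr p"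
      using e rad'_pos[of "norm x"] x' by (simp only: abs_mult powr_mult powr_powr abs_ge_zero) (simp add: powr_powr)
    also have "\<dots> = \<bar>(S x /\<^sub>R norm (S x)) \<bullet> G (S x)\<bar> powr p * jac x"
      unfolding rad'_powr[OF x'(2) n'] S_sgn[OF x] by (rule mult.commute)
    finally show "ennreal (\<bar>(x /\<^sub>R norm x) \<bullet> push_grad G x\<bar> powr p) =
        ennreal (\<bar>(S x /\<^sub>R norm (S x)) \<bullet> G (S x)\<bar> powr p) * ennreal (jac x)"
      by (simp only: ennreal_mult' powr_ge_zero)
  qed
  also have "\<dots> = hardy_rhs p R u" unfolding hardy_rhs_eq[OF G(1)]
  proof (rule nn_integral_S[OF n'])
    have "(\<lambda>x::real^'n. x /\<^sub>R norm x) \<in> borel_measurable ?M"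
      by (intro measurable_restrict_space1 measurable_completion) measurable
    then show "(\<lambda>x. ennreal (\<bar>(x /\<^sub>R norm x) \<bullet> G x\<bar> powr p)) \<in> borel_measurable ?M" using G(2) by measurable
  qed
  finally show ?thesis .
qed

lemma push_eq_scaled_fun:
  fixes u :: "real ^ 'n \<Rightarrow> real"
  assumes n: "n = CARD('n)" and x: "x \<in> ball 0 R"
  shows "scaled_fun p R l u x = push u x"
proof -
  have "scaled_point p R l x = S x"
  proof (cases "x = 0")
    case False
    then have x': "0 < norm x" "norm x \<le> R" using x by auto
    have "1 / a = (p - 1) / (n - p)" by (simp add: sobolev_exp_def)
    then have "scaled_point p R l x = rad (norm x) *\<^sub>R (x /\<^sub>R norm x)"
      unfolding scaled_point_def rad_eq[OF x'] n[symmetric] by (simp add: sobolev_exp_def)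
    also have "\<dots> = S x" using x' by (simp add: rad_def S_def)
    finally show ?thesis .
  qed (simp add: scaled_point_def S_def)
  then show ?thesis by (simp add: scaled_fun_def push_def)
qed

end

section \<open>Optimality\<close>

text \<open>Two opposite steps: 1 on [-1, 1] and 0 outside (-2, 2). It serves as the cutoff on the
  logarithmic scale.\<close>

definition plateau :: "real \<Rightarrow> real" where
  "plateau s = smooth_step (s + 2) * smooth_step (2 - s)"

lemma smooth_on_plateau: "smooth_on UNIV plateau"
proof -
  have id: "smooth_on UNIV (\<lambda>s::real. s)" using smooth_on_inner[of UNIV "1::real"] by simp
  have "smooth_on UNIV (\<lambda>s::real. s + 2)" "smooth_on UNIV (\<lambda>s::real. 2 - s)"
    by (rule smooth_on_add[OF open_UNIV id smooth_on_const[OF open_UNIV]],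
        rule smooth_on_diff[OF open_UNIV smooth_on_const[OF open_UNIV] id])
  from this[THEN smooth_on_compose_real[OF open_UNIV open_UNIV smooth_on_smooth_step]]
  have "smooth_on UNIV (\<lambda>s. smooth_step (s + 2))" "smooth_on UNIV (\<lambda>s. smooth_step (2 - s))"
    by simp_all
  then show ?thesis unfolding plateau_def[abs_def] by (intro smooth_on_mult) auto
qed

lemma plateau_simps:
  "\<bar>s\<bar> \<le> 1 \<Longrightarrow> plateau s = 1" "2 \<le> \<bar>s\<bar> \<Longrightarrow> plateau s = 0" "0 \<le> plateau s"
  by (auto simp: plateau_def smooth_step_simps abs_le_iff abs_if split: if_splits)

lemma plateau_deriv_bound:
  obtains E where "0 \<le> E" "\<And>s. \<bar>gradient plateau s\<bar> \<le> E" "\<And>s. 2 < \<bar>s\<bar> \<Longrightarrow> gradient plateau s = 0"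
proof -
  have "continuous_on UNIV (gradient plateau)" by (rule continuous_on_gradient[OF smooth_on_plateau])
  then have "bounded (gradient plateau ` {-2..2})"
    by (intro compact_imp_bounded compact_continuous_image) (auto intro: continuous_on_subset)
  then obtain M where M: "\<And>y. y \<in> gradient plateau ` {-2..2} \<Longrightarrow> \<bar>y\<bar> \<le> M" unfolding bounded_real by blast
  have zero: "gradient plateau s = 0" if "2 < \<bar>s\<bar>" for s
  proof (rule gradient_eq_0_outside[of "{-2..2}"])
    show "plateau x = 0" if "x \<notin> {-2..2}" for x using that by (intro plateau_simps(2)) auto
  qed (use that in auto)
  have M0: "0 \<le> M" using M[of "gradient plateau 0"] by auto
  have "\<bar>gradient plateau s\<bar> \<le> M" for s
    using M[of "gradient plateau s"] zero[of s] M0 by (cases "s \<in> {-2..2}") (auto simp: abs_if not_le)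
  then show ?thesis using that M0 zero by blast
qed

locale hardy_optimality =
  fixes p n R :: real
  assumes p: "1 < p" and pn: "p < n" and R: "0 < R"
begin

abbreviation "a \<equiv> sobolev_exp p n"
abbreviation pball :: "'a::euclidean_space set" where "pball \<equiv> ball 0 R - {0}"

definition time :: "'a::euclidean_space \<Rightarrow> real" where "time x = radial_time p n R (norm x)"

text \<open>In the time variable the virtual extremal is \<open>t powr ((p - 1) / p)\<close>;
  it is cut off at \<open>\<bar>ln t\<bar> = 2 * k\<close>.\<close>

definition extremal :: "real \<Rightarrow> 'a::euclidean_space \<Rightarrow> real" where
  "extremal k x = (if x \<in> pball then time x powr ((p - 1) / p) * plateau (ln (time x) / k) else 0)"

text \<open>In polar coordinates this density is a^(p-1) dt / t times the surface measure of the
  unit sphere, hence uniform in ln t.\<close>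

definition log_weight :: "'a::euclidean_space \<Rightarrow> real" where
  "log_weight x = hardy_weight p R x * time x powr (p - 1)"

lemma a: "0 < a" using sobolev_exp_pos[OF p pn] .

lemma time_pos: "x \<in> pball \<Longrightarrow> 0 < time x"
  using radial_time_pos[OF p pn, of "norm x" R] by (auto simp: time_def)

lemma time_has_derivative:
  assumes "x \<in> pball"
  shows "(time has_derivative (\<lambda>v. ((- a * norm x powr (- a - 2)) *\<^sub>R x) \<bullet> v)) (at x)"
  unfolding time_def[abs_def] radial_time_def
  by (rule has_derivative_eq_rhs, rule has_derivative_diff[OF has_derivative_norm_powr has_derivative_const])
     (use assms in auto)

lemma smooth_on_time: "smooth_on pball time"
  unfolding time_def[abs_def] radial_time_def
  by (intro smooth_on_diff smooth_on_const smooth_on_subset[OF smooth_on_norm_powr]) (auto simp: open_delete)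

lemma extremal_test_function:
  assumes k: "0 < k"
  shows "extremal k \<in> test_functions pball"
proof -
  have o: "open (pball :: 'a set)" by (simp add: open_delete)
  \<comment> \<open>The radii at which the time equals exp (2 k) and exp (-2 k); larger times lie
    closer to the origin.\<close>
  define \<rho>1 where "\<rho>1 = (exp (2 * k) + R powr (- a)) powr (- (1 / a))"
  define \<rho>2 where "\<rho>2 = (exp (- 2 * k) + R powr (- a)) powr (- (1 / a))"
  have \<rho>: "0 < \<rho>1" "\<rho>2 < R"
  proof -
    have "0 < exp (2 * k) + R powr (- a)" by (rule add_pos_nonneg) auto
    then show "0 < \<rho>1" by (simp add: \<rho>1_def)
    have "\<rho>2 < (R powr (- a)) powr (- (1 / a))"
      unfolding \<rho>2_def using R a by (intro powr_less_mono2_neg) auto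
    then show "\<rho>2 < R" using a R by (simp add: powr_powr)
  qed
  define K where "K = cball (0::'a) \<rho>2 - ball 0 \<rho>1"
  have K: "compact K" "K \<subseteq> pball" using \<rho> by (auto simp: K_def compact_diff)
  have zero: "extremal k x = 0" if "x \<notin> K" for x
  proof (rule ccontr)
    assume nz: "extremal k x \<noteq> 0"
    then have x: "x \<in> pball" by (auto simp: extremal_def split: if_splits)
    then have x': "0 < norm x" by auto
    have "plateau (ln (time x) / k) \<noteq> 0" using nz x by (auto simp: extremal_def)
    then have "\<bar>ln (time x) / k\<bar> < 2" using plateau_simps(2) not_le by blast
    then have "ln (time x) < 2 * k" "- 2 * k < ln (time x)" using k by (auto simp: abs_less_iff field_simps)
    then have "exp (ln (time x)) < exp (2 * k)" "exp (- 2 * k) < exp (ln (time x))" by (simp_all only: exp_less_cancel_iff)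
    then have t: "time x < exp (2 * k)" "exp (- 2 * k) < time x" using time_pos[OF x] by auto
    have "norm x powr (- a) = time x + R powr (- a)" by (simp add: time_def radial_time_def)
    then have "(time x + R powr (- a)) powr (- (1 / a)) = (norm x powr (- a)) powr (- (1 / a))" by simp
    also have "\<dots> = norm x" using a x' by (simp add: powr_powr)
    finally have nx: "norm x = (time x + R powr (- a)) powr (- (1 / a))" by simp
    have "0 < time x" by (rule time_pos[OF x])
    then have "\<rho>1 \<le> norm x" "norm x \<le> \<rho>2" unfolding nx \<rho>1_def \<rho>2_def
      using t a R by (auto intro!: powr_mono2' add_pos_pos)
    then show False using that by (simp add: K_def)
  qed
  have "smooth_on pball (\<lambda>x::'a. time x powr ((p - 1) / p) * plateau (ln (time x) * (1 / k)))"
  proof (rule smooth_on_mult[OF o])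
    show "smooth_on pball (\<lambda>x::'a. time x powr ((p - 1) / p))"
      by (rule smooth_on_compose_real[OF o _ smooth_on_powr smooth_on_time]) (auto intro!: time_pos)
    have "smooth_on pball (\<lambda>x::'a. ln (time x))"
      by (rule smooth_on_compose_real[OF o _ smooth_on_ln smooth_on_time]) (auto intro!: time_pos)
    then have "smooth_on pball (\<lambda>x::'a. ln (time x) * (1 / k))" by (intro smooth_on_mult smooth_on_const o)
    then show "smooth_on pball (\<lambda>x::'a. plateau (ln (time x) * (1 / k)))"
      by (rule smooth_on_compose_real[OF o open_UNIV smooth_on_plateau]) auto
  qed
  then have "smooth_on pball (extremal k :: 'a \<Rightarrow> real)"
    by (rule smooth_on_cong[OF o, rotated]) (simp add: extremal_def)
  moreover have "smooth_on (- K) (extremal k)"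
    by (rule smooth_on_cong[OF _ _ smooth_on_const[where c=0]])
       (use K(1) zero in \<open>auto simp: compact_imp_closed open_Compl\<close>)
  ultimately have "smooth_on (pball \<union> - K) (extremal k)"
    by (intro smooth_on_Un o) (use K(1) in \<open>auto simp: compact_imp_closed open_Compl\<close>)
  moreover have "pball \<union> - K = UNIV" using K(2) by auto
  ultimately show ?thesis using test_functionsI[OF _ K zero] by simp
qed

section \<open>Both sides of the inequality for the truncated extremals\<close>

lemma log_weight_nonneg: "0 \<le> log_weight x"
  by (simp add: log_weight_def hardy_weight_nonneg)

lemma hardy_weight_extremal:
  assumes "x \<in> pball"
  shows "hardy_weight p R x * \<bar>extremal k x\<bar> powr p = log_weight x * plateau (ln (time x) / k) powr p"
proof -
  have "\<bar>extremal k x\<bar> powr p = (time x powr ((p - 1) / p)) powr p * plateau (ln (time x) / k) powr p"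
    using assms plateau_simps(3)[of "ln (time x) / k"] by (simp add: extremal_def abs_mult powr_mult)
  also have "(time x powr ((p - 1) / p)) powr p = time x powr (p - 1)" using p by (simp add: powr_powr)
  finally show ?thesis by (simp add: log_weight_def)
qed

lemma hardy_weight_time:
  fixes x :: "'a::euclidean_space"
  assumes n: "n = DIM('a)" and x: "x \<in> pball"
  shows "hardy_weight p R x = (a * norm x powr (- 1 - a)) powr p * time x powr (- p)"
proof -
  have "p < DIM('a)" "x \<noteq> 0" "norm x < R" using pn n x by auto
  from hardy_weight_eq[OF p this, folded n]
  have "hardy_weight p R x = (a * norm x powr (- 1 - a) / time x) powr p" unfolding time_def .
  then show ?thesis using a time_pos[OF x] by (simp add: powr_divide powr_minus_divide)
qed

text \<open>With c = (p - 1) / p, the derivative of t^c times the cutoff in t is t^(c-1) times the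
  last bracket, and (c - 1) p = -1 turns its p-th power into \<open>log_weight\<close>. The cutoff
  on the logarithmic scale costs only a summand of order 1 / k.\<close>

lemma radial_derivative_extremal:
  fixes x :: "'a::euclidean_space"
  assumes n: "n = DIM('a)" and k: "0 < k" and x: "x \<in> pball"
  defines "s \<equiv> ln (time x) / k"
  shows "\<bar>(x /\<^sub>R norm x) \<bullet> gradient (extremal k) x\<bar> powr p =
    log_weight x * \<bar>(p - 1) / p * plateau s + gradient plateau s / k\<bar> powr p"
proof -
  have x': "x \<noteq> 0" "0 < norm x" "norm x < R" using x by auto
  have t: "0 < time x" by (rule time_pos[OF x])
  define c where "c = (p - 1) / p"
  define d where "d = time x powr (c - 1) * (c * plateau s + gradient plateau s / k)"
  have "((\<lambda>t. plateau (ln t / k)) has_real_derivative gradient plateau s * (1 / time x / k)) (at (time x))"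
    unfolding s_def
    by (rule DERIV_chain2[OF smooth_on_real_derivative[OF smooth_on_plateau]])
       (use t k in \<open>auto intro!: derivative_eq_intros\<close>)
  moreover have "((\<lambda>t. t powr c) has_real_derivative c * time x powr (c - 1)) (at (time x))"
    using t by (intro has_real_derivative_powr) auto
  ultimately have "((\<lambda>t. t powr c * plateau (ln t / k)) has_real_derivative d) (at (time x))"
    by (rule DERIV_cong[OF DERIV_mult[rotated]])
       (use t in \<open>simp add: d_def s_def powr_diff field_simps\<close>)
  from has_derivative_compose_inner[OF time_has_derivative[OF x] this]
  have "(extremal k has_derivative (\<lambda>v. (d *\<^sub>R ((- a * norm x powr (- a - 2)) *\<^sub>R x)) \<bullet> v)) (at x)"
    by (rule has_derivative_transform_within_open[where s=pball])
       (use x in \<open>auto simp: extremal_def c_def open_delete\<close>)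
  then have g: "gradient (extremal k) x = d *\<^sub>R ((- a * norm x powr (- a - 2)) *\<^sub>R x)" by (rule gradient_unique)
  have "(x /\<^sub>R norm x) \<bullet> gradient (extremal k) x = - (d * (a * (norm x powr (- a - 2) * norm x)))"
    unfolding g using x' by (simp add: dot_square_norm power2_eq_square field_simps)
  also have "norm x powr (- a - 2) * norm x = norm x powr (- 1 - a)"
  proof -
    have "norm x powr (- a - 2) * norm x powr 1 = norm x powr (- a - 2 + 1)" by (rule powr_add[symmetric])
    also have "- a - 2 + 1 = - 1 - a" by simp
    finally show ?thesis using x' by simp
  qed
  finally have "\<bar>(x /\<^sub>R norm x) \<bullet> gradient (extremal k) x\<bar> = \<bar>c * plateau s + gradient plateau s / k\<bar> *
      (time x powr (c - 1) * (a * norm x powr (- 1 - a)))"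
    using a by (simp add: abs_mult d_def)
  then have "\<bar>(x /\<^sub>R norm x) \<bullet> gradient (extremal k) x\<bar> powr p = \<bar>c * plateau s + gradient plateau s / k\<bar> powr p *
      ((time x powr (c - 1)) powr p * (a * norm x powr (- 1 - a)) powr p)"
    using a by (simp add: powr_mult)
  also have "(time x powr (c - 1)) powr p * (a * norm x powr (- 1 - a)) powr p = log_weight x"
  proof -
    have "(c - 1) * p = - 1" using p by (simp add: c_def field_simps)
    then have "(time x powr (c - 1)) powr p = time x powr (- 1)" by (simp add: powr_powr)
    also have "time x powr (- 1) = time x powr (- p) * time x powr (p - 1)" by (simp flip: powr_add)
    finally have 1: "(time x powr (c - 1)) powr p = time x powr (- p) * time x powr (p - 1)" .
    show ?thesis unfolding 1 log_weight_def hardy_weight_time[OF n x] by (simp only: mult_ac)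
  qed
  finally show ?thesis by (simp add: c_def mult.commute)
qed

text \<open>The type argument fixes the space, which k alone does not. The quantity is handled
  through its doubling property and its positivity.\<close>

definition log_mass :: "'a::euclidean_space itself \<Rightarrow> real \<Rightarrow> ennreal" where
  "log_mass _ k = (\<integral>\<^sup>+x. ennreal (log_weight x * indicator {x. \<bar>ln (time x)\<bar> \<le> k} x) \<partial>lebesgue_on (ball (0::'a) R))"

lemma time_measurable [measurable]: "time \<in> borel_measurable borel"
  unfolding time_def[abs_def] radial_time_def by measurable

lemma log_weight_measurable [measurable]: "log_weight \<in> borel_measurable borel"
  unfolding log_weight_def[abs_def] by measurable

text \<open>The scaling with l = exp h shifts ln t by h, and it preserves the measure with density
  \<open>log_weight\<close>: the powers of l from weight and time cancel.\<close>

lemma log_mass_shift: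
  assumes n: "n = DIM('a::euclidean_space)"
  shows "(\<integral>\<^sup>+x. ennreal (log_weight x * indicator {x. \<bar>ln (time x) + h\<bar> \<le> k} x) \<partial>lebesgue_on (ball (0::'a) R)) = log_mass TYPE('a) k"
proof -
  interpret rs: radial_scaling p n R "exp h" using p pn R by unfold_locales auto
  let ?M = "lebesgue_on (ball (0::'a) R)"
  have "(\<integral>\<^sup>+x. ennreal (log_weight x * indicator {x. \<bar>ln (time x) + h\<bar> \<le> k} x) \<partial>?M) =
      (\<integral>\<^sup>+x. ennreal (log_weight (rs.S x) * indicator {x. \<bar>ln (time x)\<bar> \<le> k} (rs.S x)) * ennreal (rs.jac x) \<partial>?M)"
  proof (rule nn_integral_cong_AE, use rs.AE_pball in eventually_elim)
    fix x :: 'a assume x: "x \<in> pball"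
    then have x': "0 < norm x" "norm x \<le> R" by auto
    have t: "time (rs.S x) = exp h * time x"
      using rs.norm_S[OF x'(2)] rs.radial_time_rad[OF x'] by (simp add: time_def)
    have "ln (time (rs.S x)) = ln (time x) + h" unfolding t using time_pos[OF x] by (simp add: ln_mult)
    then have ind: "indicator {x. \<bar>ln (time x)\<bar> \<le> k} (rs.S x) = (indicator {x. \<bar>ln (time x) + h\<bar> \<le> k} x :: real)"
      by (simp add: indicator_def)
    have "exp h powr (1 - p) * exp h powr (p - 1) = 1" by (simp flip: powr_add)
    then have "log_weight (rs.S x) * rs.jac x = log_weight x"
      using rs.hardy_weight_S[OF n x] time_pos[OF x] unfolding log_weight_def t
      by (simp add: powr_mult) (metis (no_types, lifting) mult.assoc mult.commute mult.left_commute mult_1)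
    then have "(log_weight (rs.S x) * indicator {x. \<bar>ln (time x)\<bar> \<le> k} (rs.S x)) * rs.jac x =
        log_weight x * indicator {x. \<bar>ln (time x) + h\<bar> \<le> k} x"
      unfolding ind by (simp add: mult_ac)
    then show "ennreal (log_weight x * indicator {x. \<bar>ln (time x) + h\<bar> \<le> k} x) =
        ennreal (log_weight (rs.S x) * indicator {x. \<bar>ln (time x)\<bar> \<le> k} (rs.S x)) * ennreal (rs.jac x)"
      using rs.jac_pos[OF x'(2)] by (metis ennreal_mult'' less_imp_le)
  qed
  also have "\<dots> = log_mass TYPE('a) k" unfolding log_mass_def
  proof (rule rs.nn_integral_S[OF n])
    show "(\<lambda>x::'a. ennreal (log_weight x * indicator {x. \<bar>ln (time x)\<bar> \<le> k} x)) \<in> borel_measurable ?M"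
      by (intro measurable_restrict_space1 measurable_completion) measurable
  qed
  finally show ?thesis .
qed

text \<open>The interval [-2k, 2k] of ln t is covered by two translates of [-k, k], which have equal
  mass by shift invariance.\<close>

lemma log_mass_double:
  assumes n: "n = DIM('a::euclidean_space)" and k: "0 \<le> k"
  shows "log_mass TYPE('a) (2 * k) \<le> 2 * log_mass TYPE('a) k"
proof -
  let ?M = "lebesgue_on (ball (0::'a) R)"
  let ?f = "\<lambda>h x::'a. ennreal (log_weight x * indicator {x. \<bar>ln (time x) + h\<bar> \<le> k} x)"
  have m: "?f h \<in> borel_measurable ?M" for h
    by (intro measurable_restrict_space1 measurable_completion) measurable
  have "log_mass TYPE('a) (2 * k) \<le> (\<integral>\<^sup>+x. ?f k x + ?f (- k) x \<partial>?M)"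
    unfolding log_mass_def
  proof (rule nn_integral_mono)
    fix x :: 'a
    show "ennreal (log_weight x * indicator {x. \<bar>ln (time x)\<bar> \<le> 2 * k} x) \<le> ?f k x + ?f (- k) x"
    proof (cases "\<bar>ln (time x)\<bar> \<le> 2 * k")
      case True
      then have "ennreal (log_weight x) = ?f k x \<or> ennreal (log_weight x) = ?f (- k) x"
        using k by (auto simp: indicator_def)
      moreover have "?f k x \<le> ?f k x + ?f (- k) x" "?f (- k) x \<le> ?f k x + ?f (- k) x"
        by (rule add_increasing2[OF zero_le order_refl], rule add_increasing[OF zero_le order_refl])
      ultimately have "ennreal (log_weight x) \<le> ?f k x + ?f (- k) x" by metis
      then show ?thesis using True by simp
    qed simp
  qed
  also have "\<dots> = log_mass TYPE('a) k + log_mass TYPE('a) k"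
    unfolding nn_integral_add[OF m m] log_mass_shift[OF n] ..
  finally show ?thesis by (simp only: mult_2)
qed

text \<open>The integrand is positive on the open set where |ln t| < k, which contains the points of
  the sphere with time 1.\<close>

lemma log_mass_pos:
  assumes n: "n = DIM('a::euclidean_space)" and k: "0 < k"
  shows "0 < log_mass TYPE('a) k"
proof (rule ccontr)
  let ?M = "lebesgue_on (ball (0::'a) R)"
  assume "\<not> 0 < log_mass TYPE('a) k"
  then have "(\<integral>\<^sup>+x. ennreal (log_weight x * indicator {x. \<bar>ln (time x)\<bar> \<le> k} x) \<partial>?M) = 0"
    by (simp add: log_mass_def)
  moreover have "(\<lambda>x::'a. ennreal (log_weight x * indicator {x. \<bar>ln (time x)\<bar> \<le> k} x)) \<in> borel_measurable ?M"
    by (intro measurable_restrict_space1 measurable_completion) measurable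
  ultimately have AE: "AE x in ?M. ennreal (log_weight x * indicator {x. \<bar>ln (time x)\<bar> \<le> k} x) = 0"
    by (subst (asm) nn_integral_0_iff_AE)
  define U :: "'a set" where "U = pball \<inter> time -` {exp (- k) <..< exp k}"
  have "open U" unfolding U_def
    by (intro continuous_open_preimage[OF smooth_on_continuous[OF smooth_on_time]]) (auto simp: open_delete)
  have "U \<noteq> {}"
  proof -
    obtain b :: 'a where b: "b \<in> Basis" using nonempty_Basis by blast
    \<comment> \<open>The radius with time 1.\<close>
    define r where "r = (1 + R powr (- a)) powr (- (1 / a))"
    have r0: "0 < 1 + R powr (- a)" by (rule add_pos_nonneg) auto
    then have r: "0 < r" by (simp add: r_def)
    have "r < (R powr (- a)) powr (- (1 / a))" unfolding r_def using R a by (intro powr_less_mono2_neg) auto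
    then have "r < R" using a R by (simp add: powr_powr)
    moreover have "time (r *\<^sub>R b) = 1"
      using r r0 b a by (simp add: time_def radial_time_def r_def powr_powr)
    ultimately have "r *\<^sub>R b \<in> U" using r b k by (auto simp: U_def)
    then show ?thesis by blast
  qed
  have "AE x in lebesgue. x \<notin> U"
  proof -
    have "AE x in lebesgue. x \<in> ball (0::'a) R \<longrightarrow> ennreal (log_weight x * indicator {x. \<bar>ln (time x)\<bar> \<le> k} x) = 0"
      using AE by (simp add: AE_restrict_space_iff)
    then show ?thesis
    proof eventually_elim
      case (elim x)
      show ?case
      proof
        assume x: "x \<in> U"
        then have xp: "x \<in> pball" and t: "exp (- k) < time x" "time x < exp k" by (auto simp: U_def)
        have t0: "0 < time x" by (rule time_pos[OF xp])
        have "- k < ln (time x)" "ln (time x) < k"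
          using t t0 exp_less_cancel_iff[of "- k" "ln (time x)"] exp_less_cancel_iff[of "ln (time x)" k] by simp_all
        then have "\<bar>ln (time x)\<bar> \<le> k" by linarith
        moreover have "0 < log_weight x"
          using xp t0 a by (auto simp: log_weight_def hardy_weight_time[OF n xp])
        ultimately show False using elim xp by (auto simp: ennreal_eq_0_iff)
      qed
    qed
  qed
  then have "U \<in> null_sets lebesgue" using \<open>open U\<close> by (subst completion.null_sets_iff_AE) auto
  then have "negligible U" by (simp add: negligible_iff_null_sets)
  then show False using open_not_negligible[OF \<open>open U\<close> \<open>U \<noteq> {}\<close>] by simp
qed

theorem hardy_constant_optimal:
  fixes C :: real
  assumes n: "n = CARD('n)"
    and C: "\<And>u :: real ^ 'n \<Rightarrow> real. u \<in> test_functions (ball 0 R - {0}) \<Longrightarrow> ennreal C * hardy_lhs p R u \<le> hardy_rhs p R u"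
  shows "C \<le> ((p - 1) / p) powr p"
proof -
  let ?M = "lebesgue_on (ball (0::real^'n) R)"
  have n': "n = DIM(real^'n)" using n by simp
  have AEp: "AE x in ?M. x \<in> pball"
  proof -
    interpret rs: radial_scaling p n R 1 using p pn R by unfold_locales auto
    show ?thesis by (rule rs.AE_pball)
  qed
  obtain E where E: "0 \<le> E" "\<And>s. \<bar>gradient plateau s\<bar> \<le> E" "\<And>s. 2 < \<bar>s\<bar> \<Longrightarrow> gradient plateau s = 0"
    using plateau_deriv_bound by metis
  define c where "c = (p - 1) / p"
  have c: "0 < c" using p by (simp add: c_def)
  \<comment> \<open>The first summand is the constant up to a factor tending to 1; the second is the
    price of the cutoff, with the factor 2 from doubling and (E / k)^p from the derivative of the
    plateau.\<close>
  have main: "C \<le> (1 - \<theta>) powr (1 - p) * c powr p + 2 * (\<theta> powr (1 - p) * (E / k) powr p)"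
    if \<theta>: "0 < \<theta>" "\<theta> < 1" and k: "0 < k" for \<theta> k
  proof -
    define \<alpha> where "\<alpha> = (1 - \<theta>) powr (1 - p) * c powr p"
    define \<beta> where "\<beta> = \<theta> powr (1 - p) * (E / k) powr p"
    have \<alpha>\<beta>: "0 \<le> \<alpha>" "0 \<le> \<beta>" by (simp_all add: \<alpha>_def \<beta>_def)
    define u where "u = (extremal k :: real^'n \<Rightarrow> real)"
    have u: "u \<in> test_functions (ball 0 R - {0})" unfolding u_def by (rule extremal_test_function[OF k])
    have smu: "smooth_on UNIV u" using test_functionsE[OF u] by metis
    define A where "A = (LINT x|?M. hardy_weight p R x * \<bar>u x\<bar> powr p)"
    have lhs: "hardy_lhs p R u = ennreal A"
      unfolding hardy_lhs_eq A_def
      using hardy_test_function(1)[OF p _ u] pn n'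
      by (intro nn_integral_eq_integral AE_I2 mult_nonneg_nonneg hardy_weight_nonneg) auto
    have lhs': "hardy_lhs p R u = (\<integral>\<^sup>+x. ennreal (log_weight x * plateau (ln (time x) / k) powr p) \<partial>?M)"
      unfolding hardy_lhs_eq
      by (rule nn_integral_cong_AE, use AEp in eventually_elim) (simp add: u_def hardy_weight_extremal)
    have mass: "log_mass TYPE(real^'n) k \<le> hardy_lhs p R u"
      unfolding lhs' log_mass_def
    proof (rule nn_integral_mono)
      fix x :: "real^'n"
      show "ennreal (log_weight x * indicator {x. \<bar>ln (time x)\<bar> \<le> k} x) \<le> ennreal (log_weight x * plateau (ln (time x) / k) powr p)"
      proof (cases "\<bar>ln (time x)\<bar> \<le> k")
        case True
        then have "\<bar>ln (time x) / k\<bar> \<le> 1" using k by simp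
        then show ?thesis by (simp add: plateau_simps(1) True)
      qed simp
    qed
    \<comment> \<open>The left-hand side is finite and, by the positive mass, nonzero; this allows A
      to be cancelled at the end.\<close>
    have A: "0 < A" using log_mass_pos[OF n' k] mass unfolding lhs by (metis ennreal_less_zero_iff less_le_trans)
    have m: "(\<lambda>x. ennreal (log_weight x * plateau (ln (time x) / k) powr p)) \<in> borel_measurable ?M"
      "(\<lambda>x::real^'n. ennreal (log_weight x * indicator {x. \<bar>ln (time x)\<bar> \<le> 2 * k} x)) \<in> borel_measurable ?M"
    proof -
      have [measurable]: "plateau \<in> borel_measurable borel"
        by (intro borel_measurable_continuous_onI smooth_on_continuous smooth_on_plateau)
      show "(\<lambda>x. ennreal (log_weight x * plateau (ln (time x) / k) powr p)) \<in> borel_measurable ?M"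
        "(\<lambda>x::real^'n. ennreal (log_weight x * indicator {x. \<bar>ln (time x)\<bar> \<le> 2 * k} x)) \<in> borel_measurable ?M"
        by (intro measurable_restrict_space1 measurable_completion, measurable)+
    qed
    have "hardy_rhs p R u = (\<integral>\<^sup>+x. ennreal (\<bar>(x /\<^sub>R norm x) \<bullet> gradient u x\<bar> powr p) \<partial>?M)"
      by (rule hardy_rhs_eq[OF has_weak_gradient_gradient[OF smu open_ball]])
    also have "\<dots> \<le> (\<integral>\<^sup>+x. ennreal \<alpha> * ennreal (log_weight x * plateau (ln (time x) / k) powr p) +
        ennreal \<beta> * ennreal (log_weight x * indicator {x. \<bar>ln (time x)\<bar> \<le> 2 * k} x) \<partial>?M)"
    proof (rule nn_integral_mono_AE, use AEp in eventually_elim)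
      fix x :: "real^'n" assume x: "x \<in> pball"
      define s where "s = ln (time x) / k"
      define i where "i = (indicator {x. \<bar>ln (time x)\<bar> \<le> 2 * k} x :: real)"
      have "\<bar>c * plateau s + gradient plateau s / k\<bar> powr p \<le>
          (1 - \<theta>) powr (1 - p) * \<bar>c * plateau s\<bar> powr p + \<theta> powr (1 - p) * \<bar>gradient plateau s / k\<bar> powr p"
        using norm_powr_add_le_convex[of p \<theta> "c * plateau s + gradient plateau s / k" "c * plateau s"] p \<theta> by simp
      moreover have "(1 - \<theta>) powr (1 - p) * \<bar>c * plateau s\<bar> powr p = \<alpha> * plateau s powr p"
        using c plateau_simps(3)[of s] by (simp add: \<alpha>_def abs_mult powr_mult)
      moreover have "\<theta> powr (1 - p) * \<bar>gradient plateau s / k\<bar> powr p \<le> \<beta> * i"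
      proof (cases "\<bar>ln (time x)\<bar> \<le> 2 * k")
        case True
        have "\<bar>gradient plateau s / k\<bar> powr p \<le> (E / k) powr p"
          using E(2)[of s] k p by (intro powr_mono2) (auto simp: divide_right_mono)
        then show ?thesis using True by (simp add: \<beta>_def i_def mult_left_mono)
      next
        case False
        then have "2 < \<bar>s\<bar>" using k by (simp add: s_def field_simps)
        then show ?thesis using E(3)[of s] p False by (simp add: i_def)
      qed
      ultimately have "\<bar>c * plateau s + gradient plateau s / k\<bar> powr p \<le> \<alpha> * plateau s powr p + \<beta> * i" by linarith
      then have "log_weight x * \<bar>c * plateau s + gradient plateau s / k\<bar> powr p \<le> log_weight x * (\<alpha> * plateau s powr p + \<beta> * i)"
        by (rule mult_left_mono[OF _ log_weight_nonneg])
      also have "\<dots> = \<alpha> * (log_weight x * plateau s powr p) + \<beta> * (log_weight x * i)" by (simp add: algebra_simps)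
      finally have "\<bar>(x /\<^sub>R norm x) \<bullet> gradient u x\<bar> powr p \<le> \<alpha> * (log_weight x * plateau s powr p) + \<beta> * (log_weight x * i)"
        using radial_derivative_extremal[OF n' k x] by (simp add: u_def c_def s_def)
      then have "ennreal (\<bar>(x /\<^sub>R norm x) \<bullet> gradient u x\<bar> powr p) \<le>
          ennreal (\<alpha> * (log_weight x * plateau s powr p) + \<beta> * (log_weight x * i))" by (rule ennreal_leI)
      also have "\<dots> = ennreal \<alpha> * ennreal (log_weight x * plateau s powr p) + ennreal \<beta> * ennreal (log_weight x * i)"
        using \<alpha>\<beta> log_weight_nonneg[of x] by (simp add: ennreal_mult' ennreal_plus i_def)
      finally show "ennreal (\<bar>(x /\<^sub>R norm x) \<bullet> gradient u x\<bar> powr p) \<le>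
          ennreal \<alpha> * ennreal (log_weight x * plateau (ln (time x) / k) powr p) +
          ennreal \<beta> * ennreal (log_weight x * indicator {x. \<bar>ln (time x)\<bar> \<le> 2 * k} x)"
        by (simp only: s_def i_def)
    qed
    also have "\<dots> = ennreal \<alpha> * hardy_lhs p R u + ennreal \<beta> * log_mass TYPE(real^'n) (2 * k)"
      unfolding lhs' log_mass_def using m by (simp add: nn_integral_add nn_integral_cmult)
    also have "\<dots> \<le> ennreal \<alpha> * hardy_lhs p R u + ennreal \<beta> * (2 * hardy_lhs p R u)"
      by (intro add_left_mono mult_left_mono order_trans[OF log_mass_double[OF n'] mult_left_mono[OF mass]])
         (use k in auto)
    also have "\<dots> = ennreal ((\<alpha> + 2 * \<beta>) * A)"
      using \<alpha>\<beta> A unfolding lhs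
      by (simp add: ennreal_mult' distrib_left distrib_right mult_ac flip: ennreal_numeral)
    finally have "ennreal C * ennreal A \<le> ennreal ((\<alpha> + 2 * \<beta>) * A)" using C[OF u] unfolding lhs by (rule order_trans[rotated])
    then have "ennreal (C * A) \<le> ennreal ((\<alpha> + 2 * \<beta>) * A)" using A by (simp add: ennreal_mult'')
    then have "C * A \<le> (\<alpha> + 2 * \<beta>) * A" using A \<alpha>\<beta> by (subst (asm) ennreal_le_iff) auto
    then show ?thesis using A by (simp add: \<alpha>_def \<beta>_def)
  qed
  \<comment> \<open>k tends to infinity at fixed \<theta>, which removes the price of the cutoff;
    only afterwards does \<theta> tend to 0, since \<theta>^(1-p) is unbounded.\<close>
  have "C \<le> (1 - \<theta>) powr (1 - p) * c powr p" if \<theta>: "0 < \<theta>" "\<theta> < 1" for \<theta>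
  proof (rule tendsto_lowerbound)
    have "((\<lambda>k. (1 - \<theta>) powr (1 - p) * c powr p + 2 * (\<theta> powr (1 - p) * (E / real (Suc k)) powr p)) \<longlonglongrightarrow>
        (1 - \<theta>) powr (1 - p) * c powr p + 2 * (\<theta> powr (1 - p) * 0))"
    proof (intro tendsto_intros tendsto_zero_powrI[where b=p])
      show "(\<lambda>k. E / real (Suc k)) \<longlonglongrightarrow> 0"
        using tendsto_mult_right_zero[OF LIMSEQ_inverse_real_of_nat, of E] by (simp add: divide_inverse)
    qed (use E p in auto)
    then show "(\<lambda>k. (1 - \<theta>) powr (1 - p) * c powr p + 2 * (\<theta> powr (1 - p) * (E / real (Suc k)) powr p)) \<longlonglongrightarrow>
        (1 - \<theta>) powr (1 - p) * c powr p" by simp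
    show "\<forall>\<^sub>F k in sequentially. C \<le> (1 - \<theta>) powr (1 - p) * c powr p + 2 * (\<theta> powr (1 - p) * (E / real (Suc k)) powr p)"
      using main[OF \<theta>] by (intro always_eventually allI) simp
  qed simp
  then have "C \<le> c powr p" by (rule le_of_le_mult_powr)
  then show ?thesis by (simp add: c_def)
qed

end

lemma has_weak_gradient_cong:
  fixes u v :: "'a::euclidean_space \<Rightarrow> real"
  assumes "\<Omega> \<in> sets lebesgue" "\<And>x. x \<in> \<Omega> \<Longrightarrow> u x = v x"
  shows "has_weak_gradient \<Omega> u G \<longleftrightarrow> has_weak_gradient \<Omega> v G"
proof -
  have "integrable (lebesgue_on K) u \<longleftrightarrow> integrable (lebesgue_on K) v" if "K \<subseteq> \<Omega>" for K
    by (rule Bochner_Integration.integrable_cong) (use that assms(2) in auto)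
  then have "locally_integrable \<Omega> u \<longleftrightarrow> locally_integrable \<Omega> v" unfolding locally_integrable_def by blast
  moreover have "(LINT x|lebesgue_on \<Omega>. u x * f x) = (LINT x|lebesgue_on \<Omega>. v x * f x)" for f
    by (rule Bochner_Integration.integral_cong) (use assms(2) in auto)
  ultimately show ?thesis unfolding has_weak_gradient_def by simp
qed

text \<open>Elements of the space are functions with arbitrary values off \<Omega>, and
  \<open>scaled_fun\<close> is identified with \<open>push\<close> only inside the ball.\<close>

lemma sobolev_W1_0_cong:
  fixes u v :: "'a::euclidean_space \<Rightarrow> real"
  assumes \<Omega>: "open \<Omega>" and p: "1 \<le> p" and eq: "\<And>x. x \<in> \<Omega> \<Longrightarrow> u x = v x" and u: "u \<in> sobolev_W1_0 \<Omega> p"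
  shows "v \<in> sobolev_W1_0 \<Omega> p"
proof -
  have "has_weak_gradient \<Omega> u G \<longleftrightarrow> has_weak_gradient \<Omega> v G" for G
    by (rule has_weak_gradient_cong[OF _ eq]) (use \<Omega> in auto)
  moreover have "in_Lp \<Omega> p u \<longleftrightarrow> in_Lp \<Omega> p v"
    unfolding in_Lp_def
    by (intro conj_cong measurable_lebesgue_cong Bochner_Integration.integrable_cong) (use eq in auto)
  moreover have "(LINT x|lebesgue_on \<Omega>. \<bar>u x - \<phi> x\<bar> powr p + norm (G x - gradient \<phi> x) powr p) =
      (LINT x|lebesgue_on \<Omega>. \<bar>v x - \<phi> x\<bar> powr p + norm (G x - gradient \<phi> x) powr p)" for \<phi> G
    by (rule Bochner_Integration.integral_cong) (use eq in auto)
  ultimately show ?thesis using u unfolding sobolev_W1_0_iff[OF \<Omega> p] by simp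
qed

theorem corollary1p1:
  fixes p R :: real
  assumes "1 < p" and "p < real CARD('n)" and "0 < R"
  shows "(\<forall>u \<in> sobolev_W1_0 (ball (0 :: real ^ 'n) R) p.
            ennreal (((p - 1) / p) powr p) * hardy_lhs p R u \<le> hardy_rhs p R u)
    \<and> (\<forall>C > ((p - 1) / p) powr p.
          \<not> (\<forall>u \<in> sobolev_W1_0 (ball (0 :: real ^ 'n) R) p.
                ennreal C * hardy_lhs p R u \<le> hardy_rhs p R u))
    \<and> (\<forall>l > 0. \<forall>u \<in> sobolev_W1_0 (ball (0 :: real ^ 'n) R) p.
          scaled_fun p R l u \<in> sobolev_W1_0 (ball 0 R) p \<and>
          hardy_lhs p R (scaled_fun p R l u) = hardy_lhs p R u \<and>
          hardy_rhs p R (scaled_fun p R l u) = hardy_rhs p R u)"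
proof (intro conjI allI impI ballI)
  fix u :: "real ^ 'n \<Rightarrow> real" assume "u \<in> sobolev_W1_0 (ball 0 R) p"
  then show "ennreal (((p - 1) / p) powr p) * hardy_lhs p R u \<le> hardy_rhs p R u"
    by (rule hardy_inequality[OF assms(1,2)])
next
  fix C assume C: "((p - 1) / p) powr p < C"
  interpret ho: hardy_optimality p "real CARD('n)" R using assms by unfold_locales
  show "\<not> (\<forall>u \<in> sobolev_W1_0 (ball (0 :: real ^ 'n) R) p. ennreal C * hardy_lhs p R u \<le> hardy_rhs p R u)"
  proof
    assume *: "\<forall>u \<in> sobolev_W1_0 (ball (0 :: real ^ 'n) R) p. ennreal C * hardy_lhs p R u \<le> hardy_rhs p R u"
    have "C \<le> ((p - 1) / p) powr p"
    proof (rule ho.hardy_constant_optimal[OF refl])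
      fix u :: "real ^ 'n \<Rightarrow> real" assume "u \<in> test_functions (ball 0 R - {0})"
      then have "u \<in> test_functions (ball 0 R)" using test_functions_mono[of "ball 0 R - {0}" "ball 0 R"] by auto
      then have "u \<in> sobolev_W1_0 (ball 0 R) p"
        using assms(1) by (intro test_functions_subset_sobolev_W1_0) auto
      with * show "ennreal C * hardy_lhs p R u \<le> hardy_rhs p R u" by blast
    qed
    with C show False by simp
  qed
next
  fix l :: real and u :: "real ^ 'n \<Rightarrow> real" assume l: "0 < l" and u: "u \<in> sobolev_W1_0 (ball 0 R) p"
  interpret rs: radial_scaling p "real CARD('n)" R l using assms l by unfold_locales
  have pn: "p < DIM(real^'n)" and n: "real CARD('n) = DIM(real^'n)" using assms by auto
  obtain G where G: "has_weak_gradient (ball 0 R) u G" "in_Lp (ball 0 R) p u" "in_Lp (ball 0 R) p G"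
    and appr: "\<And>e. e > 0 \<Longrightarrow> \<exists>\<psi>\<in>test_functions (ball 0 R - {0}).
      (LINT x|lebesgue_on (ball 0 R). \<bar>u x - \<psi> x\<bar> powr p + norm (G x - gradient \<psi> x) powr p) < e"
    using sobolev_W1_0_punctured_approx[OF open_ball _ pn u] assms(1) by auto
  note push = rs.push_sobolev[OF n G(2,3) appr]
  have eq: "scaled_fun p R l u x = rs.push u x" if "x \<in> ball 0 R" for x
    by (rule rs.push_eq_scaled_fun[OF refl that])
  show "scaled_fun p R l u \<in> sobolev_W1_0 (ball 0 R) p"
    by (rule sobolev_W1_0_cong[OF open_ball _ _ push(2)]) (use assms(1) eq in auto)
  have "hardy_lhs p R (scaled_fun p R l u) = hardy_lhs p R (rs.push u)"
    unfolding hardy_lhs_def by (rule nn_integral_cong) (simp add: eq)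
  also have "\<dots> = hardy_lhs p R u"
    by (rule rs.hardy_lhs_push[OF refl]) (use G(2) in \<open>simp add: in_Lp_def\<close>)
  finally show "hardy_lhs p R (scaled_fun p R l u) = hardy_lhs p R u" .
  \<comment> \<open>The predicates are compared as a whole because \<open>weak_gradient\<close>
    chooses from them; equal predicates give the same choice.\<close>
  have "has_weak_gradient (ball 0 R) (scaled_fun p R l u) = has_weak_gradient (ball 0 R) (rs.push u)"
    using has_weak_gradient_cong[of "ball 0 R" "scaled_fun p R l u" "rs.push u"] eq by auto
  then have "hardy_rhs p R (scaled_fun p R l u) = hardy_rhs p R (rs.push u)"
    unfolding hardy_rhs_def radial_gradient_def weak_gradient_def by simp
  also have "\<dots> = hardy_rhs p R u"
    by (rule rs.hardy_rhs_push[OF refl G(1) _ push(1)]) (use G(3) in \<open>simp add: in_Lp_def\<close>)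
  finally show "hardy_rhs p R (scaled_fun p R l u) = hardy_rhs p R u" .
qed

end
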